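(* Let $K\ge1$, $n_1,\ldots,n_K\ge2$, $n=\sum_kn_k$, and let $C=QDQ'$ be a nonsingular $n\times n$ block correlation matrix with canonical $K\times K$ block $A$ and $\lambda_k=(n_k-A_{kk})/(n_k-1)$ (see context). Let $U=(U_1',\ldots,U_K')'$, $U_k=(U_{k,1},\ldots,U_{k,n_k})'$, have mutually independent entries $U_{k,i}\sim t^{\mathrm{std}}_{\nu_{k,i}}(0,1)$ with $\nu_{k,i}>2$, and let $Z=C^{1/2}U$ (the Hetero-$t$ convolution-$t$ distribution with a block correlation matrix). Let $\ell$ be the log-density of $Z$ viewed as a function of $A$, $\nabla_A=\partial\ell/\partial\mathrm{vec}(A)$, $\mathcal I_A=\mathbb E[\nabla_A\nabla_A']$. Then $$\nabla_A=\Omega_A\Big[\sum_{k=1}^K\sum_{i=1}^{n_k}W_{k,i}U_{k,i}\mathrm{vec}(e_kX_0')n_k^{-1/2}-\mathrm{vec}(I_K)\Big]+\tfrac12E_d'S,$$ $$\mathcal I_A=\Omega_A(K_K+\Upsilon^e_K)\Omega_A+\tfrac14E_d'\Xi E_d+\tfrac12E_d'\Theta\Omega_A+\tfrac12\Omega_A\Theta'E_d,$$ where $\Omega_A=(I_K\otimes A^{-1/2})(A^{1/2}\oplus I_K)^{-1}$, $e_k$ is the $k$-th column of $I_K$, $J_k^e=e_ke_k'$, $J^e_{k\otimes}=J_k^e\otimes J_k^e$, $$S_k=\frac1{\lambda_k}-\frac{\sum_{i=1}^{n_k}W_{k,i}U_{k,i}F_{k,i}U_k}{(n_k-1)\lambda_k},\quad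 W_{k,i}=\frac{\nu_{k,i}+1}{\nu_{k,i}-2+U_{k,i}^2},\quad F_{k,i}=\tilde e_i'(I_{n_k}-v_{n_k}v_{n_k}'),$$ $\tilde e_i$ the $i$-th column of $I_{n_k}$, $\Upsilon^e_K=\sum_{k=1}^K\Psi^e_k$ with $\Psi^e_k=n_k^{-1}(3\bar\phi_k-2-\bar\psi_k)J^e_{k\otimes}+\bar\psi_k(I_K\otimes J_k^e)$, $\bar\phi_k=\frac1{n_k}\sum_i\phi_{k,i}$, $\bar\psi_k=\frac1{n_k}\sum_i\psi_{k,i}$, $\Xi$ diagonal with $\Xi_{kk}=\lambda_k^{-2}n_k^{-1}[3\bar\phi_k-1+(\bar\psi_k+1)(n_k-1)^{-1}]$, and $\Theta=\sum_{k=1}^K\lambda_k^{-1}n_k^{-1}(\bar\psi_k+2-3\bar\phi_k)e_k\mathrm{vec}(J_k^e)'$.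
   Context: $t^{\mathrm{std}}_\nu(0,1)$ ($\nu>2$) is the univariate $t$-distribution with density $\frac{\Gamma((\nu+1)/2)}{\Gamma(\nu/2)}[(\nu-2)\pi]^{-1/2}[1+\tfrac{u^2}{\nu-2}]^{-(\nu+1)/2}$ (unit variance). $\phi_{k,i}=\frac{\nu_{k,i}+1}{\nu_{k,i}+3}$ and $\psi_{k,i}=\phi_{k,i}\frac{\nu_{k,i}}{\nu_{k,i}-2}$. Block setting: $v_m=m^{-1/2}(1,\ldots,1)'\in\mathbb R^m$, $v_m^\perp$ an $m\times(m-1)$ matrix with orthonormal columns orthogonal to $v_m$; $Q=[\mathrm{blockdiag}(v_{n_1},\ldots,v_{n_K}),\ \mathrm{blockdiag}(v_{n_1}^\perp,\ldots,v_{n_K}^\perp)]$. A block correlation matrix $C$ (consecutive groups of sizes $n_k$, $(k,l)$ block constant $\rho_{kl}$ off the unit diagonal) satisfies $C=QDQ'$, $D=\mathrm{blockdiag}(A,\lambda_1I_{n_1-1},\ldots,\lambda_KI_{n_K-1})$, $A$ symmetric positive definite with $A_{kl}=\rho_{kl}\sqrt{n_kn_l}$ ($k\ne l$), $A_{kk}=1+(n_k-1)\rho_{kk}$, $\lambda_k=(n_k-A_{kk})/(n_k-1)>0$; $C$ is thereby a function of $A$. Square roots are symmetric positive definite. With $Y=Q'Z=(Y_0',\ldots,Y_K')'$, $Y_0\in\mathbb R^K$: $X_0=A^{-1/2}Y_0$. Notation: $B\oplus B'=B\otimes B'+B'\otimes B$; $K_K$ is the $K^2\times K^2$ commutation matrix;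 $E_d$ is the $K\times K^2$ matrix with $E_d\mathrm{vec}(B)=\mathrm{diag}(B)$.
   Formalization: Since ℓ is defined only for symmetric A, ∇_A=∂ℓ/∂vec(A) is read as: the stated vector gives dℓ=∇_A'vec(dA) for the derivative of ℓ along symmetric matrices; this fixes ∇_A only up to its antisymmetric part, and I_A is computed for the stated vector. *)

theory Defs
  imports "HOL-Analysis.Analysis"
begin

definition t_std_dens :: "real \<Rightarrow> real \<Rightarrow> real" where
  "t_std_dens \<nu> u = Gamma ((\<nu> + 1) / 2) / Gamma (\<nu> / 2) * ((\<nu> - 2) * pi) powr (-1/2)
      * (1 + u\<^sup>2 / (\<nu> - 2)) powr (- (\<nu> + 1) / 2)"

definition symm_mat :: "real^'n::finite^'n \<Rightarrow> bool" where
  "symm_mat M \<longleftrightarrow> transpose M = M"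

definition posdef :: "real^'n::finite^'n \<Rightarrow> bool" where
  "posdef M \<longleftrightarrow> (\<forall>x. x \<noteq> 0 \<longrightarrow> 0 < x \<bullet> (M *v x))"

definition msqrt :: "real^'n::finite^'n \<Rightarrow> real^'n::finite^'n" where
  "msqrt M = (THE S. symm_mat S \<and> posdef S \<and> S ** S = M)"

text \<open>Column-major vec, indexed by (row, column).\<close>
definition vecm :: "real^'n::finite^'n \<Rightarrow> real^('n::finite \<times> 'n)" where
  "vecm M = (\<chi> p. M $ fst p $ snd p)"

definition outerp :: "real^'m::finite \<Rightarrow> real^'n::finite \<Rightarrow> real^'n^'m" where
  "outerp x y = (\<chi> i j. x $ i * y $ j)"

text \<open>Kronecker product, consistent with vecm: kron B C *v vecm X = vecm (C ** X ** transpose B).\<close>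
definition kron :: "real^'n::finite^'n \<Rightarrow> real^'n::finite^'n \<Rightarrow> real^('n::finite \<times> 'n)^('n \<times> 'n)" where
  "kron B C = (\<chi> p q. B $ snd p $ snd q * C $ fst p $ fst q)"

definition kplus :: "real^'n::finite^'n \<Rightarrow> real^'n::finite^'n \<Rightarrow> real^('n::finite \<times> 'n)^('n \<times> 'n)" where
  "kplus B C = kron B C + kron C B"

text \<open>Commutation matrix: commK *v vecm X = vecm (transpose X).\<close>
definition commK :: "real^('n::finite \<times> 'n)^('n \<times> 'n)" where
  "commK = (\<chi> p q. if fst p = snd q \<and> snd p = fst q then 1 else 0)"

text \<open>E_d: E_d *v vecm B = diagonal of B.\<close>
definition Ed :: "real^('n::finite \<times> 'n)^'n" where
  "Ed = (\<chi> k p. if fst p = k \<and> snd p = k then 1 else 0)"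

definition ev :: "'n \<Rightarrow> real^'n" where
  "ev k = axis k 1"

definition Je :: "'n::finite \<Rightarrow> real^'n::finite^'n" where
  "Je k = outerp (ev k) (ev k)"

text \<open>Block structure: observation a belongs to block g a; block sizes.\<close>
definition nb :: "('i::finite \<Rightarrow> 'k) \<Rightarrow> 'k \<Rightarrow> real" where
  "nb g k = real (card {a. g a = k})"

definition lam :: "('i::finite \<Rightarrow> 'k) \<Rightarrow> real^'k^'k \<Rightarrow> 'k \<Rightarrow> real" where
  "lam g A k = (nb g k - A $ k $ k) / (nb g k - 1)"

definition blockC :: "('i::finite \<Rightarrow> 'k) \<Rightarrow> real^'k^'k \<Rightarrow> real^'i^'i" where
  "blockC g A = (\<chi> a b. if a = b then 1
      else if g a = g b then (A $ g a $ g a - 1) / (nb g (g a) - 1)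
      else A $ g a $ g b / sqrt (nb g (g a) * nb g (g b)))"

text \<open>Log-density of Z = C^(1/2) U as a function of A (change of variables).\<close>
definition loglik :: "('i::finite \<Rightarrow> 'k) \<Rightarrow> ('i \<Rightarrow> real) \<Rightarrow> real^'k^'k \<Rightarrow> real^'i \<Rightarrow> real" where
  "loglik g \<nu> A z = - (1/2) * ln (det (blockC g A))
     + (\<Sum>a\<in>UNIV. ln (t_std_dens (\<nu> a) ((matrix_inv (msqrt (blockC g A)) *v z) $ a)))"

text \<open>Y_0 = block averages scaled by sqrt(n_k), i.e. v_{n_k}' Z_k.\<close>
definition Y0 :: "('i::finite \<Rightarrow> 'k::finite) \<Rightarrow> real^'i \<Rightarrow> real^'k" where
  "Y0 g z = (\<chi> k. (\<Sum>a\<in>{a. g a = k}. z $ a) / sqrt (nb g k))"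

definition X0 :: "('i::finite \<Rightarrow> 'k::finite) \<Rightarrow> real^'k^'k \<Rightarrow> real^'i \<Rightarrow> real^'k" where
  "X0 g A z = matrix_inv (msqrt A) *v Y0 g z"

definition Uv :: "('i::finite \<Rightarrow> 'k) \<Rightarrow> real^'k^'k \<Rightarrow> real^'i \<Rightarrow> real^'i" where
  "Uv g A z = matrix_inv (msqrt (blockC g A)) *v z"

definition Wt :: "('i \<Rightarrow> real) \<Rightarrow> real^'i \<Rightarrow> 'i \<Rightarrow> real" where
  "Wt \<nu> u a = (\<nu> a + 1) / (\<nu> a - 2 + (u $ a)\<^sup>2)"

text \<open>F_{k,i} U_k = e_i'(I - v v') U_k: deviation from the block mean.\<close>
definition FU :: "('i::finite \<Rightarrow> 'k) \<Rightarrow> real^'i \<Rightarrow> 'i \<Rightarrow> real" where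
  "FU g u a = u $ a - (\<Sum>b\<in>{b. g b = g a}. u $ b) / nb g (g a)"

definition Svec :: "('i::finite \<Rightarrow> 'k::finite) \<Rightarrow> ('i \<Rightarrow> real) \<Rightarrow> real^'k^'k \<Rightarrow> real^'i \<Rightarrow> real^'k" where
  "Svec g \<nu> A z = (let u = Uv g A z in
     (\<chi> k. 1 / lam g A k
        - (\<Sum>a\<in>{a. g a = k}. Wt \<nu> u a * u $ a * FU g u a) / ((nb g k - 1) * lam g A k)))"

definition OmegaA :: "real^'k^'k \<Rightarrow> real^('k \<times> 'k)^('k \<times> 'k)" where
  "OmegaA A = kron (mat 1) (matrix_inv (msqrt A)) ** matrix_inv (kplus (msqrt A) (mat 1))"

definition gradA :: "('i::finite \<Rightarrow> 'k::finite) \<Rightarrow> ('i \<Rightarrow> real) \<Rightarrow> real^'k^'k \<Rightarrow> real^'i \<Rightarrow> real^('k \<times> 'k)" where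
  "gradA g \<nu> A z = (let u = Uv g A z; x0 = X0 g A z in
     OmegaA A *v ((\<Sum>a\<in>UNIV. (Wt \<nu> u a * u $ a / sqrt (nb g (g a))) *\<^sub>R vecm (outerp (ev (g a)) x0))
                  - vecm (mat 1))
     + (1/2) *\<^sub>R (transpose Ed *v Svec g \<nu> A z))"

definition phi :: "real \<Rightarrow> real" where "phi \<nu> = (\<nu> + 1) / (\<nu> + 3)"
definition psi :: "real \<Rightarrow> real" where "psi \<nu> = phi \<nu> * \<nu> / (\<nu> - 2)"

definition phibar :: "('i::finite \<Rightarrow> 'k) \<Rightarrow> ('i \<Rightarrow> real) \<Rightarrow> 'k \<Rightarrow> real" where
  "phibar g \<nu> k = (\<Sum>a\<in>{a. g a = k}. phi (\<nu> a)) / nb g k"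
definition psibar :: "('i::finite \<Rightarrow> 'k) \<Rightarrow> ('i \<Rightarrow> real) \<Rightarrow> 'k \<Rightarrow> real" where
  "psibar g \<nu> k = (\<Sum>a\<in>{a. g a = k}. psi (\<nu> a)) / nb g k"

definition Psie :: "('i::finite \<Rightarrow> 'k::finite) \<Rightarrow> ('i \<Rightarrow> real) \<Rightarrow> 'k \<Rightarrow> real^('k \<times> 'k)^('k \<times> 'k)" where
  "Psie g \<nu> k = ((3 * phibar g \<nu> k - 2 - psibar g \<nu> k) / nb g k) *\<^sub>R kron (Je k) (Je k)
       + psibar g \<nu> k *\<^sub>R kron (mat 1) (Je k)"

definition Upse :: "('i::finite \<Rightarrow> 'k::finite) \<Rightarrow> ('i \<Rightarrow> real) \<Rightarrow> real^('k \<times> 'k)^('k \<times> 'k)" where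
  "Upse g \<nu> = (\<Sum>k\<in>UNIV. Psie g \<nu> k)"

definition XiM :: "('i::finite \<Rightarrow> 'k::finite) \<Rightarrow> ('i \<Rightarrow> real) \<Rightarrow> real^'k^'k \<Rightarrow> real^'k^'k" where
  "XiM g \<nu> A = (\<chi> k l. if k = l then
      (3 * phibar g \<nu> k - 1 + (psibar g \<nu> k + 1) / (nb g k - 1)) / ((lam g A k)\<^sup>2 * nb g k) else 0)"

definition ThetaM :: "('i::finite \<Rightarrow> 'k::finite) \<Rightarrow> ('i \<Rightarrow> real) \<Rightarrow> real^'k^'k \<Rightarrow> real^('k \<times> 'k)^'k" where
  "ThetaM g \<nu> A = (\<Sum>k\<in>UNIV. ((psibar g \<nu> k + 2 - 3 * phibar g \<nu> k) / (lam g A k * nb g k))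
      *\<^sub>R outerp (ev k) (vecm (Je k)))"

definition InfoA :: "('i::finite \<Rightarrow> 'k::finite) \<Rightarrow> ('i \<Rightarrow> real) \<Rightarrow> real^'k^'k \<Rightarrow> real^('k \<times> 'k)^('k \<times> 'k)" where
  "InfoA g \<nu> A = OmegaA A ** (commK + Upse g \<nu>) ** OmegaA A
     + (1/4) *\<^sub>R (transpose Ed ** XiM g \<nu> A ** Ed)
     + (1/2) *\<^sub>R (transpose Ed ** ThetaM g \<nu> A ** OmegaA A)
     + (1/2) *\<^sub>R (OmegaA A ** transpose (ThetaM g \<nu> A) ** Ed)"

definition lawU :: "('i::finite \<Rightarrow> real) \<Rightarrow> (real^'i) measure" where
  "lawU \<nu> = density lborel (\<lambda>u. ennreal (\<Prod>a\<in>UNIV. t_std_dens (\<nu> a) (u $ a)))"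

end

theory Submission
  imports Defs
begin

text \<open>
  Write \<open>S = A\<^sup>1\<^sup>/\<^sup>2\<close>. The map \<open>(M, l) \<mapsto> Q blockdiag(M, l\<^sub>1 I, \<dots>, l\<^sub>K I) Q'\<close> is multiplicative, so
  \<open>C\<^sup>1\<^sup>/\<^sup>2\<close>, its inverse and \<open>C\<^sup>-\<^sup>1\<close> are explicit in \<open>S\<close> and \<open>\<lambda>\<close>. The derivative \<open>D\<close> of the square root in
  direction \<open>H\<close> solves \<open>S D + D S = H\<close>, which is what \<open>\<Omega>\<^sub>A vec(H) = vec(S\<^sup>-\<^sup>1 D)\<close> encodes;
  uniqueness and differentiability of the root come from the coercivity \<open>\<langle>X, T X + X S\<rangle> \<ge> m |X|\<^sup>2\<close>
  for positive definite \<open>S, T\<close>, its existence from the contraction \<open>X \<mapsto> (E + X\<^sup>2) / 2\<close> with \<open>E = I - A / c\<close>. The log-determinant is differentiated by Jacobi's formula. With \<open>w\<^sub>a = W\<^sub>a U\<^sub>a\<close>, every entry of the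
  score is a combination of forms \<open>\<Sum>\<^sub>a\<^sub>b \<alpha>\<^sub>a\<^sub>b (w\<^sub>a U\<^sub>b - \<delta>\<^sub>a\<^sub>b)\<close>, and two such forms have covariance
  \<open>\<Sum>\<^sub>a\<^sub>b \<alpha>\<^sub>a\<^sub>b \<beta>\<^sub>b\<^sub>a + \<Sum>\<^sub>a\<^sub>b \<alpha>\<^sub>a\<^sub>b \<beta>\<^sub>a\<^sub>b \<psi>\<^sub>a + \<Sum>\<^sub>a \<alpha>\<^sub>a\<^sub>a \<beta>\<^sub>a\<^sub>a (3 \<phi>\<^sub>a - 2 - \<psi>\<^sub>a)\<close>; the three terms give \<open>K\<^sub>K\<close>, the
  \<open>\<psi>\<close> part and the remaining parts of the information matrix.
\<close>

section \<open>Positive definite square roots\<close>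

text \<open>\<open>msqrt\<close> is a definite description that selects a root only at symmetric
  positive definite arguments, so the likelihood is differentiated within the symmetric matrices,
  and explicit formulas are matched with it only near \<open>A\<close>. Inverse and root are
  differentiated without an implicit function theorem: each has an exact algebraic remainder, which
  coercivity turns into a quadratic bound. The n x n root is never differentiated; C^(-1/2) z is
  first rewritten through the K x K root of \<open>A\<close> and the scalars lambda_k. For the
  expectation the score is evaluated at z = C^(1/2) u, where \<open>X0\<close> becomes the scaled
  block means of u. Then \<open>A\<close> enters only through \<open>OmegaA\<close> and lambda_k,
  and independence reduces everything to scalar moments. These are finite for every nu > 2 because W
  u is bounded, so that nothing beyond the second moment of u is required.\<close>

lemma matrix_inv_eq:
  fixes A B :: "real^'n::finite^'n"
  assumes "A ** B = mat 1"
  shows "matrix_inv A = B"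
proof -
  have BA: "B ** A = mat 1" using assms matrix_left_right_inverse by blast
  then have "A ** matrix_inv A = mat 1 \<and> matrix_inv A ** A = mat 1"
    unfolding matrix_inv_def using assms by (rule_tac someI[of _ B]) simp
  then show ?thesis
    by (metis BA matrix_mul_assoc matrix_mul_lid matrix_mul_rid)
qed

lemma bounded_bilinear_matrix_mult:
  "bounded_bilinear ((**) :: real^'n::finite^'m::finite \<Rightarrow> real^'p::finite^'n \<Rightarrow> real^'p^'m)"
proof -
  have "bilinear ((**) :: real^'n^'m \<Rightarrow> real^'p^'n \<Rightarrow> real^'p^'m)"
    unfolding bilinear_def
    by (auto intro!: linearI simp: matrix_matrix_mult_def vec_eq_iff algebra_simps sum.distrib sum_distrib_left)
  then show ?thesis by (simp add: bilinear_conv_bounded_bilinear)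
qed

interpretation matmul: bounded_bilinear "(**) :: real^'n::finite^'m::finite \<Rightarrow> real^'p::finite^'n \<Rightarrow> real^'p^'m"
  by (rule bounded_bilinear_matrix_mult)

lemma bounded_bilinear_matrix_vector_mult:
  "bounded_bilinear ((*v) :: real^'n::finite^'m::finite \<Rightarrow> real^'n \<Rightarrow> real^'m)"
proof -
  have "bilinear ((*v) :: real^'n^'m \<Rightarrow> real^'n \<Rightarrow> real^'m)"
    unfolding bilinear_def
    by (auto intro!: linearI simp: matrix_vector_mult_def vec_eq_iff algebra_simps sum.distrib sum_distrib_left)
  then show ?thesis by (simp add: bilinear_conv_bounded_bilinear)
qed

interpretation matvec: bounded_bilinear "(*v) :: real^'n::finite^'m::finite \<Rightarrow> real^'n \<Rightarrow> real^'m"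
  by (rule bounded_bilinear_matrix_vector_mult)

section \<open>Coercivity of the Sylvester operator in the Frobenius inner product\<close>

lemma inner_matrix_mult_left:
  fixes M D :: "real^'n::finite^'n"
  shows "D \<bullet> (M ** D) = (\<Sum>j\<in>UNIV. column j D \<bullet> (M *v column j D))"
proof -
  have "D \<bullet> (M ** D) = (\<Sum>i\<in>UNIV. \<Sum>j\<in>UNIV. D$i$j * (M *v column j D)$i)"
    by (simp add: inner_vec_def matrix_matrix_mult_def matrix_vector_mult_def column_def)
  also have "\<dots> = (\<Sum>j\<in>UNIV. \<Sum>i\<in>UNIV. D$i$j * (M *v column j D)$i)"
    by (rule sum.swap)
  finally show ?thesis by (simp add: inner_vec_def column_def)
qed

text \<open>Right multiplication acts on each row separately, as left multiplication does on
  columns. Either way a Frobenius form is a sum of quadratic forms of \<open>M\<close>, so bounds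
  for vectors become bounds for matrices.\<close>

lemma inner_matrix_mult_right:
  fixes M D :: "real^'n::finite^'n"
  shows "D \<bullet> (D ** M) = (\<Sum>i\<in>UNIV. row i D \<bullet> (M *v row i D))"
proof -
  have "D$i \<bullet> (D ** M)$i = row i D \<bullet> (M *v row i D)" for i
  proof -
    have "D$i \<bullet> (D ** M)$i = (\<Sum>j\<in>UNIV. \<Sum>k\<in>UNIV. D$i$j * (D$i$k * M$k$j))"
      by (simp add: inner_vec_def matrix_matrix_mult_def sum_distrib_left)
    also have "\<dots> = (\<Sum>k\<in>UNIV. \<Sum>j\<in>UNIV. D$i$k * (M$k$j * D$i$j))"
      by (subst sum.swap) (simp add: algebra_simps)
    finally show ?thesis
      by (simp add: inner_vec_def matrix_vector_mult_def row_def sum_distrib_left)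
  qed
  then show ?thesis by (simp add: inner_vec_def)
qed

lemma inner_matrix_rows: "(D::real^'n::finite^'n) \<bullet> D = (\<Sum>i\<in>UNIV. row i D \<bullet> row i D)"
  using inner_matrix_mult_right[of D "mat 1"] by simp

text \<open>The quadratic form attains a positive minimum on the compact unit sphere, and
  homogeneity extends the bound to all vectors.\<close>

lemma posdef_coercive:
  fixes M :: "real^'n::finite^'n"
  assumes "posdef M"
  obtains m where "m > 0" "\<And>x. m * (x \<bullet> x) \<le> x \<bullet> (M *v x)"
proof -
  have "compact (sphere (0::real^'n) 1)" "sphere (0::real^'n) 1 \<noteq> {}" by auto
  moreover have "continuous_on (sphere 0 1) (\<lambda>x. x \<bullet> (M *v x))"
    by (intro continuous_intros)
  ultimately obtain x0 where x0: "x0 \<in> sphere 0 1" "\<And>y. y \<in> sphere 0 1 \<Longrightarrow> x0 \<bullet> (M *v x0) \<le> y \<bullet> (M *v y)"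
    using continuous_attains_inf by metis
  have "x0 \<bullet> (M *v x0) * (x \<bullet> x) \<le> x \<bullet> (M *v x)" for x
  proof (cases "x = 0")
    case False
    define y where "y = (1 / norm x) *\<^sub>R x"
    have "y \<in> sphere 0 1" using False by (simp add: y_def)
    then have "x0 \<bullet> (M *v x0) \<le> y \<bullet> (M *v y)" by (rule x0)
    also have "\<dots> = (x \<bullet> (M *v x)) / (norm x)\<^sup>2"
      by (simp add: y_def matrix_vector_mult_scaleR power2_eq_square)
    finally show ?thesis using False
      by (simp add: power2_norm_eq_inner field_simps)
  qed simp
  moreover have "x0 \<bullet> (M *v x0) > 0"
    using assms x0(1) unfolding posdef_def by (metis mem_sphere dist_self zero_neq_one)
  ultimately show ?thesis using that by blast
qed

lemma posdef_coercive_mult_right: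
  fixes M D :: "real^'n::finite^'n"
  assumes "\<And>x. m * (x \<bullet> x) \<le> x \<bullet> (M *v x)"
  shows "m * (D \<bullet> D) \<le> D \<bullet> (D ** M)"
  unfolding inner_matrix_mult_right inner_matrix_rows sum_distrib_left
  by (intro sum_mono assms)

lemma posdef_mult_left_nonneg:
  fixes M D :: "real^'n::finite^'n"
  assumes "posdef M"
  shows "0 \<le> D \<bullet> (M ** D)"
proof -
  have "0 \<le> x \<bullet> (M *v x)" for x
    using assms by (cases "x = 0") (auto simp: posdef_def less_imp_le)
  then show ?thesis unfolding inner_matrix_mult_left by (intro sum_nonneg)
qed

text \<open>Only \<open>S\<close> supplies a quantitative bound: the \<open>T\<close> part
  contributes a nonnegative term, which is dropped, and Cauchy-Schwarz does the rest. When
  \<open>T\<close> is the root of a varying matrix, \<open>m\<close> thus stays fixed.\<close>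

lemma sylvester_norm_bound:
  fixes S T D :: "real^'n::finite^'n"
  assumes "posdef T" and "\<And>x. m * (x \<bullet> x) \<le> x \<bullet> (S *v x)"
  shows "m * norm D \<le> norm (T ** D + D ** S)"
proof (cases "D = 0")
  case False
  have "m * (norm D)\<^sup>2 \<le> D \<bullet> (T ** D + D ** S)"
    using posdef_mult_left_nonneg[OF assms(1), of D] posdef_coercive_mult_right[of m S D, OF assms(2)]
    by (simp add: inner_add_right power2_norm_eq_inner)
  also have "\<dots> \<le> norm D * norm (T ** D + D ** S)"
    by (rule norm_cauchy_schwarz)
  finally show ?thesis using False by (simp add: power2_eq_square)
qed simp

lemma sylvester_inj:
  fixes S T D :: "real^'n::finite^'n"
  assumes "posdef T" "posdef S" "T ** D + D ** S = 0"
  shows "D = 0"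
proof -
  obtain m where m: "m > 0" "\<And>x. m * (x \<bullet> x) \<le> x \<bullet> (S *v x)"
    using posdef_coercive[OF assms(2)] by blast
  have "m * norm D \<le> 0"
    using sylvester_norm_bound[OF assms(1) m(2), of D] assms(3) by simp
  then show ?thesis using m(1) by (simp add: mult_le_0_iff)
qed

text \<open>A difference of squares for noncommuting matrices: with \<open>T\<close> on the left and
  \<open>S\<close> on the right the mixed products \<open>T ** S\<close> cancel.\<close>

lemma sqrt_difference_sylvester:
  fixes S T :: "real^'n::finite^'n"
  shows "T ** (T - S) + (T - S) ** S = T ** T - S ** S"
  by (simp add: matmul.diff_left matmul.diff_right)

section \<open>Uniqueness and existence of the positive definite root\<close>

lemma posdef_sqrt_unique:
  fixes S T :: "real^'n::finite^'n"
  assumes "posdef S" "posdef T" "S ** S = T ** T"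
  shows "S = T"
  using sylvester_inj[OF assms(2,1), of "T - S"] assms(3)
  by (simp add: sqrt_difference_sylvester)

text \<open>A fixed point X of (E + X^2)/2 with E = 1 - A/c satisfies (1 - X)^2 = 1 - E = A/c, so
  sqrt c (1 - X) is a root of \<open>A\<close>; norm X < 1 makes it positive definite.\<close>

lemma posdef_sqrt_exists:
  fixes A :: "real^'n::finite^'n"
  assumes sym: "symm_mat A" and pd: "posdef A"
  shows "\<exists>S. symm_mat S \<and> posdef S \<and> S ** S = A"
proof -
  obtain m where m: "m > 0" "\<And>x. m * (x \<bullet> x) \<le> x \<bullet> (A *v x)"
    using posdef_coercive[OF pd] by blast
  obtain L where L: "L > 0" "\<And>x. norm (A *v x) \<le> L * norm x"
    using bounded_linear.pos_bounded[OF matrix_vector_mul_bounded_linear[of A]]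
    by (metis mult.commute)
  \<comment> \<open>for large \<open>c\<close> the operator \<open>1 - A/c\<close> is a strict contraction\<close>
  define c where "c = max (L\<^sup>2 / m) m"
  have c: "c > 0" "L\<^sup>2 \<le> c * m" "m \<le> c"
    using m(1) by (auto simp: c_def divide_le_eq max_def field_simps)
  \<comment> \<open>The bounds L^2 \<le> c m and x . A x \<ge> m |x|^2 give |x - A x/c|^2 \<le> (1 -
    2m/c + m/c) |x|^2, hence this factor; m \<le> c keeps the radicand nonnegative.\<close>
  define e where "e = sqrt (1 - m / c)"
  have e: "0 \<le> e" "e < 1" "e\<^sup>2 = 1 - m / c"
    using c m(1) by (auto simp: e_def field_simps)
  define Em where "Em = mat 1 - (1/c) *\<^sub>R A"
  have Emv: "Em *v x = x - (1/c) *\<^sub>R (A *v x)" for x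
    by (simp add: Em_def matrix_vector_mult_diff_rdistrib scaleR_matrix_vector_assoc)
  have Em_bound: "norm (Em *v x) \<le> e * norm x" for x
  proof -
    have "(norm (Em *v x))\<^sup>2 = (norm x)\<^sup>2 - (2/c) * (x \<bullet> (A *v x)) + (norm (A *v x))\<^sup>2 / c\<^sup>2"
      unfolding Emv power2_norm_eq_inner
      by (simp add: inner_diff_left inner_diff_right inner_commute power2_eq_square field_simps)
    also have "\<dots> \<le> (norm x)\<^sup>2 - (2/c) * (m * (norm x)\<^sup>2) + (c * m * (norm x)\<^sup>2) / c\<^sup>2"
    proof -
      have "(2/c) * (m * (norm x)\<^sup>2) \<le> (2/c) * (x \<bullet> (A *v x))"
        using m(2)[of x] c by (intro mult_left_mono) (auto simp: power2_norm_eq_inner)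
      moreover have "(norm (A *v x))\<^sup>2 \<le> L\<^sup>2 * (norm x)\<^sup>2"
        using power_mono[OF L(2)[of x], of 2] by (simp add: power_mult_distrib)
      then have "(norm (A *v x))\<^sup>2 \<le> c * m * (norm x)\<^sup>2"
        using c(2) mult_right_mono[of "L\<^sup>2" "c*m" "(norm x)\<^sup>2"] by simp
      then have "(norm (A *v x))\<^sup>2 / c\<^sup>2 \<le> (c * m * (norm x)\<^sup>2) / c\<^sup>2"
        by (intro divide_right_mono) auto
      ultimately show ?thesis by linarith
    qed
    also have "\<dots> = (e * norm x)\<^sup>2"
      using c unfolding power_mult_distrib e(3) by (simp add: field_simps power2_eq_square)
    finally show ?thesis
      by (rule power2_le_imp_le) (use e in simp)
  qed
  \<comment> \<open>The norm of the matrix type is the Frobenius norm, which can exceed 1 for a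
    contraction; bounded linear functions carry the operator norm, under which E has norm at most
    e.\<close>
  define E where "E = Blinfun ((*v) Em)"
  have E: "blinfun_apply E x = Em *v x" for x
    by (simp add: E_def bounded_linear_Blinfun_apply matrix_vector_mul_bounded_linear)
  have normE: "norm E \<le> e"
    by (rule norm_blinfun_bound) (use e Em_bound in \<open>auto simp: E\<close>)
  \<comment> \<open>The midpoint of e and 1: since (1 - \<rho>)^2 = (1 - e)^2/4 \<le> 1 - e, the
    ball of radius \<rho> is mapped into itself, and on it X^2/2 is \<rho>-Lipschitz.\<close>
  define \<rho> where "\<rho> = (1 + e) / 2"
  have \<rho>: "0 \<le> \<rho>" "\<rho> < 1" "(e + \<rho>\<^sup>2) / 2 \<le> \<rho>"
  proof -
    have "(1 - e)\<^sup>2 \<le> 4 * (1 - e)" 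
      using e mult_right_mono[of "1 - e" 4 "1 - e"] by (simp add: power2_eq_square)
    then show "(e + \<rho>\<^sup>2) / 2 \<le> \<rho>"
      by (simp add: \<rho>_def field_simps power2_eq_square)
  qed (use e in \<open>auto simp: \<rho>_def\<close>)
  define F where "F X = (1/2) *\<^sub>R (E + (X o\<^sub>L X))" for X
  \<comment> \<open>Self-adjointness is a closed condition preserved by F; built into the complete
    set, it is inherited by the fixed point.\<close>
  define K where "K = cball 0 \<rho> \<inter> (\<Inter>x. \<Inter>y. {X :: (real^'n) \<Rightarrow>\<^sub>L (real^'n). X x \<bullet> y = x \<bullet> X y})"
  have symA: "(A *v x) \<bullet> y = x \<bullet> (A *v y)" for x y
    using sym by (metis dot_lmul_matrix inner_commute symm_mat_def transpose_matrix_vector)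
  have "closed K"
    unfolding K_def
    by (intro closed_Int closed_cball closed_INT ballI closed_Collect_eq continuous_intros)
  then have "complete K" by (simp add: complete_eq_closed)
  moreover have "0 \<in> K" using \<rho> by (auto simp: K_def)
  then have "K \<noteq> {}" by blast
  moreover have "F ` K \<subseteq> K"
  proof
    fix Y assume "Y \<in> F ` K"
    then obtain X where X: "X \<in> K" "Y = F X" by blast
    have nX: "norm X \<le> \<rho>" and sX: "\<And>x y. X x \<bullet> y = x \<bullet> X y" using X by (auto simp: K_def)
    have "norm (X o\<^sub>L X) \<le> \<rho>\<^sup>2"
      using norm_blinfun_compose[of X X] nX mult_mono[OF nX nX] \<rho>
      by (simp add: power2_eq_square)
    then have "norm (E + (X o\<^sub>L X)) \<le> e + \<rho>\<^sup>2"
      using norm_triangle_ineq[of E "X o\<^sub>L X"] normE by linarith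
    then have "norm Y \<le> \<rho>" using \<rho>(3) by (simp add: X F_def)
    moreover have "Y x \<bullet> y = x \<bullet> Y y" for x y
      by (simp add: X F_def blinfun.bilinear_simps E Emv inner_add_left inner_add_right
          inner_diff_left inner_diff_right symA sX)
    ultimately show "Y \<in> K" by (auto simp: K_def)
  qed
  moreover have "dist (F X) (F Y) \<le> \<rho> * dist X Y" if "X \<in> K \<and> Y \<in> K" for X Y
  proof -
    have nX: "norm X \<le> \<rho>" "norm Y \<le> \<rho>" using that by (auto simp: K_def)
    have "F X - F Y = (1/2) *\<^sub>R ((X o\<^sub>L (X - Y)) + ((X - Y) o\<^sub>L Y))"
      by (rule blinfun_eqI) (simp add: F_def blinfun.bilinear_simps algebra_simps)
    then have "dist (F X) (F Y) = (1/2) * norm ((X o\<^sub>L (X - Y)) + ((X - Y) o\<^sub>L Y))"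
      by (simp add: dist_norm)
    also have "\<dots> \<le> (1/2) * (norm X * norm (X - Y) + norm (X - Y) * norm Y)"
      by (intro mult_left_mono norm_triangle_le add_mono norm_blinfun_compose) simp
    also have "\<dots> \<le> (1/2) * (\<rho> * norm (X - Y) + norm (X - Y) * \<rho>)"
      by (intro mult_left_mono add_mono mult_right_mono nX) simp_all
    finally show ?thesis by (simp add: dist_norm)
  qed
  ultimately obtain X where X: "X \<in> K" "F X = X"
    using Banach_fix[of K \<rho> F] \<rho> by blast
  have nX: "norm X \<le> \<rho>" and sX: "\<And>x y. X x \<bullet> y = x \<bullet> X y" using X by (auto simp: K_def)
  define S where "S = sqrt c *\<^sub>R (mat 1 - matrix X)"
  have MX: "matrix X *v x = X x" for x
    by (simp add: matrix_works bounded_linear.linear blinfun.bounded_linear_right)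
  have Sv: "S *v x = sqrt c *\<^sub>R (x - X x)" for x
    by (simp add: S_def scaleR_matrix_vector_assoc[symmetric] matrix_vector_mult_diff_rdistrib MX)
  have "x \<bullet> (S *v y) = (S *v x) \<bullet> y" for x y
    by (simp add: Sv inner_diff_left inner_diff_right sX)
  then have "x \<bullet> (S *v y) = x \<bullet> (transpose S *v y)" for x y
    by (simp add: dot_lmul_matrix transpose_matrix_vector flip: vector_transpose_matrix)
  then have "S *v y = transpose S *v y" for y
    using vector_eq_ldot by blast
  then have "symm_mat S" unfolding symm_mat_def by (metis matrix_eq)
  moreover have "posdef S"
    unfolding posdef_def
  proof (intro allI impI)
    fix x :: "real^'n" assume "x \<noteq> 0"
    have "x \<bullet> X x \<le> norm x * norm (X x)" by (rule norm_cauchy_schwarz)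
    also have "\<dots> \<le> norm x * (\<rho> * norm x)"
      using norm_blinfun[of X x] mult_right_mono[OF nX, of "norm x"]
      by (intro mult_left_mono) auto
    also have "\<dots> < (norm x)\<^sup>2"
      using \<rho> \<open>x \<noteq> 0\<close> by (simp add: power2_eq_square)
    finally show "0 < x \<bullet> (S *v x)"
      using c by (simp add: Sv inner_diff_right power2_norm_eq_inner)
  qed
  moreover have "S ** S = A"
  proof -
    have "(S ** S) *v x = A *v x" for x
    proof -
      have "(F X) x = X x" using X by simp
      then have "(1/2) *\<^sub>R (x - (1/c) *\<^sub>R (A *v x) + X (X x)) = X x"
        by (simp add: F_def blinfun.bilinear_simps E Emv)
      then have "2 *\<^sub>R ((1/2) *\<^sub>R (x - (1/c) *\<^sub>R (A *v x) + X (X x))) = 2 *\<^sub>R X x"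
        by (rule arg_cong)
      then have "x - (1/c) *\<^sub>R (A *v x) + X (X x) = 2 *\<^sub>R X x"
        by (simp only: scaleR_scaleR) simp
      then have *: "(1/c) *\<^sub>R (A *v x) = x - 2 *\<^sub>R X x + X (X x)"
        by (simp add: algebra_simps)
      have "(S ** S) *v x = c *\<^sub>R (x - 2 *\<^sub>R X x + X (X x))"
        using c by (simp add: matrix_vector_mul_assoc[symmetric] Sv blinfun.bilinear_simps algebra_simps scaleR_2)
      also have "\<dots> = A *v x" using c by (simp flip: *)
      finally show ?thesis .
    qed
    then show ?thesis by (simp add: matrix_eq)
  qed
  ultimately show ?thesis by blast
qed

lemma msqrt_eqI:
  assumes "symm_mat S" "posdef S" "S ** S = A"
  shows "msqrt A = S"
  unfolding msqrt_def
  by (rule the_equality) (use assms posdef_sqrt_unique in blast)+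

lemma msqrt_props:
  assumes "symm_mat A" "posdef A"
  shows "symm_mat (msqrt A)" "posdef (msqrt A)" "msqrt A ** msqrt A = A"
  using posdef_sqrt_exists[OF assms] msqrt_eqI by metis+

lemma posdef_invertible:
  assumes "posdef M"
  shows "M ** matrix_inv M = mat 1" "matrix_inv M ** M = mat 1"
proof -
  have "\<exists>B. B ** M = mat 1"
    unfolding matrix_left_invertible_ker using assms
    by (metis posdef_def inner_zero_right less_irrefl)
  then obtain B where "M ** B = mat 1" using matrix_left_right_inverse by blast
  then show "M ** matrix_inv M = mat 1" "matrix_inv M ** M = mat 1"
    using matrix_inv_eq matrix_left_right_inverse by metis+
qed

section \<open>Linear images of Lebesgue measure\<close>

lemma Basis_vec_real: "(Basis :: (real^'n::finite) set) = range (\<lambda>a. axis a 1)"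
  by (auto simp: Basis_vec_def)

lemma prod_Basis_vec: "(\<Prod>b\<in>(Basis :: (real^'n::finite) set). f b) = (\<Prod>a\<in>UNIV. f (axis a 1))"
  unfolding Basis_vec_real by (subst prod.reindex) (auto simp: inj_on_def axis_eq_axis)

text \<open>Fubini with coordinate \<open>i\<close> innermost: on each line in direction
  \<open>i\<close> the shear is a translation by \<open>c * x j\<close>, constant there because
  \<open>j\<close> differs from \<open>i\<close>, and Lebesgue measure on the line is translation
  invariant.\<close>

lemma nn_integral_lborel_shear:
  fixes i j :: "'a::euclidean_space"
  assumes ij: "i \<in> Basis" "j \<in> Basis" "i \<noteq> j" and [measurable]: "f \<in> borel_measurable borel"
  shows "(\<integral>\<^sup>+ x. f (x + (c * (x \<bullet> j)) *\<^sub>R i) \<partial>lborel) = (\<integral>\<^sup>+ x. f x \<partial>lborel)"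
proof -
  interpret product_sigma_finite "\<lambda>_::'a. lborel :: real measure" by standard
  define I where "I = Basis - {i}"
  have I: "finite I" "i \<notin> I" "insert i I = Basis" using ij by (auto simp: I_def)
  define T where "T x = x + (c * (x \<bullet> j)) *\<^sub>R i" for x
  have [measurable]: "T \<in> borel_measurable borel" unfolding T_def by measurable
  let ?s = "\<lambda>x::'a \<Rightarrow> real. \<Sum>b\<in>Basis. x b *\<^sub>R b"
  have split: "(\<integral>\<^sup>+ x. h x \<partial>lborel) = (\<integral>\<^sup>+ x. \<integral>\<^sup>+ y. h (?s (x(i := y))) \<partial>lborel \<partial>Pi\<^sub>M I (\<lambda>_. lborel))"
    if [measurable]: "h \<in> borel_measurable borel" for h :: "'a \<Rightarrow> ennreal"
  proof -
    have "(\<integral>\<^sup>+ x. h x \<partial>lborel) = (\<integral>\<^sup>+ x. h (?s x) \<partial>Pi\<^sub>M (insert i I) (\<lambda>_. lborel))"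
      by (subst lborel_eq) (simp add: nn_integral_distr I(3))
    also have "\<dots> = (\<integral>\<^sup>+ x. \<integral>\<^sup>+ y. h (?s (x(i := y))) \<partial>lborel \<partial>Pi\<^sub>M I (\<lambda>_. lborel))"
      by (rule product_nn_integral_insert[OF I(1,2)]) (simp add: I(3))
    finally show ?thesis .
  qed
  have sh: "T (?s (x(i := y))) = ?s (x(i := y + c * x j))" for x y
  proof -
    have "?s (x(i := y)) \<bullet> j = x j"
      using ij by (subst inner_sum_left_Basis) auto
    then have "T (?s (x(i := y))) = ?s (x(i := y)) + (c * x j) *\<^sub>R i" by (simp add: T_def)
    also have "\<dots> = ?s (x(i := y + c * x j))"
      using I by (simp add: scaleR_add_left flip: I(3)) (auto intro!: sum.cong)
    finally show ?thesis .
  qed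
  have "(\<integral>\<^sup>+ x. f (T x) \<partial>lborel) = (\<integral>\<^sup>+ x. \<integral>\<^sup>+ y. f (?s (x(i := y + c * x j))) \<partial>lborel \<partial>Pi\<^sub>M I (\<lambda>_. lborel))"
    by (subst split) (simp_all only: sh, measurable)
  also have "\<dots> = (\<integral>\<^sup>+ x. \<integral>\<^sup>+ y. f (?s (x(i := y))) \<partial>lborel \<partial>Pi\<^sub>M I (\<lambda>_. lborel))"
  proof (rule nn_integral_cong)
    fix x
    have [measurable]: "(\<lambda>y. f (?s (x(i := y)))) \<in> borel_measurable borel"
      using I by (simp flip: I(3))
    show "(\<integral>\<^sup>+ y. f (?s (x(i := y + c * x j))) \<partial>lborel) = (\<integral>\<^sup>+ y. f (?s (x(i := y))) \<partial>lborel)"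
      using nn_integral_real_affine[of "\<lambda>y. f (?s (x(i := y)))" 1 "c * x j"] by (simp add: add.commute)
  qed
  also have "\<dots> = (\<integral>\<^sup>+ x. f x \<partial>lborel)" by (rule split[symmetric]) measurable
  finally show ?thesis by (simp add: T_def)
qed

text \<open>The linear change of variables in \<open>Change_Of_Vars\<close> needs a well-ordered index type.\<close>
lemma nn_integral_lborel_linear:
  fixes A :: "real^'n::finite^'n" and f :: "real^'n \<Rightarrow> ennreal"
  assumes "det A \<noteq> 0" "f \<in> borel_measurable borel"
  shows "(\<integral>\<^sup>+ x. f x \<partial>lborel) = ennreal \<bar>det A\<bar> * (\<integral>\<^sup>+ x. f (A *v x) \<partial>lborel)"
proof -
  \<comment> \<open>Restricting the claim to nonsingular matrices makes the zero-row case vacuous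
    and gives nonsingular factors in the product case, so \<open>P\<close> passes through the
    induction over elementary matrices.\<close>
  define P where "P A \<longleftrightarrow> det A \<noteq> 0 \<longrightarrow> (\<forall>f \<in> borel_measurable borel.
    (\<integral>\<^sup>+ x. f x \<partial>lborel) = ennreal \<bar>det A\<bar> * (\<integral>\<^sup>+ x. f (A *v x) \<partial>lborel))" for A :: "real^'n^'n"
  have [measurable]: "(*v) A \<in> borel_measurable borel" for A :: "real^'n^'n"
    by (intro borel_measurable_continuous_onI continuous_intros)
  have "P A"
  proof (rule induct_matrix_elementary_alt)
    fix A B :: "real^'n^'n" assume PA: "P A" and PB: "P B"
    show "P (A ** B)"
      unfolding P_def
    proof (intro impI ballI)
      fix f :: "real^'n \<Rightarrow> ennreal"
      assume d: "det (A ** B) \<noteq> 0" and [measurable]: "f \<in> borel_measurable borel"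
      have dA: "det A \<noteq> 0" and dB: "det B \<noteq> 0" using d by (auto simp: det_mul)
      have "(\<integral>\<^sup>+ x. f x \<partial>lborel) = ennreal \<bar>det A\<bar> * (\<integral>\<^sup>+ x. f (A *v x) \<partial>lborel)"
        by (rule PA[unfolded P_def, rule_format, OF dA]) measurable
      also have "(\<integral>\<^sup>+ x. f (A *v x) \<partial>lborel) = ennreal \<bar>det B\<bar> * (\<integral>\<^sup>+ x. f (A *v (B *v x)) \<partial>lborel)"
        by (rule PB[unfolded P_def, rule_format, OF dB]) measurable
      finally show "(\<integral>\<^sup>+ x. f x \<partial>lborel) = ennreal \<bar>det (A ** B)\<bar> * (\<integral>\<^sup>+ x. f ((A ** B) *v x) \<partial>lborel)"
        by (simp add: det_mul abs_mult ennreal_mult mult.assoc matrix_vector_mul_assoc)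
    qed
  next
    fix A :: "real^'n^'n" and i assume "row i A = 0"
    then show "P A" by (auto simp: P_def det_zero_row)
  next
    fix A :: "real^'n^'n" assume A: "\<And>i j. i \<noteq> j \<Longrightarrow> A $ i $ j = 0"
    show "P A"
      unfolding P_def
    proof (intro impI ballI)
      fix f :: "real^'n \<Rightarrow> ennreal"
      assume d: "det A \<noteq> 0" and [measurable]: "f \<in> borel_measurable borel"
      have det: "det A = (\<Prod>i\<in>UNIV. A $ i $ i)" using A by (rule det_diagonal)
      define c where "c b = b \<bullet> (A *v b)" for b
      have ca: "c (axis a 1) = A $ a $ a" for a
        by (simp add: c_def inner_axis' matrix_vector_mult_basis column_def)
      have T: "A *v x = 0 + (\<Sum>j\<in>Basis. (c j * (x \<bullet> j)) *\<^sub>R j)" for x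
      proof -
        have "(A *v x) $ a = A $ a $ a * x $ a" for a
        proof -
          have "(A *v x) $ a = (\<Sum>j\<in>UNIV. if j = a then A $ a $ a * x $ a else 0)"
            unfolding matrix_vector_mult_def vec_lambda_beta
            by (rule sum.cong) (use A in auto)
          then show ?thesis by simp
        qed
        then have "A *v x = (\<Sum>a\<in>UNIV. (A $ a $ a * x $ a) *\<^sub>R axis a 1)"
          by (simp add: vec_eq_iff axis_def if_distrib cong: if_cong)
        also have "\<dots> = (\<Sum>j\<in>Basis. (c j * (x \<bullet> j)) *\<^sub>R j)"
          unfolding Basis_vec_real
          by (subst sum.reindex) (auto simp: inj_on_def axis_eq_axis ca inner_axis)
        finally show ?thesis by simp
      qed
      have "c j \<noteq> 0" if "j \<in> Basis" for j
        using that d unfolding det Basis_vec_real by (auto simp: ca)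
      from lborel_affine_euclidean[of c 0, OF this]
      have "lborel = density (distr lborel borel ((*v) A)) (\<lambda>_. ennreal (\<Prod>j\<in>Basis. \<bar>c j\<bar>))"
        by (simp add: T[abs_def])
      also have "(\<Prod>j\<in>Basis. \<bar>c j\<bar>) = \<bar>det A\<bar>"
        by (simp add: prod_Basis_vec ca det abs_prod)
      finally have "(\<integral>\<^sup>+ x. f x \<partial>lborel) = (\<integral>\<^sup>+ x. f x \<partial>density (distr lborel borel ((*v) A)) (\<lambda>_. ennreal \<bar>det A\<bar>))"
        by simp
      also have "\<dots> = ennreal \<bar>det A\<bar> * (\<integral>\<^sup>+ x. f (A *v x) \<partial>lborel)"
        by (simp add: nn_integral_density nn_integral_distr nn_integral_cmult)
      finally show "(\<integral>\<^sup>+ x. f x \<partial>lborel) = \<dots>" .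
    qed
  next
    fix m n :: 'n assume mn: "m \<noteq> n"
    let ?p = "Transposition.transpose m n"
    define A :: "real^'n^'n" where "A = (\<chi> i j. mat 1 $ i $ ?p j)"
    have "det A = sign ?p"
      unfolding A_def by (subst det_permute_columns) (auto simp: permutes_swap_id)
    then have det: "\<bar>det A\<bar> = 1" using mn by (simp add: sign_swap_id)
    have Av: "A *v x = (\<chi> i. x $ ?p i)" for x
    proof -
      have "A $ i $ j = (if j = ?p i then 1 else 0)" for i j
        by (auto simp: A_def mat_def transpose_involutory)
      then have "(A *v x) $ i = (\<Sum>j\<in>UNIV. if j = ?p i then x $ j else 0)" for i
        unfolding matrix_vector_mult_def vec_lambda_beta by (intro sum.cong) auto
      then show ?thesis by (simp add: vec_eq_iff)
    qed
    \<comment> \<open>Lebesgue measure is determined by its values on boxes, and a transposition of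
      coordinates maps boxes to boxes with the same side lengths.\<close>
    have "lborel = distr lborel borel ((*v) A)"
    proof (rule lborel_eqI)
      fix l u :: "real^'n" assume le: "\<And>b. b \<in> Basis \<Longrightarrow> l \<bullet> b \<le> u \<bullet> b"
      have le': "l $ a \<le> u $ a" for a
        using le[of "axis a 1"] by (simp add: inner_axis)
      have "(*v) A -` box l u = box (A *v l) (A *v u)"
        by (auto simp: Av mem_box_cart) (metis transpose_involutory)+
      moreover have "(A *v l) \<bullet> b \<le> (A *v u) \<bullet> b" if "b \<in> Basis" for b
        using that le' by (auto simp: Basis_vec_real Av inner_axis)
      ultimately have "emeasure (distr lborel borel ((*v) A)) (box l u) = (\<Prod>b\<in>Basis. (A *v u - A *v l) \<bullet> b)"
        by (simp add: emeasure_distr)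
      also have "(\<Prod>b\<in>Basis. (A *v u - A *v l) \<bullet> b) = (\<Prod>a\<in>UNIV. (u - l) $ ?p a)"
        by (simp add: prod_Basis_vec Av inner_axis)
      also have "\<dots> = (\<Prod>a\<in>UNIV. (u - l) $ a)"
        by (rule prod.reindex_bij_betw) (simp add: bij_betw_def)
      also have "\<dots> = (\<Prod>b\<in>Basis. (u - l) \<bullet> b)"
        by (simp add: prod_Basis_vec inner_axis)
      finally show "emeasure (distr lborel borel ((*v) A)) (box l u) = (\<Prod>b\<in>Basis. (u - l) \<bullet> b)" .
    qed simp
    then have "(\<integral>\<^sup>+ x. f x \<partial>lborel) = (\<integral>\<^sup>+ x. f x \<partial>distr lborel borel ((*v) A))" for f :: "real^'n \<Rightarrow> ennreal"
      by (rule arg_cong)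
    moreover have "(\<integral>\<^sup>+ x. f x \<partial>distr lborel borel ((*v) A)) = (\<integral>\<^sup>+ x. f (A *v x) \<partial>lborel)"
      if "f \<in> borel_measurable borel" for f :: "real^'n \<Rightarrow> ennreal"
      by (rule nn_integral_distr) (use that in measurable)
    ultimately show "P (\<chi> i j. mat 1 $ i $ ?p j)"
      unfolding P_def A_def[symmetric] det ennreal_1 mult_1_left by metis
  next
    fix m n :: 'n assume mn: "m \<noteq> n"
    define A :: "real^'n^'n" where "A = (\<chi> i j. of_bool (i = m \<and> j = n \<or> i = j))"
    have "A = (\<chi> k. if k = m then row m (mat 1) + 1 *s row n (mat 1) else row k (mat 1))"
      using mn by (auto simp: A_def vec_eq_iff row_def mat_def)
    then have det: "det A = 1" using det_row_operation[OF mn, of "mat 1" 1] by simp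
    have Av: "A *v x = x + (1 * (x \<bullet> axis n 1)) *\<^sub>R axis m 1" for x
    proof -
      have "(A *v x) $ i = (\<Sum>j\<in>UNIV. (if j = i then x $ i else 0) + (if j = n then (if i = m then x $ n else 0) else 0))" for i
        unfolding A_def matrix_vector_mult_def vec_lambda_beta
        by (rule sum.cong) (use mn in auto)
      then have "(A *v x) $ i = x $ i + (if i = m then x $ n else 0)" for i
        by (simp only: sum.distrib sum.delta finite UNIV_I if_True)
      then show ?thesis by (simp add: vec_eq_iff inner_axis) (simp add: axis_def)
    qed
    have "(\<integral>\<^sup>+ x. f (A *v x) \<partial>lborel) = (\<integral>\<^sup>+ x. f x \<partial>lborel)"
      if "f \<in> borel_measurable borel" for f :: "real^'n \<Rightarrow> ennreal"
      unfolding Av by (rule nn_integral_lborel_shear) (use mn that in \<open>auto simp: axis_in_Basis_iff axis_eq_axis\<close>)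
    then show "P (\<chi> i j. of_bool (i = m \<and> j = n \<or> i = j))"
      unfolding P_def A_def[symmetric] det abs_one ennreal_1 mult_1_left by metis
  qed
  then show ?thesis unfolding P_def using assms by blast
qed

section \<open>Moments of the standardised t-distribution\<close>

text \<open>The substitution t = u^2/(1 + u^2) carries (0, infinity) onto (0, 1) and turns the Beta
  integrand t^(-1/2) (1 - t)^(s - 3/2) into 2 (1 + u^2)^(-s); evenness supplies the negative
  half-line and absorbs the factor 2.\<close>

lemma has_bochner_integral_Beta_cauchy:
  fixes s :: real
  assumes s: "s > 1/2"
  shows "has_bochner_integral lborel (\<lambda>u. (1 + u\<^sup>2) powr (- s)) (Beta (1/2) (s - 1/2))"
proof -
  let ?f = "\<lambda>t::real. t powr (1/2 - 1) * (1 - t) powr (s - 1/2 - 1)"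
  let ?g = "\<lambda>u::real. u\<^sup>2 / (1 + u\<^sup>2)" and ?g' = "\<lambda>u::real. 2 * u / (1 + u\<^sup>2)\<^sup>2"
  have pos: "1 + u\<^sup>2 > 0" for u :: real by (simp add: add_pos_nonneg)
  have "(?f has_integral Beta (1/2) (s - 1/2)) {0<..<1}"
    using has_integral_Beta_real[of "1/2" "s - 1/2"] s by (simp add: has_integral_Icc_iff_Ioo)
  then have f: "?f absolutely_integrable_on {0<..<1}" "integral {0<..<1} ?f = Beta (1/2) (s - 1/2)"
    by (auto intro!: nonnegative_absolutely_integrable_1 simp: has_integral_iff)
  have im: "?g ` {0<..} = {0<..<1}"
  proof (intro equalityI subsetI)
    fix t :: real assume t: "t \<in> {0<..<1}"
    then have "t = ?g (sqrt (t / (1 - t)))" by (simp add: field_simps)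
    moreover have "sqrt (t / (1 - t)) \<in> {0<..}" using t by simp
    ultimately show "t \<in> ?g ` {0<..}" by blast
  qed (use pos in \<open>auto simp: field_simps\<close>)
  have inj: "inj_on ?g {0<..}"
  proof (rule inj_onI)
    fix x y :: real assume xy: "x \<in> {0<..}" "y \<in> {0<..}" "?g x = ?g y"
    then have "x\<^sup>2 * (1 + y\<^sup>2) = y\<^sup>2 * (1 + x\<^sup>2)" using pos[of x] pos[of y] by (simp add: field_simps)
    then have "x\<^sup>2 = y\<^sup>2" by (simp add: algebra_simps)
    then show "x = y" using xy by simp
  qed
  have der: "(?g has_field_derivative ?g' x) (at x within {0<..})" for x
  proof -
    have "1 + x\<^sup>2 \<noteq> 0" using pos[of x] by linarith
    then show ?thesis
      by (auto intro!: derivative_eq_intros simp: power2_eq_square field_simps)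
  qed
  have "(\<lambda>x. \<bar>?g' x\<bar> * ?f (?g x)) absolutely_integrable_on {0<..} \<and>
      integral {0<..} (\<lambda>x. \<bar>?g' x\<bar> * ?f (?g x)) = Beta (1/2) (s - 1/2)"
    by (subst has_absolute_integral_change_of_variables_1'[of _ ?g ?g']) (use der inj im f in auto)
  moreover have eq: "\<bar>?g' x\<bar> * ?f (?g x) = 2 * (1 + x\<^sup>2) powr (- s)" if "x \<in> {0<..}" for x
  proof -
    have x: "x > 0" using that by simp
    have "?f (?g x) = (x\<^sup>2) powr (-1/2) * (1 + x\<^sup>2) powr (1/2) * (1 / (1 + x\<^sup>2)) powr (s - 1/2 - 1)"
    proof -
      have "1 - ?g x = 1 / (1 + x\<^sup>2)" using pos[of x] by (simp add: field_simps)
      moreover have "(?g x) powr (-1/2) = (x\<^sup>2) powr (-1/2) * (1 + x\<^sup>2) powr (1/2)"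
        using pos[of x] by (simp add: powr_divide powr_minus_divide)
      ultimately show ?thesis by simp
    qed
    also have "(x\<^sup>2) powr (-1/2) = 1 / x"
      using x by (simp add: powr_minus_divide powr_half_sqrt)
    also have "(1 / (1 + x\<^sup>2)) powr (s - 1/2 - 1) = (1 + x\<^sup>2) powr (3/2 - s)"
      using pos[of x] by (simp add: powr_divide flip: powr_minus_divide)
    finally have "\<bar>?g' x\<bar> * ?f (?g x) = 2 * ((1 + x\<^sup>2) powr (1/2) * (1 + x\<^sup>2) powr (3/2 - s) * (1 + x\<^sup>2) powr (-2))"
      using x pos[of x] by (simp add: powr_minus_divide powr_numeral)
    also have "\<dots> = 2 * (1 + x\<^sup>2) powr (- s)"
      by (simp flip: powr_add)
    finally show ?thesis .
  qed
  moreover have "(\<lambda>x. \<bar>?g' x\<bar> * ?f (?g x)) absolutely_integrable_on {0<..} \<longleftrightarrow>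
      (\<lambda>x. 2 * (1 + x\<^sup>2) powr (- s)) absolutely_integrable_on {0<..}"
    by (rule set_integrable_cong[OF refl refl eq])
  moreover have "integral {0<..} (\<lambda>x. \<bar>?g' x\<bar> * ?f (?g x)) = integral {0<..} (\<lambda>x. 2 * (1 + x\<^sup>2) powr (- s))"
    by (rule Henstock_Kurzweil_Integration.integral_cong[OF eq])
  ultimately have h: "(\<lambda>x. 2 * (1 + x\<^sup>2) powr (- s)) absolutely_integrable_on {0<..}"
      "integral {0<..} (\<lambda>x. 2 * (1 + x\<^sup>2) powr (- s)) = Beta (1/2) (s - 1/2)"
    by metis+
  have "has_bochner_integral lebesgue (\<lambda>x. indicator {0<..} x *\<^sub>R (2 * (1 + x\<^sup>2) powr (- s))) (Beta (1/2) (s - 1/2))"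
    using h set_lebesgue_integral_eq_integral(2)[OF h(1)]
    unfolding has_bochner_integral_iff set_integrable_def set_lebesgue_integral_def by metis
  then have "has_bochner_integral lborel (\<lambda>x. indicator {0<..} x *\<^sub>R (2 * (1 + x\<^sup>2) powr (- s))) (Beta (1/2) (s - 1/2))"
    by (subst (asm) has_bochner_integral_iff, subst has_bochner_integral_iff)
       (simp add: integrable_completion integral_completion)
  then have "has_bochner_integral lborel (\<lambda>x. indicator {0..} x *\<^sub>R (2 * (1 + x\<^sup>2) powr (- s))) (Beta (1/2) (s - 1/2))"
    by (rule has_bochner_integral_discrete_difference[where X="{0}", THEN iffD1, rotated 4])
       (auto split: split_indicator)
  then have "has_bochner_integral lborel (\<lambda>x. (1/2) *\<^sub>R (indicator {0..} x *\<^sub>R (2 * (1 + x\<^sup>2) powr (- s)))) ((1/2) *\<^sub>R Beta (1/2) (s - 1/2))"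
    by (rule has_bochner_integral_scaleR_right)
  then have "has_bochner_integral lborel (\<lambda>x. indicator {0..} x *\<^sub>R ((1 + x\<^sup>2) powr (- s))) (Beta (1/2) (s - 1/2) / 2)"
    by (simp add: mult.left_commute)
  from has_bochner_integral_even_function[OF this] show ?thesis by simp
qed

text \<open>The extra power only shifts the exponent of the kernel, hence the second Beta parameter
  from nu/2 to nu/2 + r. After rescaling by sqrt (nu - 2) the normalising constant is 1/B(1/2,
  nu/2).\<close>

lemma has_bochner_integral_t_std_dens_powr:
  fixes \<nu> r :: real
  assumes nu: "\<nu> > 2" and r: "\<nu> / 2 + r > 0"
  shows "has_bochner_integral lborel (\<lambda>u. t_std_dens \<nu> u * (1 + u\<^sup>2 / (\<nu> - 2)) powr (- r))
           (Beta (1/2) (\<nu>/2 + r) / Beta (1/2) (\<nu>/2))"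
proof -
  define c where "c = \<nu> - 2"
  define K where "K = Gamma ((\<nu> + 1) / 2) / Gamma (\<nu> / 2) * (c * pi) powr (-1/2)"
  have c: "c > 0" using nu by (simp add: c_def)
  have K: "K * sqrt c = 1 / Beta (1/2) (\<nu>/2)"
  proof -
    have "(c * pi) powr (-1/2) = 1 / (sqrt c * sqrt pi)"
      using c by (simp add: powr_minus_divide powr_half_sqrt real_sqrt_mult)
    then have "K * sqrt c = Gamma ((\<nu> + 1) / 2) / (Gamma (\<nu> / 2) * sqrt pi)"
      using c by (simp add: K_def)
    then show ?thesis by (simp add: Beta_def Gamma_one_half_real add_divide_distrib add.commute mult.commute)
  qed
  define s where "s = (\<nu> + 1) / 2 + r"
  have s: "s > 1/2" "s - 1/2 = \<nu>/2 + r" using r by (auto simp: s_def add_divide_distrib)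
  have "has_bochner_integral lborel (\<lambda>u. (1 + (0 + (1 / sqrt c) * u)\<^sup>2) powr (- s)) (Beta (1/2) (\<nu>/2 + r) /\<^sub>R \<bar>1 / sqrt c\<bar>)"
    using has_bochner_integral_Beta_cauchy[OF s(1)] c unfolding s(2)
    by (subst (asm) lborel_has_bochner_integral_real_affine_iff[where c="1 / sqrt c" and t=0]) auto
  from has_bochner_integral_mult_right[OF this, of K]
  have "has_bochner_integral lborel (\<lambda>u. K * (1 + (0 + (1 / sqrt c) * u)\<^sup>2) powr (- s)) (K * (Beta (1/2) (\<nu>/2 + r) /\<^sub>R \<bar>1 / sqrt c\<bar>))"
    by simp
  moreover have "K * (Beta (1/2) (\<nu>/2 + r) /\<^sub>R \<bar>1 / sqrt c\<bar>) = (K * sqrt c) * Beta (1/2) (\<nu>/2 + r)"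
    using c by simp
  moreover have "K * (1 + (0 + (1 / sqrt c) * u)\<^sup>2) powr (- s) = t_std_dens \<nu> u * (1 + u\<^sup>2 / (\<nu> - 2)) powr (- r)" for u
  proof -
    have "(0 + (1 / sqrt c) * u)\<^sup>2 = u\<^sup>2 / c" using c by (simp add: power_divide)
    moreover have "- s = - (\<nu> + 1) / 2 + - r" unfolding s_def by linarith
    ultimately show ?thesis
      by (simp only: powr_add t_std_dens_def K_def c_def mult.assoc)
  qed
  ultimately show ?thesis by (simp add: K)
qed


section \<open>Joint moments of a t variable and its score\<close>

lemma t_std_dens_pos: "\<nu> > 2 \<Longrightarrow> t_std_dens \<nu> u > 0"
  unfolding t_std_dens_def
  by (intro mult_pos_pos divide_pos_pos Gamma_real_pos) (auto simp: add_pos_nonneg add_nonneg_eq_0_iff)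

lemma measurable_t_std_dens [measurable]: "t_std_dens \<nu> \<in> borel_measurable borel"
  unfolding t_std_dens_def[abs_def] by measurable

text \<open>Minus the derivative of the log-density, \<open>W u\<close> in the notation of the paper.\<close>
definition t_score :: "real \<Rightarrow> real \<Rightarrow> real" where
  "t_score \<nu> u = (\<nu> + 1) / (\<nu> - 2 + u\<^sup>2) * u"

lemma measurable_t_score [measurable]: "t_score \<nu> \<in> borel_measurable borel"
  unfolding t_score_def[abs_def] by measurable

text \<open>The table of E[(W u)^i u^j] for exponents up to 2. The default 1 serves three cases:
  total mass (0,0), unit variance (0,2) and the score identity (1,1).\<close>

definition t_moment :: "real \<Rightarrow> nat \<Rightarrow> nat \<Rightarrow> real" where
  "t_moment \<nu> i j = (if odd (i + j) then 0 else if i = 2 then (if j = 2 then 3 * phi \<nu> else psi \<nu>) else 1)"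

context
  fixes \<nu> :: real
  assumes nu: "\<nu> > 2"
begin

private definition q :: "real \<Rightarrow> real" where "q u = (\<nu> - 2) / (\<nu> - 2 + u\<^sup>2)"

private lemma pos: "\<nu> - 2 + u\<^sup>2 > 0" for u
  using nu by (simp add: add_pos_nonneg)

private lemma q_powr: "(1 + u\<^sup>2 / (\<nu> - 2)) powr (- 1) = q u" "(1 + u\<^sup>2 / (\<nu> - 2)) powr (- 2) = (q u)\<^sup>2"
  "(1 + u\<^sup>2 / (\<nu> - 2)) powr (- 0) = 1" "(1 + u\<^sup>2 / (\<nu> - 2)) powr (- (- 1)) = 1 + u\<^sup>2 / (\<nu> - 2)"
proof -
  have *: "1 + u\<^sup>2 / (\<nu> - 2) = (\<nu> - 2 + u\<^sup>2) / (\<nu> - 2)" using nu by (simp add: field_simps)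
  have "1 + u\<^sup>2 / (\<nu> - 2) > 0" using nu by (simp add: add_pos_nonneg)
  then show "(1 + u\<^sup>2 / (\<nu> - 2)) powr (- 1) = q u" "(1 + u\<^sup>2 / (\<nu> - 2)) powr (- 2) = (q u)\<^sup>2"
  "(1 + u\<^sup>2 / (\<nu> - 2)) powr (- 0) = 1" "(1 + u\<^sup>2 / (\<nu> - 2)) powr (- (- 1)) = 1 + u\<^sup>2 / (\<nu> - 2)"
    using pos[of u] nu by (auto simp: powr_minus_divide powr_numeral powr_one power_divide * q_def)
qed

private lemma Beta_ratio: "y > 0 \<Longrightarrow> Beta (1/2) (y + 1) = y / (y + 1/2) * Beta (1/2) (y::real)"
proof -
  assume y: "y > 0"
  then have "y \<notin> \<int>\<^sub>\<le>\<^sub>0" by (auto elim!: nonpos_Ints_cases)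
  from Beta_plus1_right[OF this, of "1/2"] show ?thesis using y by (simp add: field_simps)
qed

private lemma Beta_half_pos: "Beta (1/2) (\<nu>/2) > 0"
  using nu by (simp add: Beta_def)

text \<open>The Beta family at r = 0, 1, 2, -1, reduced to rational functions by the recurrence in
  the second argument. The variance comes from r = -1, whose parameter nu/2 - 1 is positive exactly
  when nu > 2.\<close>

private lemma moment_q:
  "has_bochner_integral lborel (\<lambda>u. t_std_dens \<nu> u) 1"
  "has_bochner_integral lborel (\<lambda>u. t_std_dens \<nu> u * q u) (\<nu> / (\<nu> + 1))"
  "has_bochner_integral lborel (\<lambda>u. t_std_dens \<nu> u * (q u)\<^sup>2) (\<nu> * (\<nu> + 2) / ((\<nu> + 1) * (\<nu> + 3)))"
  "has_bochner_integral lborel (\<lambda>u. t_std_dens \<nu> u * u\<^sup>2) 1"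
proof -
  note I = has_bochner_integral_t_std_dens_powr[OF nu]
  have b1: "Beta (1/2) (\<nu>/2 + 1) = \<nu> / (\<nu> + 1) * Beta (1/2) (\<nu>/2)"
    using Beta_ratio[of "\<nu>/2"] nu by (simp add: field_simps)
  have b2: "Beta (1/2) (\<nu>/2 + 2) = (\<nu> + 2) / (\<nu> + 3) * (\<nu> / (\<nu> + 1) * Beta (1/2) (\<nu>/2))"
  proof -
    have r: "(\<nu>/2 + 1) / (\<nu>/2 + 1 + 1/2) = (\<nu> + 2) / (\<nu> + 3)"
      using nu by (simp add: divide_simps) (simp add: algebra_simps)
    have e: "\<nu>/2 + 1 + 1 = \<nu>/2 + 2" by simp
    have "Beta (1/2) (\<nu>/2 + 1 + 1) = (\<nu>/2 + 1) / (\<nu>/2 + 1 + 1/2) * Beta (1/2) (\<nu>/2 + 1)"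
      by (rule Beta_ratio) (use nu in simp)
    then show ?thesis unfolding e r b1 .
  qed
  have bm: "Beta (1/2) (\<nu>/2 + - 1) = (\<nu> - 1) / (\<nu> - 2) * Beta (1/2) (\<nu>/2)"
  proof -
    have "(\<nu>/2 - 1) / (\<nu>/2 - 1 + 1/2) = (\<nu> - 2) / (\<nu> - 1)"
      using nu by (simp add: divide_simps) (simp add: algebra_simps)
    then have "Beta (1/2) (\<nu>/2) = (\<nu> - 2) / (\<nu> - 1) * Beta (1/2) (\<nu>/2 - 1)"
      using Beta_ratio[of "\<nu>/2 - 1"] nu by simp
    then show ?thesis using nu by simp
  qed
  show 0: "has_bochner_integral lborel (\<lambda>u. t_std_dens \<nu> u) 1"
    using I[of 0] nu Beta_half_pos unfolding q_powr by simp
  show "has_bochner_integral lborel (\<lambda>u. t_std_dens \<nu> u * q u) (\<nu> / (\<nu> + 1))"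
    using I[of 1] nu Beta_half_pos unfolding q_powr b1 by simp
  show "has_bochner_integral lborel (\<lambda>u. t_std_dens \<nu> u * (q u)\<^sup>2) (\<nu> * (\<nu> + 2) / ((\<nu> + 1) * (\<nu> + 3)))"
    using I[of 2] nu Beta_half_pos unfolding q_powr b2 by (simp add: mult.commute)
  have m: "has_bochner_integral lborel (\<lambda>u. t_std_dens \<nu> u * (1 + u\<^sup>2 / (\<nu> - 2))) ((\<nu> - 1) / (\<nu> - 2))"
    using I[of "-1"] nu Beta_half_pos unfolding q_powr bm by simp
  have "(\<nu> - 2) * (t_std_dens \<nu> u * (1 + u\<^sup>2 / (\<nu> - 2)) - t_std_dens \<nu> u) = t_std_dens \<nu> u * u\<^sup>2" for u
    using nu by (simp add: distrib_left)
  moreover have "(\<nu> - 2) * ((\<nu> - 1) / (\<nu> - 2) - 1) = 1" using nu by (simp add: field_simps)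
  ultimately show "has_bochner_integral lborel (\<lambda>u. t_std_dens \<nu> u * u\<^sup>2) 1"
    using has_bochner_integral_mult_right[OF has_bochner_integral_diff[OF m 0], of "\<nu> - 2"]
    by (simp only:)
qed

text \<open>In the variable \<open>q\<close> the even expressions in the score are polynomials of
  degree at most 2, so their means follow from those of \<open>q\<close> and its square.\<close>

private lemma t_score_q: "t_score \<nu> u * u = (\<nu> + 1) * (1 - q u)"
  "(t_score \<nu> u)\<^sup>2 = (\<nu> + 1)\<^sup>2 / (\<nu> - 2) * (q u - (q u)\<^sup>2)"
  using pos[of u] nu by (auto simp: t_score_def q_def power2_eq_square divide_simps) (simp_all add: algebra_simps)

private lemma moment_even:
  "has_bochner_integral lborel (\<lambda>u. t_std_dens \<nu> u * (t_score \<nu> u * u)) 1"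
  "has_bochner_integral lborel (\<lambda>u. t_std_dens \<nu> u * (t_score \<nu> u)\<^sup>2) (psi \<nu>)"
  "has_bochner_integral lborel (\<lambda>u. t_std_dens \<nu> u * ((t_score \<nu> u)\<^sup>2 * u\<^sup>2)) (3 * phi \<nu>)"
proof -
  have "has_bochner_integral lborel (\<lambda>u. (\<nu> + 1) * (t_std_dens \<nu> u - t_std_dens \<nu> u * q u)) ((\<nu> + 1) * (1 - \<nu> / (\<nu> + 1)))"
    by (intro has_bochner_integral_mult_right has_bochner_integral_diff moment_q)
  moreover have "(\<nu> + 1) * (1 - \<nu> / (\<nu> + 1)) = 1" using nu by (simp add: field_simps)
  ultimately show "has_bochner_integral lborel (\<lambda>u. t_std_dens \<nu> u * (t_score \<nu> u * u)) 1"
    unfolding t_score_q by (simp add: algebra_simps)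
  have "has_bochner_integral lborel (\<lambda>u. (\<nu> + 1)\<^sup>2 / (\<nu> - 2) * (t_std_dens \<nu> u * q u - t_std_dens \<nu> u * (q u)\<^sup>2))
      ((\<nu> + 1)\<^sup>2 / (\<nu> - 2) * (\<nu> / (\<nu> + 1) - \<nu> * (\<nu> + 2) / ((\<nu> + 1) * (\<nu> + 3))))"
    by (intro has_bochner_integral_mult_right has_bochner_integral_diff moment_q)
  moreover have "(\<nu> + 1)\<^sup>2 / (\<nu> - 2) * (\<nu> / (\<nu> + 1) - \<nu> * (\<nu> + 2) / ((\<nu> + 1) * (\<nu> + 3))) = psi \<nu>"
    using nu by (simp add: psi_def phi_def power2_eq_square divide_simps) (simp add: algebra_simps)
  moreover have "(\<nu> + 1)\<^sup>2 / (\<nu> - 2) * (t_std_dens \<nu> u * q u - t_std_dens \<nu> u * (q u)\<^sup>2) = t_std_dens \<nu> u * (t_score \<nu> u)\<^sup>2" for u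
    unfolding t_score_q by (simp add: right_diff_distrib mult.left_commute)
  ultimately show "has_bochner_integral lborel (\<lambda>u. t_std_dens \<nu> u * (t_score \<nu> u)\<^sup>2) (psi \<nu>)"
    by (simp only:)
  have "has_bochner_integral lborel (\<lambda>u. (\<nu> + 1)\<^sup>2 * (t_std_dens \<nu> u - 2 * (t_std_dens \<nu> u * q u) + t_std_dens \<nu> u * (q u)\<^sup>2))
      ((\<nu> + 1)\<^sup>2 * (1 - 2 * (\<nu> / (\<nu> + 1)) + \<nu> * (\<nu> + 2) / ((\<nu> + 1) * (\<nu> + 3))))"
    by (intro has_bochner_integral_mult_right has_bochner_integral_add has_bochner_integral_diff moment_q)
  moreover have "(\<nu> + 1)\<^sup>2 * (1 - 2 * (\<nu> / (\<nu> + 1)) + \<nu> * (\<nu> + 2) / ((\<nu> + 1) * (\<nu> + 3))) = 3 * phi \<nu>"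
    using nu by (simp add: phi_def power2_eq_square divide_simps) (simp add: algebra_simps)
  moreover have "(\<nu> + 1)\<^sup>2 * (t_std_dens \<nu> u - 2 * (t_std_dens \<nu> u * q u) + t_std_dens \<nu> u * (q u)\<^sup>2)
      = t_std_dens \<nu> u * ((t_score \<nu> u)\<^sup>2 * u\<^sup>2)" for u
  proof -
    have e: "(t_score \<nu> u)\<^sup>2 * u\<^sup>2 = ((\<nu> + 1) * (1 - q u))\<^sup>2"
      using t_score_q(1)[of u] by (metis power_mult_distrib)
    show ?thesis unfolding e by (simp add: power2_eq_square algebra_simps)
  qed
  ultimately show "has_bochner_integral lborel (\<lambda>u. t_std_dens \<nu> u * ((t_score \<nu> u)\<^sup>2 * u\<^sup>2)) (3 * phi \<nu>)"
    by (simp only:)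
qed

text \<open>The score is bounded, so every product is dominated by a multiple of 1 + u^2 and
  integrability rests on the variance.\<close>

private lemma integrable_moment:
  assumes "i \<le> 2" "j \<le> 2"
  shows "integrable lborel (\<lambda>u. t_std_dens \<nu> u * (t_score \<nu> u ^ i * u ^ j))"
proof -
  \<comment> \<open>The summands 1/(nu - 2) and 1 bound |u|/(nu - 2 + u^2) for |u| \<le> 1 and |u| >
    1 respectively; C \<ge> 1 lets C^i be replaced by C^2.\<close>
  define C where "C = (\<nu> + 1) * (1 / (\<nu> - 2) + 1)"
  have C: "C \<ge> 1" using nu by (auto simp: C_def intro: order_trans[of 1 "\<nu> + 1"])
  have w: "\<bar>t_score \<nu> u\<bar> \<le> C" for u
  proof -
    have "\<bar>u\<bar> / (\<nu> - 2 + u\<^sup>2) \<le> 1 / (\<nu> - 2) + 1"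
    proof (cases "\<bar>u\<bar> \<le> 1")
      case True
      have "\<bar>u\<bar> / (\<nu> - 2 + u\<^sup>2) \<le> 1 / (\<nu> - 2)" using True nu by (intro frac_le) auto
      then show ?thesis by linarith
    next
      case False
      then have "\<bar>u\<bar> * 1 \<le> \<bar>u\<bar> * \<bar>u\<bar>" by (intro mult_left_mono) auto
      then have "\<bar>u\<bar> \<le> u\<^sup>2" by (simp add: power2_eq_square)
      then have "\<bar>u\<bar> / (\<nu> - 2 + u\<^sup>2) \<le> 1" using nu pos[of u] by simp
      then show ?thesis using nu by (smt (verit) divide_nonneg_nonneg)
    qed
    then have "(\<nu> + 1) * (\<bar>u\<bar> / (\<nu> - 2 + u\<^sup>2)) \<le> C" unfolding C_def using nu by (intro mult_left_mono) auto
    moreover have "\<bar>t_score \<nu> u\<bar> = (\<nu> + 1) * (\<bar>u\<bar> / (\<nu> - 2 + u\<^sup>2))"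
      using nu abs_of_pos[OF pos[of u]] by (simp add: t_score_def abs_mult abs_divide)
    ultimately show ?thesis by simp
  qed
  have wi: "\<bar>t_score \<nu> u\<bar> ^ i \<le> C ^ 2" for u
  proof -
    have "\<bar>t_score \<nu> u\<bar> ^ i \<le> C ^ i" by (intro power_mono w) simp
    also have "\<dots> \<le> C ^ 2" using C assms by (intro power_increasing)
    finally show ?thesis .
  qed
  have uj: "\<bar>u\<bar> ^ j \<le> 1 + u\<^sup>2" for u :: real
  proof (cases "\<bar>u\<bar> \<le> 1")
    case True
    then have "\<bar>u\<bar> ^ j \<le> 1" by (simp add: power_le_one)
    then show ?thesis by (smt (verit) zero_le_power2)
  next
    case False
    then have "\<bar>u\<bar> ^ j \<le> \<bar>u\<bar> ^ 2" using assms by (intro power_increasing) auto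
    then show ?thesis by simp
  qed
  have "integrable lborel (\<lambda>u. C\<^sup>2 * (t_std_dens \<nu> u + t_std_dens \<nu> u * u\<^sup>2))"
    using moment_q(1,4) by (intro integrable_mult_right integrable_add) (auto simp: has_bochner_integral_iff)
  then show ?thesis
  proof (rule Bochner_Integration.integrable_bound)
    have "norm (t_std_dens \<nu> u * (t_score \<nu> u ^ i * u ^ j)) \<le> norm (C\<^sup>2 * (t_std_dens \<nu> u + t_std_dens \<nu> u * u\<^sup>2))" for u
    proof -
      have p: "t_std_dens \<nu> u \<ge> 0" using t_std_dens_pos[OF nu, of u] by simp
      have "norm (t_std_dens \<nu> u * (t_score \<nu> u ^ i * u ^ j)) = t_std_dens \<nu> u * (\<bar>t_score \<nu> u\<bar> ^ i * \<bar>u\<bar> ^ j)"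
        using p by (simp add: abs_mult power_abs)
      also have "\<dots> \<le> t_std_dens \<nu> u * (C\<^sup>2 * (1 + u\<^sup>2))"
        using p wi[of u] uj[of u] by (intro mult_left_mono mult_mono) auto
      also have "\<dots> = norm (C\<^sup>2 * (t_std_dens \<nu> u + t_std_dens \<nu> u * u\<^sup>2))"
        using p by (simp add: abs_mult distrib_left mult.left_commute add_nonneg_nonneg)
      finally show ?thesis .
    qed
    then show "AE u in lborel. norm (t_std_dens \<nu> u * (t_score \<nu> u ^ i * u ^ j)) \<le> norm (C\<^sup>2 * (t_std_dens \<nu> u + t_std_dens \<nu> u * u\<^sup>2))"
      by simp
  qed measurable
qed

private lemma moment_odd:
  assumes "i \<le> 2" "j \<le> 2" "odd (i + j)"
  shows "has_bochner_integral lborel (\<lambda>u. t_std_dens \<nu> u * (t_score \<nu> u ^ i * u ^ j)) 0"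
proof (rule has_bochner_integral_odd_function)
  show "has_bochner_integral lborel (\<lambda>u. indicator {0..} u *\<^sub>R (t_std_dens \<nu> u * (t_score \<nu> u ^ i * u ^ j)))
     (integral\<^sup>L lborel (\<lambda>u. indicator {0..} u *\<^sub>R (t_std_dens \<nu> u * (t_score \<nu> u ^ i * u ^ j))))"
    by (intro has_bochner_integral_integrable integrable_mult_indicator integrable_moment assms) simp
  fix u
  have "t_score \<nu> (- u) = - t_score \<nu> u" "t_std_dens \<nu> (- u) = t_std_dens \<nu> u"
    by (auto simp: t_score_def t_std_dens_def)
  moreover have "(- t_score \<nu> u) ^ i * (- u) ^ j = - (t_score \<nu> u ^ i * u ^ j)"
    using assms(3) by (cases "even i") auto
  ultimately show "t_std_dens \<nu> (- u) * (t_score \<nu> (- u) ^ i * (- u) ^ j) = - (t_std_dens \<nu> u * (t_score \<nu> u ^ i * u ^ j))"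
    by simp
qed

lemma has_bochner_integral_t_moment:
  assumes "i \<le> 2" "j \<le> 2"
  shows "has_bochner_integral lborel (\<lambda>u. t_std_dens \<nu> u * (t_score \<nu> u ^ i * u ^ j)) (t_moment \<nu> i j)"
proof (cases "odd (i + j)")
  case True
  then show ?thesis using moment_odd[OF assms] by (simp add: t_moment_def)
next
  case False
  have "(i = 0 \<and> j = 0) \<or> (i = 0 \<and> j = 2) \<or> (i = 1 \<and> j = 1) \<or> (i = 2 \<and> j = 0) \<or> (i = 2 \<and> j = 2)"
    using assms False by presburger
  then show ?thesis
    using moment_q(1,4) moment_even by (auto simp: t_moment_def)
qed

end

section \<open>Block matrices\<close>

lemma inner_matrix_transpose:
  fixes M :: "real^'n::finite^'m::finite"
  shows "(transpose M *v x) \<bullet> y = x \<bullet> (M *v y)"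
  by (simp add: dot_lmul_matrix transpose_matrix_vector)

lemma sum_by_blocks:
  fixes g :: "'i::finite \<Rightarrow> 'k::finite" and f :: "'i \<Rightarrow> real"
  shows "(\<Sum>a\<in>UNIV. f a) = (\<Sum>k\<in>UNIV. \<Sum>a\<in>{a. g a = k}. f a)"
  using sum.group[of UNIV UNIV g f] by simp

text \<open>
  \<open>block_lift g M l\<close> is \<open>Q blockdiag(M, l\<^sub>1 I, \<dots>, l\<^sub>K I) Q'\<close> of the canonical representation;
  it does not depend on the choice of the matrices \<open>v\<^sub>m\<^sup>\<bottom>\<close> inside \<open>Q\<close>.
\<close>
definition block_lift :: "('i::finite \<Rightarrow> 'k::finite) \<Rightarrow> real^'k^'k \<Rightarrow> ('k \<Rightarrow> real) \<Rightarrow> real^'i^'i" where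
  "block_lift g M l = (\<chi> a b. M $ g a $ g b / (sqrt (nb g (g a)) * sqrt (nb g (g b)))
     + (if g a = g b then l (g a) * ((if a = b then 1 else 0) - 1 / nb g (g a)) else 0))"

context
  fixes g :: "'i::finite \<Rightarrow> 'k::finite"
  assumes blocks: "\<forall>k. card {a. g a = k} \<ge> 2"
begin

lemma nb_ge_2: "nb g k \<ge> 2"
  using blocks[rule_format, of k] by (simp add: nb_def)

lemma nb_pos: "nb g k > 0"
  using nb_ge_2[of k] by linarith

lemma nb_gt_1: "nb g k - 1 > 0"
  using nb_ge_2[of k] by linarith

text \<open>Block means and deviations from them are complementary coordinates: \<open>M\<close>
  acts on the scaled means, and \<open>l\<close> multiplies the deviations. Products and inverses of
  lifts follow from this description.\<close>

lemma block_lift_mult_vec: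
  "(block_lift g M l *v x) $ a = (M *v Y0 g x) $ g a / sqrt (nb g (g a)) + l (g a) * FU g x a"
proof -
  have "(block_lift g M l *v x) $ a
      = (\<Sum>b\<in>UNIV. M $ g a $ g b / (sqrt (nb g (g a)) * sqrt (nb g (g b))) * x $ b)
      + (\<Sum>b\<in>UNIV. (if g a = g b then l (g a) * ((if a = b then 1 else 0) - 1 / nb g (g a)) else 0) * x $ b)"
    by (simp add: block_lift_def matrix_vector_mult_def distrib_right sum.distrib)
  also have "(\<Sum>b\<in>UNIV. M $ g a $ g b / (sqrt (nb g (g a)) * sqrt (nb g (g b))) * x $ b)
      = (\<Sum>k\<in>UNIV. \<Sum>b\<in>{b. g b = k}. M $ g a $ k / (sqrt (nb g (g a)) * sqrt (nb g k)) * x $ b)"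
    by (subst sum_by_blocks[of _ g]) (auto intro!: sum.cong)
  also have "\<dots> = (M *v Y0 g x) $ g a / sqrt (nb g (g a))"
    by (simp add: matrix_vector_mult_def Y0_def sum_divide_distrib sum_distrib_left mult_ac)
  also have "(\<Sum>b\<in>UNIV. (if g a = g b then l (g a) * ((if a = b then 1 else 0) - 1 / nb g (g a)) else 0) * x $ b)
      = (\<Sum>b\<in>{b. g b = g a}. l (g a) * ((if a = b then 1 else 0) - 1 / nb g (g a)) * x $ b)"
    by (rule sum.mono_neutral_cong_right) auto
  also have "\<dots> = l (g a) * (\<Sum>b\<in>{b. g b = g a}. (if b = a then x $ b else 0) - x $ b / nb g (g a))"
    by (auto simp: sum_distrib_left algebra_simps intro!: sum.cong)
  also have "(\<Sum>b\<in>{b. g b = g a}. (if b = a then x $ b else 0) - x $ b / nb g (g a)) = FU g x a"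
    by (simp add: sum_subtractf FU_def sum_divide_distrib)
  finally show ?thesis .
qed

lemma sum_block_const: "(\<Sum>a\<in>{a. g a = k}. c) = nb g k * c"
  by (simp add: nb_def)

lemma sum_block_FU: "(\<Sum>a\<in>{a. g a = k}. FU g x a) = 0"
proof -
  have "(\<Sum>a\<in>{a. g a = k}. FU g x a) = (\<Sum>a\<in>{a. g a = k}. x $ a - (\<Sum>b\<in>{b. g b = k}. x $ b) / nb g k)"
    by (rule sum.cong) (auto simp: FU_def)
  also have "\<dots> = 0" using nb_pos[of k] by (simp only: sum_subtractf sum_block_const) simp
  finally show ?thesis .
qed

lemma sum_block_lift:
  "(\<Sum>a\<in>{a. g a = k}. (block_lift g M l *v x) $ a) = sqrt (nb g k) * (M *v Y0 g x) $ k"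
proof -
  have "(\<Sum>a\<in>{a. g a = k}. (block_lift g M l *v x) $ a)
      = (\<Sum>a\<in>{a. g a = k}. (M *v Y0 g x) $ k / sqrt (nb g k) + l k * FU g x a)"
    by (rule sum.cong) (auto simp: block_lift_mult_vec)
  also have "\<dots> = nb g k * ((M *v Y0 g x) $ k / sqrt (nb g k)) + l k * (\<Sum>a\<in>{a. g a = k}. FU g x a)"
    by (simp only: sum.distrib sum_block_const sum_distrib_left)
  also have "\<dots> = sqrt (nb g k) * (M *v Y0 g x) $ k"
    using nb_pos[of k] by (simp add: sum_block_FU real_div_sqrt flip: times_divide_eq_left)
  finally show ?thesis .
qed

lemma Y0_block_lift: "Y0 g (block_lift g M l *v x) = M *v Y0 g x"
  using nb_pos by (simp add: vec_eq_iff Y0_def[of g "block_lift g M l *v x"] sum_block_lift less_imp_neq[symmetric])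

lemma FU_block_lift: "FU g (block_lift g M l *v x) a = l (g a) * FU g x a"
  unfolding FU_def[of g "block_lift g M l *v x"] sum_block_lift block_lift_mult_vec
  using nb_pos[of "g a"] by (simp add: field_simps)

lemma block_lift_mult: "block_lift g M l ** block_lift g M' l' = block_lift g (M ** M') (\<lambda>k. l k * l' k)"
  unfolding matrix_eq
  by (simp add: matrix_vector_mul_assoc[symmetric] vec_eq_iff block_lift_mult_vec Y0_block_lift FU_block_lift)

lemma block_lift_one: "block_lift g (mat 1) (\<lambda>_. 1) = mat 1"
proof -
  have "(block_lift g (mat 1) (\<lambda>_. 1) *v x) $ a = x $ a" for x a
    using nb_pos[of "g a"] by (simp add: block_lift_mult_vec Y0_def FU_def)
  then show ?thesis unfolding matrix_eq by (simp add: vec_eq_iff)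
qed

lemma symm_block_lift: "symm_mat M \<Longrightarrow> symm_mat (block_lift g M l)"
  unfolding symm_mat_def transpose_def vec_eq_iff block_lift_def by (auto simp: mult.commute)

text \<open>The weight \<open>nb g k - 1\<close> is the dimension of the deviations inside block
  \<open>k\<close>, on which \<open>l k\<close> acts as a scalar.\<close>

lemma trace_block_lift: "trace (block_lift g M l) = trace M + (\<Sum>k\<in>UNIV. l k * (nb g k - 1))"
proof -
  have "trace (block_lift g M l) = (\<Sum>k\<in>UNIV. \<Sum>a\<in>{a. g a = k}. M $ k $ k / nb g k + l k * (1 - 1 / nb g k))"
    unfolding trace_def block_lift_def
    by (subst sum_by_blocks[of _ g]) (auto intro!: sum.cong simp: nb_pos less_imp_le)
  also have "\<dots> = (\<Sum>k\<in>UNIV. M $ k $ k + l k * (nb g k - 1))"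
    unfolding sum_block_const
  proof (rule sum.cong[OF refl])
    fix k show "nb g k * (M $ k $ k / nb g k + l k * (1 - 1 / nb g k)) = M $ k $ k + l k * (nb g k - 1)"
      using nb_pos[of k] by (simp add: field_simps)
  qed
  finally show ?thesis by (simp add: trace_def sum.distrib)
qed

text \<open>The canonical form C = Q D Q'. \<open>lam\<close> is the value for which A_kk/n + lambda
  (1 - 1/n) is the unit diagonal, and A_kk/n - lambda/n is then the correlation (A_kk - 1)/(n -
  1).\<close>

lemma blockC_eq_block_lift: "blockC g A = block_lift g A (lam g A)"
proof -
  have "blockC g A $ a $ b = block_lift g A (lam g A) $ a $ b" for a b
  proof -
    define n where "n = nb g (g a)"
    have n: "n \<noteq> 0" "n - 1 \<noteq> 0" "n \<ge> 0" using nb_pos[of "g a"] nb_gt_1[of "g a"] by (auto simp: n_def)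
    consider "a = b" | "a \<noteq> b" "g a = g b" | "g a \<noteq> g b" by blast
    then show ?thesis
    proof cases
      case 1
      have "A $ g a $ g a / n + lam g A (g a) * (1 - 1 / n) = 1"
        using n by (simp add: lam_def n_def[symmetric] divide_simps)
      then show ?thesis using 1 n unfolding n_def by (simp add: blockC_def block_lift_def)
    next
      case 2
      have "A $ g a $ g a / n + lam g A (g a) * (0 - 1 / n) = (A $ g a $ g a - 1) / (n - 1)"
        using n by (simp add: lam_def n_def[symmetric] divide_simps) (simp add: algebra_simps)
      then show ?thesis using 2 n unfolding n_def by (simp add: blockC_def block_lift_def)
    next
      case 3
      then show ?thesis by (auto simp: blockC_def block_lift_def real_sqrt_mult)
    qed
  qed
  then show ?thesis by (simp add: vec_eq_iff)
qed

lemma block_lift_inverse: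
  assumes "M ** N = mat 1" "\<And>k. l k \<noteq> 0"
  shows "block_lift g M l ** block_lift g N (\<lambda>k. 1 / l k) = mat 1"
  by (simp add: block_lift_mult assms block_lift_one)

text \<open>Lifting the roots gives a symmetric \<open>R\<close> whose square is the matrix, so the
  quadratic form is |R x|^2; lifting their inverses gives a left inverse of
  \<open>R\<close>.\<close>

lemma posdef_block_lift:
  assumes "symm_mat M" "posdef M" "\<And>k. l k > 0"
  shows "posdef (block_lift g M l)"
  unfolding posdef_def
proof (intro allI impI)
  fix x :: "real^'i" assume x: "x \<noteq> 0"
  define R where "R = block_lift g (msqrt M) (\<lambda>k. sqrt (l k))"
  note S = msqrt_props[OF assms(1,2)]
  have l: "\<And>k. l k \<ge> 0" using assms(3) less_imp_le by blast
  have RR: "block_lift g M l = R ** R"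
    unfolding R_def block_lift_mult S(3) using l by simp
  have "transpose R = R" using symm_block_lift[OF S(1)] by (simp add: R_def symm_mat_def)
  then have "x \<bullet> (block_lift g M l *v x) = (R *v x) \<bullet> (R *v x)"
    using inner_matrix_transpose[of R x "R *v x"] by (simp add: RR matrix_vector_mul_assoc)
  moreover have "R *v x \<noteq> 0"
  proof
    assume "R *v x = 0"
    moreover have "block_lift g (matrix_inv (msqrt M)) (\<lambda>k. 1 / sqrt (l k)) ** R = mat 1"
      using block_lift_inverse[OF posdef_invertible(1)[OF S(2)], of "\<lambda>k. sqrt (l k)"] assms(3)
      unfolding R_def by (metis less_irrefl matrix_left_right_inverse real_sqrt_eq_zero_cancel_iff)
    ultimately show False using x
      by (metis matrix_vector_mul_assoc matrix_vector_mul_lid matrix_vector_mult_0_right)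
  qed
  ultimately show "0 < x \<bullet> (block_lift g M l *v x)" by simp
qed

lemma msqrt_block_lift:
  assumes "symm_mat M" "posdef M" "\<And>k. l k > 0"
  shows "msqrt (block_lift g M l) = block_lift g (msqrt M) (\<lambda>k. sqrt (l k))"
proof (rule msqrt_eqI)
  note S = msqrt_props[OF assms(1,2)]
  have l: "\<And>k. l k \<ge> 0" using assms(3) less_imp_le by blast
  show "symm_mat (block_lift g (msqrt M) (\<lambda>k. sqrt (l k)))" by (rule symm_block_lift[OF S(1)])
  show "posdef (block_lift g (msqrt M) (\<lambda>k. sqrt (l k)))"
    by (rule posdef_block_lift[OF S(1,2)]) (simp add: assms)
  show "block_lift g (msqrt M) (\<lambda>k. sqrt (l k)) ** block_lift g (msqrt M) (\<lambda>k. sqrt (l k)) = block_lift g M l"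
    using l by (simp add: block_lift_mult S)
qed

lemma matrix_inv_msqrt_blockC:
  assumes "symm_mat A" "posdef A" "\<And>k. lam g A k > 0"
  shows "matrix_inv (msqrt (blockC g A)) = block_lift g (matrix_inv (msqrt A)) (\<lambda>k. 1 / sqrt (lam g A k))"
  unfolding blockC_eq_block_lift msqrt_block_lift[OF assms]
  by (intro matrix_inv_eq block_lift_inverse posdef_invertible msqrt_props assms(1,2))
     (use assms(3) in \<open>simp add: less_imp_neq[symmetric]\<close>)

end

section \<open>Derivatives of inverse, determinant and square root\<close>

text \<open>An explicit quadratic remainder is what the algebraic identities for inverse and root
  deliver; affine maps use C = 0.\<close>

lemma has_derivative_quadratic_bound:
  fixes f :: "'a::real_normed_vector \<Rightarrow> 'b::real_normed_vector"
  assumes "bounded_linear f'" and "eventually (\<lambda>y. norm (f y - f x - f' (y - x)) \<le> C * (norm (y - x))\<^sup>2) (at x within S)"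
  shows "(f has_derivative f') (at x within S)"
  unfolding has_derivative_at_within
proof (intro conjI assms(1))
  have "eventually (\<lambda>y. norm ((f y - f x - f' (y - x)) /\<^sub>R norm (y - x)) \<le> \<bar>C\<bar> * norm (y - x)) (at x within S)"
    using assms(2)
  proof eventually_elim
    case (elim y)
    show ?case
    proof (cases "y = x")
      case False
      have "norm (f y - f x - f' (y - x)) \<le> \<bar>C\<bar> * (norm (y - x))\<^sup>2"
        using elim mult_right_mono[OF abs_ge_self[of C], of "(norm (y - x))\<^sup>2"] by simp
      then show ?thesis using False by (simp only: norm_scaleR) (simp add: field_simps power2_eq_square)
    qed simp
  qed
  moreover have "((\<lambda>y. \<bar>C\<bar> * norm (y - x)) \<longlongrightarrow> 0) (at x within S)"
  proof -
    have "((\<lambda>y. \<bar>C\<bar> * norm (y - x)) \<longlongrightarrow> \<bar>C\<bar> * norm (x - x)) (at x within S)"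
      by (intro tendsto_intros)
    then show ?thesis by simp
  qed
  ultimately show "((\<lambda>y. (f y - f x - f' (y - x)) /\<^sub>R norm (y - x)) \<longlongrightarrow> 0) (at x within S)"
    by (rule Lim_null_comparison)
qed

text \<open>A perturbation below m/(2K), with K the bilinear constant of matrix times vector, costs
  at most m/2 of coercivity. One constant for a whole neighbourhood bounds nearby inverses
  uniformly.\<close>

lemma eventually_coercive:
  fixes M :: "real^'n::finite^'n"
  assumes m: "m > 0" "\<And>x. m * (x \<bullet> x) \<le> x \<bullet> (M *v x)"
  shows "eventually (\<lambda>T. \<forall>x. m/2 * (x \<bullet> x) \<le> x \<bullet> (T *v x)) (at M within S)"
proof -
  obtain K where K: "K > 0" "\<And>(N::real^'n^'n) x. norm (N *v x) \<le> norm N * norm x * K"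
    using matvec.pos_bounded by blast
  have "eventually (\<lambda>T. dist T M < m / (2 * K)) (at M within S)"
    using m K by (auto simp: eventually_at intro!: exI[of _ "m / (2 * K)"])
  then show ?thesis
  proof eventually_elim
    case (elim T)
    then have d: "norm (M - T) * K \<le> m / 2"
      using K by (simp add: dist_norm norm_minus_commute field_simps)
    have "m/2 * (x \<bullet> x) \<le> x \<bullet> (T *v x)" for x
    proof -
      have "x \<bullet> ((M - T) *v x) \<le> norm x * norm ((M - T) *v x)" by (rule norm_cauchy_schwarz)
      also have "\<dots> \<le> norm x * (norm (M - T) * norm x * K)" by (intro mult_left_mono K(2)) simp
      also have "\<dots> = (norm (M - T) * K) * (x \<bullet> x)"
        by (simp add: power2_norm_eq_inner[symmetric] power2_eq_square)
      also have "\<dots> \<le> m / 2 * (x \<bullet> x)" by (intro mult_right_mono d) simp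
      finally show ?thesis using m(2)[of x]
        by (simp add: matvec.diff_left inner_diff_right)
    qed
    then show ?case by blast
  qed
qed

lemma coercive_posdef:
  fixes M :: "real^'n::finite^'n"
  assumes "m > 0" "\<And>x. m * (x \<bullet> x) \<le> x \<bullet> (M *v x)"
  shows "posdef M"
  unfolding posdef_def
proof (intro allI impI)
  fix x :: "real^'n" assume "x \<noteq> 0"
  then have "0 < m * (x \<bullet> x)" using assms(1) by simp
  then show "0 < x \<bullet> (M *v x)" using assms(2)[of x] by linarith
qed

lemma eventually_posdef:
  assumes "posdef M"
  shows "eventually posdef (at M within S)"
proof -
  obtain m where m: "m > 0" "\<And>x. m * (x \<bullet> x) \<le> x \<bullet> (M *v x)"
    using posdef_coercive[OF assms] by blast
  from eventually_coercive[OF this, of S] show ?thesis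
    by eventually_elim (rule coercive_posdef[of "m/2"], use m in auto)
qed

text \<open>With J and I the inverses of M and T and D = T - M, the resolvent identity used from
  both sides gives the exact remainder I - J + J D J = J D I D J, quadratic in D once I is
  bounded.\<close>

lemma matrix_inv_has_derivative:
  fixes M :: "real^'n::finite^'n"
  assumes "posdef M"
  shows "(matrix_inv has_derivative (\<lambda>H. - (matrix_inv M ** H ** matrix_inv M))) (at M within S)"
proof -
  obtain m where m: "m > 0" "\<And>x. m * (x \<bullet> x) \<le> x \<bullet> (M *v x)"
    using posdef_coercive[OF assms] by blast
  obtain K where K: "K > 0" "\<And>(N::real^'n^'n) (N'::real^'n^'n). norm (N ** N') \<le> norm N * norm N' * K"
    using matmul.pos_bounded by blast
  define J where "J = matrix_inv M"
  note J = posdef_invertible[OF assms, folded J_def]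
  \<comment> \<open>The bound for |I|: since I T = 1, coercivity with m/2 gives m/2 |I|^2 \<le> <I,
    I T> = <I, 1> \<le> |I| |1|.\<close>
  define c where "c = 2 * norm (mat 1 :: real^'n^'n) / m"
  have bl: "bounded_linear (\<lambda>H. - (J ** H ** J))"
    by (intro bounded_linear_minus matmul.bounded_linear_left[THEN bounded_linear_compose] matmul.bounded_linear_right)
  show ?thesis
    unfolding J_def[symmetric]
  proof (rule has_derivative_quadratic_bound[OF bl])
    show "eventually (\<lambda>T. norm (matrix_inv T - matrix_inv M - - (J ** (T - M) ** J))
        \<le> (norm J * norm J * c * K^4) * (norm (T - M))\<^sup>2) (at M within S)"
      using eventually_coercive[OF m]
    proof eventually_elim
      case (elim T)
      have "posdef T" by (rule coercive_posdef[of "m/2"]) (use m elim in auto)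
      note T = posdef_invertible[OF this]
      define I where "I = matrix_inv T"
      define D where "D = T - M"
      have nI: "norm I \<le> c"
      proof (cases "I = 0")
        case False
        have "m/2 * (I \<bullet> I) \<le> I \<bullet> (I ** T)"
          by (rule posdef_coercive_mult_right) (use elim in auto)
        also have "\<dots> \<le> norm I * norm (mat 1 :: real^'n^'n)"
          using T(2) norm_cauchy_schwarz[of I "mat 1"] by (simp add: I_def)
        finally have "m/2 * norm I \<le> norm (mat 1 :: real^'n^'n)"
          using False by (simp add: power2_norm_eq_inner[symmetric] power2_eq_square)
        then show ?thesis using m by (simp add: c_def field_simps)
      qed (use m in \<open>simp add: c_def\<close>)
      have IJ: "I - J = - (I ** D ** J)"
        using T(2) J(1) by (simp add: D_def I_def matmul.diff_left matmul.diff_right matrix_mul_assoc[symmetric])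
      have JI: "I - J = - (J ** D ** I)"
        using T(1) J(2) by (simp add: D_def I_def matmul.diff_left matmul.diff_right) (simp add: matrix_mul_assoc[symmetric])
      have "I - J + J ** D ** J = (J - I) ** D ** J"
        unfolding IJ by (simp add: matmul.diff_left)
      also have "J - I = J ** D ** I" using JI by (simp add: algebra_simps)
      finally have e: "I - J - - (J ** D ** J) = J ** D ** I ** D ** J" by simp
      have "norm (J ** D ** I ** D ** J) \<le> (((norm J * norm D * K) * norm I * K) * norm D * K) * norm J * K"
        by (intro order_trans[OF K(2)] mult_right_mono norm_ge_zero less_imp_le[OF K(1)]) (rule order_refl)
      also have "\<dots> = (norm J * norm J * norm I * K^4) * (norm D)\<^sup>2"
        by (simp add: power2_eq_square power4_eq_xxxx)
      also have "\<dots> \<le> (norm J * norm J * c * K^4) * (norm D)\<^sup>2"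
        using nI K by (intro mult_right_mono mult_left_mono) auto
      finally show ?case
        unfolding I_def[symmetric] D_def[symmetric] J_def[symmetric] e .
    qed
  qed
qed

text \<open>In the Leibniz expansion a permutation other than \<open>id\<close> moves at least two
  points, so after one factor is differentiated an off-diagonal zero of the identity matrix remains;
  \<open>id\<close> alone yields the trace.\<close>

lemma det_has_derivative_one:
  "(det has_derivative trace) (at (mat 1 :: real^'n::finite^'n) within S)"
proof -
  let ?P = "{p::'n \<Rightarrow> 'n. p permutes UNIV}"
  have comp: "((\<lambda>A::real^'n^'n. A $ i $ j) has_derivative (\<lambda>H. H $ i $ j)) (at (mat 1) within S)" for i j
    by (intro bounded_linear_imp_has_derivative bounded_linear_compose[OF bounded_linear_vec_nth bounded_linear_vec_nth])
  have "((\<lambda>A::real^'n^'n. \<Sum>p\<in>?P. of_int (sign p) * (\<Prod>i\<in>UNIV. A $ i $ p i)) has_derivative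
     (\<lambda>H. \<Sum>p\<in>?P. of_int (sign p) * (\<Sum>i\<in>UNIV. H $ i $ p i * (\<Prod>j\<in>UNIV-{i}. mat 1 $ j $ p j)))) (at (mat 1) within S)"
    by (intro has_derivative_sum has_derivative_mult_right has_derivative_prod comp)
  moreover have "(\<Sum>p\<in>?P. of_int (sign p) * (\<Sum>i\<in>UNIV. H $ i $ p i * (\<Prod>j\<in>UNIV-{i}. mat 1 $ j $ p j))) = trace H"
    for H :: "real^'n^'n"
  proof -
    have z: "(\<Prod>j\<in>UNIV-{i}. mat 1 $ j $ p j :: real) = 0" if p: "p \<in> ?P" "p \<noteq> id" for p i
    proof -
      obtain k where k: "p k \<noteq> k" using p(2) by (auto simp: fun_eq_iff)
      have "p (p k) \<noteq> p k" using k p(1) by (metis mem_Collect_eq permutes_inj injD)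
      then obtain j where "j \<noteq> i" "p j \<noteq> j" using k by metis
      then show ?thesis by (intro prod_zero bexI[of _ j]) (auto simp: mat_def)
    qed
    have "(\<Sum>p\<in>?P. of_int (sign p) * (\<Sum>i\<in>UNIV. H $ i $ p i * (\<Prod>j\<in>UNIV-{i}. mat 1 $ j $ p j)))
        = (\<Sum>p\<in>{id}. of_int (sign p) * (\<Sum>i\<in>UNIV. H $ i $ p i * (\<Prod>j\<in>UNIV-{i}. mat 1 $ j $ p j)))"
      by (rule sum.mono_neutral_right) (simp_all add: finite_permutations permutes_id z)
    also have "\<dots> = trace H" by (simp add: trace_def mat_def)
    finally show ?thesis .
  qed
  ultimately show ?thesis by (simp add: det_def[abs_def])
qed

lemma det_has_derivative:
  fixes M :: "real^'n::finite^'n"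
  assumes "M ** N = mat 1"
  shows "(det has_derivative (\<lambda>H. det M * trace (N ** H))) (at M within S)"
proof -
  have NM: "N ** M = mat 1" using assms matrix_left_right_inverse by blast
  have "((\<lambda>X. N ** X) has_derivative (\<lambda>H. N ** H)) (at M within S)"
    by (intro bounded_linear_imp_has_derivative matmul.bounded_linear_right)
  moreover have "(det has_derivative trace) (at (N ** M))"
    unfolding NM by (rule det_has_derivative_one)
  ultimately have "((\<lambda>X. det (N ** X)) has_derivative (\<lambda>H. trace (N ** H))) (at M within S)"
    by (rule has_derivative_compose)
  then have "((\<lambda>X. det M * det (N ** X)) has_derivative (\<lambda>H. det M * trace (N ** H))) (at M within S)"
    by (rule has_derivative_mult_right)
  moreover have "det M * det (N ** X) = det X" for X
    using assms by (metis det_I det_mul mult.assoc mult_1)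
  ultimately show ?thesis by simp
qed

section \<open>Vectorised matrices and the derivative of the root\<close>

lemma vecm_nth [simp]: "vecm M $ (i, j) = M $ i $ j"
  by (simp add: vecm_def)

definition unvecm :: "real^('n::finite \<times> 'n) \<Rightarrow> real^'n^'n" where
  "unvecm v = (\<chi> i j. v $ (i, j))"

lemma vecm_unvecm [simp]: "vecm (unvecm v) = v" "unvecm (vecm M) = M"
  by (auto simp: vec_eq_iff unvecm_def)

lemma linear_vecm: "linear vecm" and linear_unvecm: "linear unvecm"
  by (auto intro!: linearI simp: vec_eq_iff unvecm_def vecm_def)

lemma inner_vecm: "vecm M \<bullet> vecm N = M \<bullet> N"
  by (simp add: inner_vec_def sum.cartesian_product UNIV_Times_UNIV[symmetric] case_prod_unfold vecm_def del: UNIV_Times_UNIV)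

lemma kron_vecm: "kron B C *v vecm X = vecm (C ** X ** transpose B)"
proof -
  have "(kron B C *v vecm X) $ (i, j) = vecm (C ** X ** transpose B) $ (i, j)" for i j
  proof -
    have "(kron B C *v vecm X) $ (i, j) = (\<Sum>k\<in>UNIV. \<Sum>l\<in>UNIV. B $ j $ l * C $ i $ k * X $ k $ l)"
      by (simp add: kron_def matrix_vector_mult_def sum.cartesian_product UNIV_Times_UNIV[symmetric] case_prod_unfold vecm_def del: UNIV_Times_UNIV)
    also have "\<dots> = (\<Sum>l\<in>UNIV. \<Sum>k\<in>UNIV. B $ j $ l * C $ i $ k * X $ k $ l)" by (rule sum.swap)
    finally show ?thesis
      by (simp add: matrix_matrix_mult_def transpose_def sum_distrib_right sum_distrib_left mult_ac)
  qed
  then show ?thesis by (simp add: vec_eq_iff)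
qed

lemma kplus_vecm: "symm_mat S \<Longrightarrow> kplus S (mat 1) *v vecm X = vecm (S ** X + X ** S)"
  by (simp add: kplus_def matvec.add_left kron_vecm symm_mat_def linear_add[OF linear_vecm])

text \<open>\<open>kplus S (mat 1)\<close> represents X -> S X + X S under \<open>vecm\<close>;
  coercivity makes this map injective, and a square matrix with trivial kernel is
  invertible.\<close>

lemma kplus_inverse:
  assumes "symm_mat S" "posdef S"
  shows "kplus S (mat 1) ** matrix_inv (kplus S (mat 1)) = mat 1"
        "matrix_inv (kplus S (mat 1)) ** kplus S (mat 1) = mat 1"
proof -
  have "\<exists>B. B ** kplus S (mat 1) = mat 1"
    unfolding matrix_left_invertible_ker
  proof (intro allI impI)
    fix v assume "kplus S (mat 1) *v v = 0"
    then have "vecm (S ** unvecm v + unvecm v ** S) = vecm 0"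
      using kplus_vecm[OF assms(1), of "unvecm v"] by (simp add: linear_0[OF linear_vecm])
    then have "S ** unvecm v + unvecm v ** S = 0" by (metis vecm_unvecm(2))
    then have "unvecm v = 0" by (rule sylvester_inj[OF assms(2,2)])
    then show "v = 0" by (metis vecm_unvecm(1) linear_0[OF linear_vecm])
  qed
  then obtain B where "kplus S (mat 1) ** B = mat 1" using matrix_left_right_inverse by blast
  then show "kplus S (mat 1) ** matrix_inv (kplus S (mat 1)) = mat 1"
        "matrix_inv (kplus S (mat 1)) ** kplus S (mat 1) = mat 1"
    using matrix_inv_eq matrix_left_right_inverse by metis+
qed

text \<open>Solves the Sylvester equation through the inverse Kronecker sum, which makes it visibly
  linear in \<open>H\<close> and matches the factor inside \<open>OmegaA\<close>.\<close>

definition sqrt_deriv :: "real^'n::finite^'n \<Rightarrow> real^'n^'n \<Rightarrow> real^'n^'n" where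
  "sqrt_deriv A H = unvecm (matrix_inv (kplus (msqrt A) (mat 1)) *v vecm H)"

lemma sqrt_deriv_sylvester:
  assumes "symm_mat A" "posdef A"
  shows "msqrt A ** sqrt_deriv A H + sqrt_deriv A H ** msqrt A = H"
proof -
  note S = msqrt_props[OF assms]
  have "vecm (msqrt A ** sqrt_deriv A H + sqrt_deriv A H ** msqrt A) = vecm H"
    using kplus_inverse(1)[OF S(1,2)]
    by (simp add: kplus_vecm[OF S(1), symmetric] sqrt_deriv_def matrix_vector_mul_assoc)
  then show ?thesis by (metis vecm_unvecm(2))
qed

text \<open>The increment D = T - S satisfies T D + D S = B - A, and subtracting the linearised
  equation leaves S E + E S = -D^2 for the error E. Both are controlled by the constant m of the
  fixed root S.\<close>

lemma msqrt_has_derivative: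
  fixes A :: "real^'n::finite^'n"
  assumes "symm_mat A" "posdef A"
  shows "(msqrt has_derivative sqrt_deriv A) (at A within {B. symm_mat B})"
proof -
  define S where "S = msqrt A"
  note S = msqrt_props[OF assms, folded S_def]
  obtain m where m: "m > 0" "\<And>x. m * (x \<bullet> x) \<le> x \<bullet> (S *v x)"
    using posdef_coercive[OF S(2)] by blast
  obtain K where K: "K > 0" "\<And>(N::real^'n^'n) (N'::real^'n^'n). norm (N ** N') \<le> norm N * norm N' * K"
    using matmul.pos_bounded by blast
  have "linear (sqrt_deriv A)"
    unfolding sqrt_deriv_def[abs_def]
    using linear_compose[OF linear_compose[OF linear_vecm matrix_vector_mul_linear] linear_unvecm]
    by (simp add: o_def)
  then have bl: "bounded_linear (sqrt_deriv A)" by (simp add: linear_conv_bounded_linear)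
  show ?thesis
  proof (rule has_derivative_quadratic_bound[OF bl])
    have "eventually (\<lambda>B. symm_mat B) (at A within {B. symm_mat B})"
      by (auto simp: eventually_at intro: exI[of _ 1])
    \<comment> \<open>One factor 1/m comes from solving for E, two from squaring |D| \<le> |B -
      A|/m; K is the norm constant of the matrix product.\<close>
    then show "eventually (\<lambda>B. norm (msqrt B - msqrt A - sqrt_deriv A (B - A)) \<le> (K / m ^ 3) * (norm (B - A))\<^sup>2) (at A within {B. symm_mat B})"
      using eventually_posdef[OF assms(2)]
    proof eventually_elim
      case (elim B)
      define T where "T = msqrt B"
      note T = msqrt_props[OF elim, folded T_def]
      define D where "D = T - S"
      define E where "E = D - sqrt_deriv A (B - A)"
      have "T ** D + D ** S = B - A"
        using sqrt_difference_sylvester[of T S] by (simp add: D_def T S)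
      then have nD: "m * norm D \<le> norm (B - A)"
        using sylvester_norm_bound[OF T(2) m(2), of D] by simp
      have "S ** D + D ** S = B - A - D ** D"
        by (simp add: D_def matmul.diff_left matmul.diff_right T S)
      moreover have "S ** E + E ** S = (S ** D + D ** S)
          - (S ** sqrt_deriv A (B - A) + sqrt_deriv A (B - A) ** S)"
        by (simp add: E_def matmul.diff_left matmul.diff_right)
      ultimately have "S ** E + E ** S = - (D ** D)"
        using sqrt_deriv_sylvester[OF assms, of "B - A"] by (simp add: S_def)
      then have "m * norm E \<le> norm (D ** D)"
        using sylvester_norm_bound[OF S(2) m(2), of E] by simp
      also have "\<dots> \<le> K * (norm D)\<^sup>2" using K(2)[of D D] by (simp add: power2_eq_square mult_ac)
      also have "\<dots> \<le> K * (norm (B - A) / m)\<^sup>2"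
        using nD m K by (intro mult_left_mono power_mono) (auto simp: field_simps)
      finally show ?case
        using m by (simp add: E_def D_def T_def S_def field_simps power2_eq_square power3_eq_cube)
    qed
  qed
qed

section \<open>The score\<close>

lemma transpose_kron: "transpose (kron B C) = kron (transpose B) (transpose C)"
  by (simp add: vec_eq_iff transpose_def kron_def)

lemma transpose_matrix_add: "transpose (M + N) = transpose M + transpose N"
  by (simp add: vec_eq_iff transpose_def)

lemma kron_mult: "kron B C ** kron B' C' = kron (B ** B') (C ** C')"
proof -
  have "(kron B C ** kron B' C') *v v = kron (B ** B') (C ** C') *v v" for v
  proof -
    have "(kron B C ** kron B' C') *v vecm (unvecm v) = kron (B ** B') (C ** C') *v vecm (unvecm v)"
      unfolding matrix_vector_mul_assoc[symmetric] kron_vecm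
      by (simp only: matrix_transpose_mul matrix_mul_assoc)
    then show ?thesis by simp
  qed
  then show ?thesis unfolding matrix_eq by blast
qed

lemma symm_mat_inverse:
  fixes M N :: "real^'n::finite^'n"
  assumes "symm_mat M" "M ** N = mat 1"
  shows "symm_mat N"
proof -
  have "transpose N ** M = mat 1"
    using arg_cong[OF assms(2), of transpose] assms(1)
    by (simp add: matrix_transpose_mul symm_mat_def transpose_mat)
  then have "transpose N = transpose N ** (M ** N)" by (simp add: assms(2))
  also have "\<dots> = N" using \<open>transpose N ** M = mat 1\<close> by (simp add: matrix_mul_assoc)
  finally show ?thesis by (simp add: symm_mat_def)
qed

text \<open>The Kronecker product of I with S^(-1) and the Kronecker sum are symmetric and commute,
  so the first times the inverse of the second is symmetric. Hence \<open>OmegaA\<close> can move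
  across inner products and stands on both sides of the information matrix.\<close>

lemma transpose_OmegaA:
  assumes "symm_mat A" "posdef A"
  shows "transpose (OmegaA A) = OmegaA A"
proof -
  note S = msqrt_props[OF assms]
  define J where "J = matrix_inv (msqrt A)"
  define P where "P = kron (mat 1) J"
  define Q where "Q = kplus (msqrt A) (mat 1)"
  define R where "R = matrix_inv Q"
  note J = posdef_invertible[OF S(2), folded J_def]
  note R = kplus_inverse[OF S(1,2), folded Q_def, folded R_def]
  have "symm_mat J" using symm_mat_inverse[OF S(1) J(1)] .
  then have tP: "transpose P = P" by (simp add: P_def transpose_kron symm_mat_def transpose_mat)
  have "symm_mat Q"
    using S(1) by (simp add: symm_mat_def Q_def kplus_def transpose_matrix_add transpose_kron transpose_mat)
  then have tR: "transpose R = R" using symm_mat_inverse[OF _ R(1)] by (simp add: symm_mat_def)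
  have PQ: "P ** Q = Q ** P"
    by (simp add: P_def Q_def kplus_def matmul.add_left matmul.add_right kron_mult J)
  have "transpose (OmegaA A) = R ** P"
    by (simp add: OmegaA_def matrix_transpose_mul tR tP flip: J_def P_def Q_def R_def)
  also have "\<dots> = R ** (P ** Q) ** R"
    using R(1) by (simp add: matrix_mul_assoc[symmetric])
  also have "\<dots> = P ** R"
    unfolding PQ using R(2) by (simp add: matrix_mul_assoc)
  finally show ?thesis by (simp add: OmegaA_def P_def Q_def R_def J_def)
qed

lemma OmegaA_vecm: "OmegaA A *v vecm H = vecm (matrix_inv (msqrt A) ** sqrt_deriv A H)"
proof -
  have "OmegaA A *v vecm H = kron (mat 1) (matrix_inv (msqrt A)) *v vecm (sqrt_deriv A H)"
    by (simp add: OmegaA_def sqrt_deriv_def matrix_vector_mul_assoc)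
  then show ?thesis by (simp add: kron_vecm transpose_mat)
qed

lemma inner_vecm_outerp: "vecm (outerp (ev k) x) \<bullet> vecm N = (N *v x) $ k"
proof -
  have "vecm (outerp (ev k) x) \<bullet> vecm N = (\<Sum>i\<in>UNIV. if i = k then \<Sum>j\<in>UNIV. x $ j * N $ i $ j else 0)"
    unfolding inner_vecm unfolding inner_vec_def by (rule sum.cong) (auto simp: outerp_def ev_def axis_def)
  then show ?thesis by (simp add: matrix_vector_mult_def mult.commute)
qed

lemma inner_vecm_one: "vecm (mat 1) \<bullet> vecm N = trace N"
proof -
  have "vecm (mat 1) \<bullet> vecm N = (\<Sum>i\<in>UNIV. \<Sum>j\<in>UNIV. if j = i then N $ i $ j else 0)"
    unfolding inner_vecm unfolding inner_vec_def by (intro sum.cong refl) (auto simp: mat_def)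
  then show ?thesis by (simp add: trace_def)
qed

lemma inner_transpose_Ed: "(transpose Ed *v s) \<bullet> vecm H = (\<Sum>k\<in>UNIV. s $ k * H $ k $ k)"
proof -
  have "(Ed *v vecm H) $ k = H $ k $ k" for k
  proof -
    have "(Ed *v vecm H) $ k = (\<Sum>p\<in>UNIV. if p = (k, k) then H $ k $ k else 0)"
      unfolding Ed_def matrix_vector_mult_def vec_lambda_beta by (rule sum.cong) (auto simp: vecm_def prod_eq_iff)
    then show ?thesis by simp
  qed
  then show ?thesis unfolding inner_matrix_transpose by (simp add: inner_vec_def)
qed

section \<open>Derivatives of the log-determinant, the standardised residuals and the
  log-likelihood\<close>

lemma has_derivative_entry: "((\<lambda>B::real^'k::finite^'k. B $ i $ j) has_derivative (\<lambda>H. H $ i $ j)) F"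
  by (intro bounded_linear_imp_has_derivative bounded_linear_compose[OF bounded_linear_vec_nth bounded_linear_vec_nth])

lemma has_derivative_ln_t_std_dens:
  assumes "\<nu> > 2"
  shows "((\<lambda>u. ln (t_std_dens \<nu> u)) has_field_derivative - t_score \<nu> u) (at u)"
proof -
  define K where "K = Gamma ((\<nu> + 1) / 2) / Gamma (\<nu> / 2) * ((\<nu> - 2) * pi) powr (-1/2)"
  have K: "K > 0" unfolding K_def using assms by (intro mult_pos_pos divide_pos_pos Gamma_real_pos) auto
  have pos: "1 + u\<^sup>2 / (\<nu> - 2) > 0" for u using assms by (simp add: add_pos_nonneg)
  have "ln (t_std_dens \<nu> u) = ln K + - (\<nu> + 1) / 2 * ln (1 + u\<^sup>2 / (\<nu> - 2))" for u
    unfolding t_std_dens_def K_def[symmetric] using K pos[of u]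
    by (simp add: ln_mult ln_powr less_imp_neq[symmetric])
  moreover have "((\<lambda>u. ln K + - (\<nu> + 1) / 2 * ln (1 + u\<^sup>2 / (\<nu> - 2))) has_field_derivative
      - (\<nu> + 1) / 2 * ((2 * u / (\<nu> - 2)) / (1 + u\<^sup>2 / (\<nu> - 2)))) (at u)"
    using assms pos[of u] by (auto intro!: derivative_eq_intros simp: mult.commute)
  moreover have "- (\<nu> + 1) / 2 * ((2 * u / (\<nu> - 2)) / (1 + u\<^sup>2 / (\<nu> - 2))) = - t_score \<nu> u"
  proof -
    have e: "(2 * u / (\<nu> - 2)) / (1 + u\<^sup>2 / (\<nu> - 2)) = 2 * u / (\<nu> - 2 + u\<^sup>2)"
    proof -
      have "1 + u\<^sup>2 / (\<nu> - 2) = (\<nu> - 2 + u\<^sup>2) / (\<nu> - 2)" using assms by (simp add: field_simps)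
      then show ?thesis using assms by simp
    qed
    show ?thesis
      unfolding e t_score_def by (simp only: minus_mult_left[symmetric] minus_divide_left[symmetric]) simp
  qed
  ultimately show ?thesis by simp
qed

lemma block_lift_add: "block_lift g (M + M') (\<lambda>k. l k + l' k) = block_lift g M l + block_lift g M' l'"
  by (auto simp: vec_eq_iff block_lift_def add_divide_distrib distrib_right)

lemma block_lift_scale: "block_lift g (c *\<^sub>R M) (\<lambda>k. c * l k) = c *\<^sub>R block_lift g M l"
  by (auto simp: vec_eq_iff block_lift_def distrib_left mult.assoc)

lemma block_lift_diff: "block_lift g (M - M') (\<lambda>k. l k - l' k) = block_lift g M l - block_lift g M' l'"
  by (auto simp: vec_eq_iff block_lift_def diff_divide_distrib left_diff_distrib)

context
  fixes g :: "'i::finite \<Rightarrow> 'k::finite" and A :: "real^'k^'k"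
  assumes blocks: "\<forall>k. card {a. g a = k} \<ge> 2"
    and symA: "symm_mat A" and pdA: "posdef A" and lam_pos: "\<And>k. lam g A k > 0"
begin

private lemmas S = msqrt_props[OF symA pdA]
private lemmas J = posdef_invertible[OF S(2)]

lemma Uv_eq:
  "Uv g A z $ a = (matrix_inv (msqrt A) *v Y0 g z) $ g a / sqrt (nb g (g a)) + 1 / sqrt (lam g A (g a)) * FU g z a"
  unfolding Uv_def matrix_inv_msqrt_blockC[OF blocks symA pdA lam_pos] block_lift_mult_vec[OF blocks] ..

lemma FU_Uv: "FU g (Uv g A z) a = FU g z a / sqrt (lam g A (g a))"
  unfolding Uv_def matrix_inv_msqrt_blockC[OF blocks symA pdA lam_pos] FU_block_lift[OF blocks] by simp

lemma blockC_inverse: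
  "blockC g A ** block_lift g (matrix_inv (msqrt A) ** matrix_inv (msqrt A)) (\<lambda>k. 1 / lam g A k) = mat 1"
  unfolding blockC_eq_block_lift[OF blocks]
proof (rule block_lift_inverse[OF blocks])
  show "A ** (matrix_inv (msqrt A) ** matrix_inv (msqrt A)) = mat 1"
    by (metis J(1) S(3) matrix_mul_assoc matrix_mul_rid)
qed (use lam_pos in \<open>simp add: less_imp_neq[symmetric]\<close>)

lemma msqrt_blockC_props:
  "symm_mat (msqrt (blockC g A))" "posdef (msqrt (blockC g A))" "msqrt (blockC g A) ** msqrt (blockC g A) = blockC g A"
  unfolding blockC_eq_block_lift[OF blocks]
  by (intro msqrt_props symm_block_lift[OF blocks] posdef_block_lift[OF blocks] symA pdA lam_pos)+

lemma det_msqrt_blockC: "det (msqrt (blockC g A)) \<noteq> 0" "det (blockC g A) = (det (msqrt (blockC g A)))\<^sup>2"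
proof -
  have "det (msqrt (blockC g A)) * det (matrix_inv (msqrt (blockC g A))) = 1"
    using posdef_invertible(1)[OF msqrt_blockC_props(2)] by (metis det_I det_mul)
  then show "det (msqrt (blockC g A)) \<noteq> 0" by auto
  show "det (blockC g A) = (det (msqrt (blockC g A)))\<^sup>2"
    by (metis det_mul msqrt_blockC_props(3) power2_eq_square)
qed

lemma lam_has_derivative:
  "((\<lambda>B. lam g B k) has_derivative (\<lambda>H. - H $ k $ k / (nb g k - 1))) F"
proof -
  have "((\<lambda>B. inverse (nb g k - 1) * (nb g k - B $ k $ k)) has_derivative (\<lambda>H. inverse (nb g k - 1) * (0 - H $ k $ k))) F"
    by (intro has_derivative_mult_right has_derivative_diff has_derivative_const has_derivative_entry)
  then show ?thesis by (simp add: lam_def divide_inverse mult.commute)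
qed

text \<open>\<open>lam\<close> is affine in the matrix and \<open>block_lift\<close> is jointly
  linear in its two arguments, so the increment is exactly linear.\<close>

lemma blockC_has_derivative:
  "(blockC g has_derivative (\<lambda>H. block_lift g H (\<lambda>k. - H $ k $ k / (nb g k - 1)))) (at A within T)"
proof (rule has_derivative_quadratic_bound[where C=0])
  have "linear (\<lambda>H. block_lift g H (\<lambda>k. - H $ k $ k / (nb g k - 1)))"
  proof (rule linearI)
    fix M N :: "real^'k^'k" and c :: real
    have "(\<lambda>k. - (M + N) $ k $ k / (nb g k - 1)) = (\<lambda>k. - M $ k $ k / (nb g k - 1) + - N $ k $ k / (nb g k - 1))"
      by (simp add: fun_eq_iff diff_divide_distrib)
    then show "block_lift g (M + N) (\<lambda>k. - (M + N) $ k $ k / (nb g k - 1))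
        = block_lift g M (\<lambda>k. - M $ k $ k / (nb g k - 1)) + block_lift g N (\<lambda>k. - N $ k $ k / (nb g k - 1))"
      by (simp only: block_lift_add)
    have "(\<lambda>k. - (c *\<^sub>R M) $ k $ k / (nb g k - 1)) = (\<lambda>k. c * (- M $ k $ k / (nb g k - 1)))"
      by (simp add: fun_eq_iff)
    then show "block_lift g (c *\<^sub>R M) (\<lambda>k. - (c *\<^sub>R M) $ k $ k / (nb g k - 1))
        = c *\<^sub>R block_lift g M (\<lambda>k. - M $ k $ k / (nb g k - 1))"
      by (simp only: block_lift_scale)
  qed
  then show "bounded_linear (\<lambda>H. block_lift g H (\<lambda>k. - H $ k $ k / (nb g k - 1)))"
    by (simp add: linear_conv_bounded_linear)
  have "lam g B k - lam g A k = - (B - A) $ k $ k / (nb g k - 1)" for B k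
    by (simp add: lam_def diff_divide_distrib)
  then have "blockC g B - blockC g A - block_lift g (B - A) (\<lambda>k. - (B - A) $ k $ k / (nb g k - 1)) = 0" for B
    unfolding blockC_eq_block_lift[OF blocks] block_lift_diff[symmetric] by (simp add: block_lift_def vec_eq_iff)
  then show "eventually (\<lambda>B. norm (blockC g B - blockC g A - block_lift g (B - A) (\<lambda>k. - (B - A) $ k $ k / (nb g k - 1)))
      \<le> 0 * (norm (B - A))\<^sup>2) (at A within T)" by simp
qed

text \<open>Inserting H = S D + D S, both terms equal the trace of S^(-1) D by cyclicity. In this
  form the log-determinant contributes the vec(I) term under \<open>OmegaA\<close>.\<close>

lemma trace_sqrt_deriv:
  "trace (matrix_inv (msqrt A) ** matrix_inv (msqrt A) ** H) = 2 * trace (matrix_inv (msqrt A) ** sqrt_deriv A H)"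
proof -
  let ?S = "msqrt A" and ?J = "matrix_inv (msqrt A)" and ?D = "sqrt_deriv A H"
  have "?J ** ?J ** H = ?J ** ?J ** (?S ** ?D + ?D ** ?S)"
    using sqrt_deriv_sylvester[OF symA pdA, of H] by simp
  also have "\<dots> = ?J ** ?D + ?J ** (?J ** ?D ** ?S)"
    by (simp add: matmul.add_right matrix_mul_assoc) (metis J(2) matrix_mul_assoc matrix_mul_lid)
  also have "trace \<dots> = trace (?J ** ?D) + trace (?J ** ?D ** ?S ** ?J)"
    by (simp add: trace_add trace_mul_sym[of ?J "?J ** ?D ** ?S"])
  also have "?J ** ?D ** ?S ** ?J = ?J ** ?D"
    using J(1) by (metis matrix_mul_assoc matrix_mul_rid)
  finally show ?thesis by simp
qed

lemma ln_det_blockC_has_derivative: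
  "((\<lambda>B. ln (det (blockC g B))) has_derivative
     (\<lambda>H. 2 * trace (matrix_inv (msqrt A) ** sqrt_deriv A H) - (\<Sum>k\<in>UNIV. H $ k $ k / lam g A k))) (at A within T)"
proof -
  let ?C = "blockC g A"
  have pos: "det ?C > 0" using det_msqrt_blockC by simp
  have "((\<lambda>B. det (blockC g B)) has_derivative (\<lambda>H. det ?C *
      trace (block_lift g (matrix_inv (msqrt A) ** matrix_inv (msqrt A)) (\<lambda>k. 1 / lam g A k)
        ** block_lift g H (\<lambda>k. - H $ k $ k / (nb g k - 1))))) (at A within T)"
    by (rule has_derivative_compose[OF blockC_has_derivative det_has_derivative[OF blockC_inverse]])
  note d = DERIV_compose_FDERIV[OF DERIV_ln[OF pos] this]
  have "det ?C * x * inverse (det ?C) = x" for x using pos by simp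
  then have "((\<lambda>B. ln (det (blockC g B))) has_derivative (\<lambda>H.
      trace (block_lift g (matrix_inv (msqrt A) ** matrix_inv (msqrt A)) (\<lambda>k. 1 / lam g A k)
        ** block_lift g H (\<lambda>k. - H $ k $ k / (nb g k - 1))))) (at A within T)"
    using d by (simp only:)
  moreover have "trace (block_lift g (matrix_inv (msqrt A) ** matrix_inv (msqrt A)) (\<lambda>k. 1 / lam g A k)
        ** block_lift g H (\<lambda>k. - H $ k $ k / (nb g k - 1)))
      = 2 * trace (matrix_inv (msqrt A) ** sqrt_deriv A H) - (\<Sum>k\<in>UNIV. H $ k $ k / lam g A k)" for H
  proof -
    \<comment> \<open>The derivative -H_kk/(n_k - 1) of lambda_k meets the multiplicity n_k - 1 from
      the trace, so each block leaves only -H_kk/lambda_k.\<close>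
    have "nb g k - 1 \<noteq> 0" for k using nb_gt_1[OF blocks, of k] by simp
    then show ?thesis
      by (simp add: block_lift_mult[OF blocks] trace_block_lift[OF blocks] trace_sqrt_deriv sum_negf)
  qed
  ultimately show ?thesis by simp
qed

text \<open>The function differentiated is the explicit expression of \<open>Uv_eq\<close>. One
  factor S^(-1) of the derivative is absorbed into \<open>X0\<close>, and a factor lambda^(-1/2) of
  lambda^(-3/2) into the deviation of the residuals.\<close>

lemma Uv_has_derivative:
  "((\<lambda>B. (matrix_inv (msqrt B) *v Y0 g z) $ g a / sqrt (nb g (g a)) + 1 / sqrt (lam g B (g a)) * FU g z a) has_derivative
     (\<lambda>H. - ((matrix_inv (msqrt A) ** sqrt_deriv A H) *v X0 g A z) $ g a / sqrt (nb g (g a))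
        + H $ g a $ g a * FU g (Uv g A z) a / ((nb g (g a) - 1) * lam g A (g a)) / 2)) (at A within {B. symm_mat B})"
proof -
  let ?J = "matrix_inv (msqrt A)" and ?k = "g a" and ?F = "at A within {B. symm_mat B}"
  have "((\<lambda>B. matrix_inv (msqrt B)) has_derivative (\<lambda>H. - (?J ** sqrt_deriv A H ** ?J))) ?F"
    by (rule has_derivative_compose[OF msqrt_has_derivative[OF symA pdA] matrix_inv_has_derivative[OF S(2)]])
  moreover have "bounded_linear (\<lambda>M. (M *v Y0 g z) $ ?k / sqrt (nb g ?k))"
    by (intro bounded_linear_divide[THEN bounded_linear_compose] bounded_linear_compose[OF bounded_linear_vec_nth] matvec.bounded_linear_left)
  ultimately have 1: "((\<lambda>B. (matrix_inv (msqrt B) *v Y0 g z) $ ?k / sqrt (nb g ?k)) has_derivative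
      (\<lambda>H. (- (?J ** sqrt_deriv A H ** ?J) *v Y0 g z) $ ?k / sqrt (nb g ?k))) ?F"
    using bounded_linear.has_derivative by blast
  have dd: "((\<lambda>t. 1 / sqrt t) has_field_derivative - (1 / (2 * lam g A ?k * sqrt (lam g A ?k)))) (at (lam g A ?k))"
    using lam_pos[of ?k] by (auto intro!: derivative_eq_intros simp: field_simps)
  have 2: "((\<lambda>B. 1 / sqrt (lam g B ?k) * FU g z a) has_derivative
      (\<lambda>H. - H $ ?k $ ?k / (nb g ?k - 1) * - (1 / (2 * lam g A ?k * sqrt (lam g A ?k))) * FU g z a)) ?F"
    by (rule has_derivative_mult_left[OF DERIV_compose_FDERIV[OF dd lam_has_derivative]])
  have 3: "(- (?J ** sqrt_deriv A H ** ?J) *v Y0 g z) $ ?k = - ((?J ** sqrt_deriv A H) *v X0 g A z) $ ?k" for H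
    by (simp add: X0_def matvec.minus_left matrix_vector_mul_assoc matrix_mul_assoc)
  have 4: "- H $ ?k $ ?k / (nb g ?k - 1) * - (1 / (2 * lam g A ?k * sqrt (lam g A ?k))) * FU g z a
      = H $ ?k $ ?k * FU g (Uv g A z) a / ((nb g ?k - 1) * lam g A ?k) / 2" for H
    using FU_Uv[of z a] by simp
  show ?thesis using has_derivative_add[OF 1 2] unfolding 3 4 .
qed

lemma loglik_has_derivative:
  assumes nu: "\<forall>a. \<nu> a > 2"
  shows "((\<lambda>B. loglik g \<nu> B z) has_derivative (\<lambda>H. gradA g \<nu> A z \<bullet> vecm H)) (at A within {B. symm_mat B})"
proof -
  let ?F = "at A within {B. symm_mat B}" and ?J = "matrix_inv (msqrt A)"
  define u where "u = Uv g A z"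
  define t where "t a = t_score (\<nu> a) (u $ a)" for a
  define U where "U B a = (matrix_inv (msqrt B) *v Y0 g z) $ g a / sqrt (nb g (g a)) + 1 / sqrt (lam g B (g a)) * FU g z a" for B a
  define d1 where "d1 H a = ((?J ** sqrt_deriv A H) *v X0 g A z) $ g a / sqrt (nb g (g a))" for H a
  define d2 where "d2 H a = H $ g a $ g a * FU g u a / ((nb g (g a) - 1) * lam g A (g a)) / 2" for H :: "real^'k^'k" and a
  have UA: "U A a = u $ a" for a by (simp add: U_def u_def Uv_eq)
  have dU: "((\<lambda>B. U B a) has_derivative (\<lambda>H. - d1 H a + d2 H a)) ?F" for a
    using Uv_has_derivative[of z a] unfolding U_def d1_def d2_def u_def by simp
  have "((\<lambda>B. ln (t_std_dens (\<nu> a) (U B a))) has_derivative (\<lambda>H. (- d1 H a + d2 H a) * - t a)) ?F" for a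
    by (rule DERIV_compose_FDERIV[OF _ dU]) (use has_derivative_ln_t_std_dens nu in \<open>auto simp: t_def UA\<close>)
  then have "((\<lambda>B. - (1/2) * ln (det (blockC g B)) + (\<Sum>a\<in>UNIV. ln (t_std_dens (\<nu> a) (U B a)))) has_derivative
      (\<lambda>H. - (1/2) * (2 * trace (?J ** sqrt_deriv A H) - (\<Sum>k\<in>UNIV. H $ k $ k / lam g A k))
         + (\<Sum>a\<in>UNIV. (- d1 H a + d2 H a) * - t a))) ?F"
    by (intro has_derivative_add has_derivative_mult_right ln_det_blockC_has_derivative has_derivative_sum)
  moreover have "- (1/2) * (2 * trace (?J ** sqrt_deriv A H) - (\<Sum>k\<in>UNIV. H $ k $ k / lam g A k))
         + (\<Sum>a\<in>UNIV. (- d1 H a + d2 H a) * - t a) = gradA g \<nu> A z \<bullet> vecm H" for H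
  proof -
    have W: "Wt \<nu> u a * u $ a = t a" for a by (simp add: Wt_def t_def t_score_def)
    define X where "X = (\<Sum>a\<in>UNIV. (Wt \<nu> u a * u $ a / sqrt (nb g (g a))) *\<^sub>R vecm (outerp (ev (g a)) (X0 g A z))) - vecm (mat 1)"
    \<comment> \<open>By symmetry \<open>OmegaA\<close> passes to the direction H, where it produces
      S^(-1) D.\<close>
    have "(OmegaA A *v X) \<bullet> vecm H = X \<bullet> vecm (?J ** sqrt_deriv A H)"
      using inner_matrix_transpose[of "OmegaA A" X "vecm H"] unfolding transpose_OmegaA[OF symA pdA] OmegaA_vecm .
    also have "\<dots> = (\<Sum>a\<in>UNIV. t a * d1 H a) - trace (?J ** sqrt_deriv A H)"
      unfolding X_def W by (simp add: inner_diff_left inner_sum_left inner_vecm_outerp inner_vecm_one d1_def)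
    finally have 1: "(OmegaA A *v X) \<bullet> vecm H = \<dots>" .
    \<comment> \<open>\<open>d2\<close> carries a factor 1/2 from differentiating lambda^(-1/2); the
      2 here compensates for it and cancels against the 1/2 in \<open>gradA\<close>.\<close>
    have "(transpose Ed *v Svec g \<nu> A z) \<bullet> vecm H
        = (\<Sum>k\<in>UNIV. H $ k $ k / lam g A k - (\<Sum>a\<in>{a. g a = k}. 2 * (t a * d2 H a)))"
      unfolding inner_transpose_Ed
    proof (rule sum.cong[OF refl])
      fix k
      have "Svec g \<nu> A z $ k * H $ k $ k = H $ k $ k / lam g A k
          - (\<Sum>a\<in>{a. g a = k}. t a * FU g u a * (H $ k $ k / ((nb g k - 1) * lam g A k)))"
        by (simp add: Svec_def Let_def W left_diff_distrib sum_distrib_right sum_divide_distrib flip: u_def)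
      also have "(\<Sum>a\<in>{a. g a = k}. t a * FU g u a * (H $ k $ k / ((nb g k - 1) * lam g A k))) = (\<Sum>a\<in>{a. g a = k}. 2 * (t a * d2 H a))"
        by (rule sum.cong) (auto simp: d2_def)
      finally show "Svec g \<nu> A z $ k * H $ k $ k = H $ k $ k / lam g A k - (\<Sum>a\<in>{a. g a = k}. 2 * (t a * d2 H a))" .
    qed
    also have "\<dots> = (\<Sum>k\<in>UNIV. H $ k $ k / lam g A k) - 2 * (\<Sum>a\<in>UNIV. t a * d2 H a)"
      by (simp add: sum_subtractf sum_by_blocks[of "\<lambda>a. t a * d2 H a" g] sum_distrib_left)
    finally have 2: "(transpose Ed *v Svec g \<nu> A z) \<bullet> vecm H = \<dots>" .
    have "gradA g \<nu> A z \<bullet> vecm H = (OmegaA A *v X) \<bullet> vecm H + (1/2) * ((transpose Ed *v Svec g \<nu> A z) \<bullet> vecm H)"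
      by (simp add: gradA_def Let_def X_def u_def inner_add_left)
    moreover have "(\<Sum>a\<in>UNIV. (- d1 H a + d2 H a) * - t a) = (\<Sum>a\<in>UNIV. t a * d1 H a) - (\<Sum>a\<in>UNIV. t a * d2 H a)"
      by (simp add: sum_subtractf[symmetric] algebra_simps)
    ultimately show ?thesis unfolding 1 2 by (simp add: diff_divide_distrib)
  qed
  ultimately have "((\<lambda>B. - (1/2) * ln (det (blockC g B)) + (\<Sum>a\<in>UNIV. ln (t_std_dens (\<nu> a) (U B a)))) has_derivative
      (\<lambda>H. gradA g \<nu> A z \<bullet> vecm H)) ?F" by simp
  \<comment> \<open>\<open>U\<close> gives the residuals C^(-1/2) z only where the lift formulas
    apply. Symmetry holds on the set, positive definiteness and lambda_k > 0 persist near
    \<open>A\<close>, and agreement there transfers the derivative to \<open>loglik\<close>.\<close>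
  moreover have ev: "eventually (\<lambda>B. - (1/2) * ln (det (blockC g B)) + (\<Sum>a\<in>UNIV. ln (t_std_dens (\<nu> a) (U B a))) = loglik g \<nu> B z) ?F"
  proof -
    have "eventually (\<lambda>B. lam g B k > 0) ?F" for k
      using has_derivative_continuous[OF lam_has_derivative[of k ?F]] lam_pos[of k]
      by (auto simp: continuous_within intro: order_tendstoD)
    then have "eventually (\<lambda>B. \<forall>k. lam g B k > 0) ?F" by (rule eventually_all_finite)
    moreover have "eventually (\<lambda>B. symm_mat B) ?F"
      by (auto simp: eventually_at intro: exI[of _ 1])
    ultimately show ?thesis using eventually_posdef[OF pdA]
    proof eventually_elim
      case (elim B)
      have "(matrix_inv (msqrt (blockC g B)) *v z) $ a = U B a" for a
        using elim by (simp add: matrix_inv_msqrt_blockC[OF blocks] block_lift_mult_vec[OF blocks] U_def)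
      then show ?case by (simp add: loglik_def)
    qed
  qed
  moreover have "- (1/2) * ln (det (blockC g A)) + (\<Sum>a\<in>UNIV. ln (t_std_dens (\<nu> a) (U A a))) = loglik g \<nu> A z"
    by (simp add: loglik_def UA u_def Uv_def)
  ultimately show ?thesis
    by (rule has_derivative_transform_eventually) (simp add: symA)
qed

end

section \<open>Covariances and the information matrix\<close>

text \<open>Lebesgue measure on vectors is the image of a product measure indexed by basis vectors,
  over which products factor; \<open>h\<close> recovers the coordinate from its basis
  vector.\<close>

lemma has_bochner_integral_lborel_prod:
  fixes f :: "'n::finite \<Rightarrow> real \<Rightarrow> real"
  assumes f: "\<And>a. has_bochner_integral lborel (f a) (m a)"
  shows "has_bochner_integral lborel (\<lambda>x::real^'n. \<Prod>a\<in>UNIV. f a (x $ a)) (\<Prod>a\<in>UNIV. m a)"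
proof -
  interpret product_sigma_finite "\<lambda>_::real^'n. lborel :: real measure" by standard
  define h :: "real^'n \<Rightarrow> 'n" where "h = inv (\<lambda>a. axis a 1)"
  have h: "h (axis a 1) = a" for a
    unfolding h_def by (rule inv_f_f) (auto simp: inj_on_def axis_eq_axis)
  have [measurable]: "f a \<in> borel_measurable borel" for a
    using f[of a] by (auto simp: has_bochner_integral_iff dest: borel_measurable_integrable)
  let ?P = "Pi\<^sub>M (Basis :: (real^'n) set) (\<lambda>_. lborel :: real measure)"
  let ?s = "\<lambda>y::real^'n \<Rightarrow> real. \<Sum>b\<in>Basis. y b *\<^sub>R b"
  have s: "?s y $ a = y (axis a 1)" for y a
  proof -
    have "?s y \<bullet> axis a 1 = y (axis a 1)"
      by (rule inner_sum_left_Basis) (simp add: axis_in_Basis_iff)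
    then show ?thesis by (simp add: inner_axis)
  qed
  have eq: "(\<Prod>a\<in>UNIV. f a (?s y $ a)) = (\<Prod>b\<in>Basis. f (h b) (y b))" for y
    by (simp only: prod_Basis_vec h s)
  have int: "integrable lborel (f (h b))" for b using f has_bochner_integral_iff by blast
  have [measurable]: "?s \<in> measurable ?P borel" by measurable
  have meas: "(\<lambda>x::real^'n. \<Prod>a\<in>UNIV. f a (x $ a)) \<in> borel_measurable borel" by measurable
  have "integrable ?P (\<lambda>y. \<Prod>a\<in>UNIV. f a (?s y $ a))"
    unfolding eq by (rule product_integrable_prod) (use int in auto)
  moreover have "(\<integral>y. (\<Prod>a\<in>UNIV. f a (?s y $ a)) \<partial>?P) = (\<Prod>a\<in>UNIV. m a)"
    unfolding eq using f
    by (subst product_integral_prod) (auto simp: int prod_Basis_vec h has_bochner_integral_iff)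
  ultimately show ?thesis
    unfolding has_bochner_integral_iff lborel_eq[where 'a="real^'n"]
    using meas by (simp add: integrable_distr_eq integral_distr)
qed

lemma has_bochner_integral_lawU_prod:
  fixes h :: "'n::finite \<Rightarrow> real \<Rightarrow> real"
  assumes nu: "\<And>a. \<nu> a > 2"
    and [measurable]: "\<And>a. h a \<in> borel_measurable borel"
    and h: "\<And>a. has_bochner_integral lborel (\<lambda>x. t_std_dens (\<nu> a) x * h a x) (m a)"
  shows "has_bochner_integral (lawU \<nu>) (\<lambda>u. \<Prod>a\<in>UNIV. h a (u $ a)) (\<Prod>a\<in>UNIV. m a)"
  unfolding lawU_def
proof (rule has_bochner_integral_density)
  show "has_bochner_integral lborel (\<lambda>u. (\<Prod>a\<in>UNIV. t_std_dens (\<nu> a) (u $ a)) *\<^sub>R (\<Prod>a\<in>UNIV. h a (u $ a))) (\<Prod>a\<in>UNIV. m a)"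
    using has_bochner_integral_lborel_prod[OF h] by (simp add: prod.distrib)
  show "AE u in lborel. 0 \<le> (\<Prod>a\<in>UNIV. t_std_dens (\<nu> a) (u $ a))"
    using t_std_dens_pos[OF nu] by (auto intro!: prod_nonneg simp: less_imp_le)
qed measurable

text \<open>Writes a single coordinate as a product over all of them, the shape in which
  expectations factor.\<close>

lemma prod_power_of_bool:
  fixes x :: "'n::finite \<Rightarrow> real"
  shows "(\<Prod>e\<in>UNIV. x e ^ of_bool (e = a)) = x a"
proof -
  have "(\<Prod>e\<in>UNIV. x e ^ of_bool (e = a)) = (\<Prod>e\<in>UNIV. if e = a then x e else 1)"
    by (rule prod.cong) auto
  then show ?thesis by simp
qed

definition centered_form :: "('i::finite \<Rightarrow> real) \<Rightarrow> ('i \<Rightarrow> 'i \<Rightarrow> real) \<Rightarrow> real^'i \<Rightarrow> real" where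
  "centered_form \<nu> \<alpha> u = (\<Sum>a\<in>UNIV. \<Sum>b\<in>UNIV. \<alpha> a b * (t_score (\<nu> a) (u $ a) * u $ b - of_bool (a = b)))"

context
  fixes \<nu> :: "'i::finite \<Rightarrow> real"
  assumes nu: "\<And>a. \<nu> a > 2"
begin

private definition w :: "real^'i \<Rightarrow> 'i \<Rightarrow> real" where "w u a = t_score (\<nu> a) (u $ a)"

private lemma moment_prod:
  assumes "\<And>e. i e \<le> 2" "\<And>e. j e \<le> 2"
  shows "has_bochner_integral (lawU \<nu>) (\<lambda>u. \<Prod>e\<in>UNIV. w u e ^ i e * (u $ e) ^ j e) (\<Prod>e\<in>UNIV. t_moment (\<nu> e) (i e) (j e))"
  unfolding w_def
  by (rule has_bochner_integral_lawU_prod[where h="\<lambda>e x. t_score (\<nu> e) x ^ i e * x ^ j e"])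
     (auto simp: nu intro!: has_bochner_integral_t_moment assms)

private lemma moment2: "has_bochner_integral (lawU \<nu>) (\<lambda>u. w u a * u $ b) (of_bool (a = b))"
proof -
  have "has_bochner_integral (lawU \<nu>) (\<lambda>u. \<Prod>e\<in>UNIV. w u e ^ of_bool (e = a) * (u $ e) ^ of_bool (e = b))
      (\<Prod>e\<in>UNIV. t_moment (\<nu> e) (of_bool (e = a)) (of_bool (e = b)))"
    by (rule moment_prod) (simp_all add: of_bool_def)
  moreover have "(\<Prod>e\<in>UNIV. t_moment (\<nu> e) (of_bool (e = a)) (of_bool (e = b))) = of_bool (a = b)"
  proof (cases "a = b")
    case True
    then show ?thesis by (auto intro!: prod.neutral simp: t_moment_def of_bool_def)
  next
    case False
    then have "t_moment (\<nu> a) (of_bool (a = a)) (of_bool (a = b)) = 0" by (simp add: t_moment_def)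
    then have "(\<Prod>e\<in>UNIV. t_moment (\<nu> e) (of_bool (e = a)) (of_bool (e = b))) = 0"
      by (intro prod_zero bexI[of _ a]) auto
    then show ?thesis using False by simp
  qed
  ultimately show ?thesis by (simp add: prod.distrib prod_power_of_bool)
qed

text \<open>The three pairings of w_a u_b w_c u_d, as for Gaussian fourth moments, where pairing w
  with w costs psi. If all indices agree the pairings give 2 + psi in place of 3 phi; the last term
  corrects this.\<close>

private definition m4 :: "'i \<Rightarrow> 'i \<Rightarrow> 'i \<Rightarrow> 'i \<Rightarrow> real" where
  "m4 a b c d = of_bool (a = b \<and> c = d) + of_bool (a = d \<and> b = c) + of_bool (a = c \<and> b = d) * psi (\<nu> a)
     + of_bool (a = b \<and> b = c \<and> c = d) * (3 * phi (\<nu> a) - 2 - psi (\<nu> a))"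

private lemma moment4: "has_bochner_integral (lawU \<nu>) (\<lambda>u. w u a * u $ b * (w u c * u $ d)) (m4 a b c d)"
proof -
  \<comment> \<open>\<open>i\<close> and \<open>j\<close> count the occurrences of e among the score
    indices a, c and the variable indices b, d; both stay within the range of the moment
    table.\<close>
  define i where "i e = of_bool (e = a) + (of_bool (e = c) :: nat)" for e
  define j where "j e = of_bool (e = b) + (of_bool (e = d) :: nat)" for e
  have "has_bochner_integral (lawU \<nu>) (\<lambda>u. \<Prod>e\<in>UNIV. w u e ^ i e * (u $ e) ^ j e) (\<Prod>e\<in>UNIV. t_moment (\<nu> e) (i e) (j e))"
    by (rule moment_prod) (simp_all add: i_def j_def of_bool_def)
  moreover have "(\<Prod>e\<in>UNIV. w u e ^ i e * (u $ e) ^ j e) = w u a * u $ b * (w u c * u $ d)" for u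
    by (simp add: i_def j_def power_add prod.distrib prod_power_of_bool)
  moreover have "(\<Prod>e\<in>UNIV. t_moment (\<nu> e) (i e) (j e)) = m4 a b c d"
  proof -
    consider "a = b" "b = c" "c = d" | "a = c" "b = d" "a \<noteq> b" | "a = b" "c = d" "a \<noteq> c" | "a = d" "b = c" "a \<noteq> b"
      | "\<not> (a = b \<and> c = d)" "\<not> (a = c \<and> b = d)" "\<not> (a = d \<and> b = c)" by blast
    then show ?thesis
    proof cases
      case 1
      then have "(\<Prod>e\<in>UNIV. t_moment (\<nu> e) (i e) (j e)) = (\<Prod>e\<in>UNIV. if e = a then 3 * phi (\<nu> e) else 1)"
        by (intro prod.cong) (auto simp: i_def j_def t_moment_def)
      then show ?thesis using 1 by (simp add: m4_def)
    next
      case 2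
      then have "(\<Prod>e\<in>UNIV. t_moment (\<nu> e) (i e) (j e)) = (\<Prod>e\<in>UNIV. if e = a then psi (\<nu> e) else 1)"
        by (intro prod.cong) (auto simp: i_def j_def t_moment_def of_bool_def)
      then show ?thesis using 2 by (auto simp: m4_def)
    next
      case 3
      then have "(\<Prod>e\<in>UNIV. t_moment (\<nu> e) (i e) (j e)) = 1"
        by (intro prod.neutral) (auto simp: i_def j_def t_moment_def of_bool_def)
      then show ?thesis using 3 by (auto simp: m4_def)
    next
      case 4
      then have "(\<Prod>e\<in>UNIV. t_moment (\<nu> e) (i e) (j e)) = 1"
        by (intro prod.neutral) (auto simp: i_def j_def t_moment_def of_bool_def)
      then show ?thesis using 4 by (auto simp: m4_def)
    next
      case 5
      \<comment> \<open>some index occurs an odd number of times among \<open>a, b, c, d\<close>\<close>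
      have "\<exists>e. odd (i e + j e)"
      proof (rule ccontr)
        assume "\<not> ?thesis"
        then have "even (i a + j a)" "even (i b + j b)" "even (i c + j c)" "even (i d + j d)" by auto
        then show False using 5 unfolding i_def j_def
          by (cases "a = b"; cases "a = c"; cases "a = d"; cases "b = c"; cases "b = d"; cases "c = d") auto
      qed
      then obtain e where "odd (i e + j e)" by blast
      then have "t_moment (\<nu> e) (i e) (j e) = 0" by (simp add: t_moment_def)
      then have "(\<Prod>e\<in>UNIV. t_moment (\<nu> e) (i e) (j e)) = 0" by (intro prod_zero bexI[of _ e]) auto
      moreover have "m4 a b c d = 0"
      proof -
        have "(a = b \<and> c = d) = False" "(a = d \<and> b = c) = False" "(a = c \<and> b = d) = False"
          "(a = b \<and> b = c \<and> c = d) = False" using 5 by blast+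
        then show ?thesis unfolding m4_def by (simp only: of_bool_eq mult_zero_left add_0)
      qed
      ultimately show ?thesis by (simp only:)
    qed
  qed
  ultimately show ?thesis by simp
qed

private lemma prob_lawU: "has_bochner_integral (lawU \<nu>) (\<lambda>u. 1 :: real) 1"
  using moment_prod[of "\<lambda>_. 0" "\<lambda>_. 0"] by (simp add: t_moment_def)

lemma centered_form_covariance:
  "has_bochner_integral (lawU \<nu>) (\<lambda>u. centered_form \<nu> \<alpha> u * centered_form \<nu> \<beta> u)
    ((\<Sum>a\<in>UNIV. \<Sum>b\<in>UNIV. \<alpha> a b * \<beta> b a) + (\<Sum>a\<in>UNIV. \<Sum>b\<in>UNIV. \<alpha> a b * \<beta> a b * psi (\<nu> a))
      + (\<Sum>a\<in>UNIV. \<alpha> a a * \<beta> a a * (3 * phi (\<nu> a) - 2 - psi (\<nu> a))))"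
proof -
  \<comment> \<open>The fourth moment without the pairing a = b, c = d, which is the product of
    means removed by centering.\<close>
  define \<kappa> where "\<kappa> a b c d = of_bool (a = d \<and> b = c) + of_bool (a = c \<and> b = d) * psi (\<nu> a)
     + of_bool (a = b \<and> b = c \<and> c = d) * (3 * phi (\<nu> a) - 2 - psi (\<nu> a))" for a b c d
  have entry: "has_bochner_integral (lawU \<nu>)
      (\<lambda>u. (w u a * u $ b - of_bool (a = b)) * (w u c * u $ d - of_bool (c = d))) (\<kappa> a b c d)" for a b c d
  proof -
    have "has_bochner_integral (lawU \<nu>) (\<lambda>u. w u a * u $ b * (w u c * u $ d)
        - of_bool (c = d) * (w u a * u $ b) - of_bool (a = b) * (w u c * u $ d) + of_bool (a = b) * of_bool (c = d) * 1)
      (m4 a b c d - of_bool (c = d) * of_bool (a = b) - of_bool (a = b) * of_bool (c = d) + of_bool (a = b) * of_bool (c = d) * 1)"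
      by (intro has_bochner_integral_add has_bochner_integral_diff has_bochner_integral_mult_right moment4 moment2 prob_lawU)
    moreover have "m4 a b c d - of_bool (c = d) * of_bool (a = b) - of_bool (a = b) * of_bool (c = d) + of_bool (a = b) * of_bool (c = d) * 1 = \<kappa> a b c d"
      by (simp add: m4_def \<kappa>_def of_bool_conj)
    ultimately show ?thesis by (simp add: algebra_simps)
  qed
  have int: "has_bochner_integral (lawU \<nu>)
      (\<lambda>u. \<Sum>a\<in>UNIV. \<Sum>b\<in>UNIV. \<Sum>c\<in>UNIV. \<Sum>d\<in>UNIV. (\<alpha> a b * \<beta> c d) *
          ((w u a * u $ b - of_bool (a = b)) * (w u c * u $ d - of_bool (c = d))))
      (\<Sum>a\<in>UNIV. \<Sum>b\<in>UNIV. \<Sum>c\<in>UNIV. \<Sum>d\<in>UNIV. (\<alpha> a b * \<beta> c d) * \<kappa> a b c d)"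
    by (intro has_bochner_integral_sum has_bochner_integral_mult_right entry)
  have eq1: "(\<Sum>a\<in>UNIV. \<Sum>b\<in>UNIV. \<Sum>c\<in>UNIV. \<Sum>d\<in>UNIV. (\<alpha> a b * \<beta> c d) *
          ((w u a * u $ b - of_bool (a = b)) * (w u c * u $ d - of_bool (c = d)))) = centered_form \<nu> \<alpha> u * centered_form \<nu> \<beta> u" for u
    unfolding centered_form_def w_def[symmetric] unfolding sum_distrib_right unfolding sum_distrib_left
    by (simp add: mult_ac)
  have eq2: "(\<Sum>c\<in>UNIV. \<Sum>d\<in>UNIV. (\<alpha> a b * \<beta> c d) * \<kappa> a b c d)
      = \<alpha> a b * \<beta> b a + \<alpha> a b * \<beta> a b * psi (\<nu> a) + (if b = a then \<alpha> a a * \<beta> a a * (3 * phi (\<nu> a) - 2 - psi (\<nu> a)) else 0)" for a b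
  proof -
    have "(\<Sum>c\<in>UNIV. \<Sum>d\<in>UNIV. (\<alpha> a b * \<beta> c d) * \<kappa> a b c d)
      = (\<Sum>c\<in>UNIV. \<Sum>d\<in>UNIV. (if d = a then if c = b then \<alpha> a b * \<beta> b a else 0 else 0)
         + (if d = b then if c = a then \<alpha> a b * \<beta> a b * psi (\<nu> a) else 0 else 0)
         + (if d = a then if c = a then if b = a then \<alpha> a a * \<beta> a a * (3 * phi (\<nu> a) - 2 - psi (\<nu> a)) else 0 else 0 else 0))"
      unfolding \<kappa>_def distrib_left by (intro sum.cong refl arg_cong2[where f="(+)"]) auto
    then show ?thesis by (simp add: sum.distrib)
  qed
  show ?thesis
    using int unfolding eq1 eq2 by (simp only: sum.distrib sum.delta finite UNIV_I if_True)
qed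

end

section \<open>Matrix-valued expectations and the entries of the information matrix\<close>

lemma has_bochner_integral_matrix:
  fixes f :: "'a \<Rightarrow> real^'n::finite^'m::finite"
  assumes "\<And>p q. has_bochner_integral M (\<lambda>u. f u $ p $ q) (c $ p $ q)"
  shows "has_bochner_integral M f c"
proof -
  have e: "X = (\<Sum>p\<in>UNIV. \<Sum>q\<in>UNIV. (X $ p $ q) *\<^sub>R axis p (axis q 1))" for X :: "real^'n^'m"
  proof -
    have "(\<Sum>p\<in>UNIV. \<Sum>q\<in>UNIV. (X $ p $ q) *\<^sub>R axis p (axis q 1 :: real^'n)) $ i $ j
        = (\<Sum>p\<in>UNIV. \<Sum>q\<in>UNIV. if q = j then if p = i then X $ p $ q else 0 else 0)" for i j
      by (simp only: sum_component) (intro sum.cong refl, auto simp: axis_def)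
    then show ?thesis by (simp add: vec_eq_iff)
  qed
  have "has_bochner_integral M (\<lambda>u. \<Sum>p\<in>UNIV. \<Sum>q\<in>UNIV. (f u $ p $ q) *\<^sub>R axis p (axis q (1::real)))
      (\<Sum>p\<in>UNIV. \<Sum>q\<in>UNIV. (c $ p $ q) *\<^sub>R axis p (axis q 1))"
    by (intro has_bochner_integral_sum has_bochner_integral_scaleR_left assms)
  then show ?thesis by (simp only: e[symmetric])
qed

lemma matrix_mult_outerp: "M ** outerp x y = outerp (M *v x) y"
  by (simp add: vec_eq_iff outerp_def matrix_matrix_mult_def matrix_vector_mult_def sum_distrib_right mult.assoc)

lemma outerp_mult_matrix: "outerp x y ** transpose N = outerp x (N *v y)"
  by (simp add: vec_eq_iff outerp_def matrix_matrix_mult_def matrix_vector_mult_def transpose_def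
      sum_distrib_left mult.assoc) (simp add: mult.commute)

lemma outerp_mult: "outerp (M *v x) (N *v y) = M ** outerp x y ** transpose N"
  by (simp add: matrix_mult_outerp outerp_mult_matrix)

lemma outerp_add_left: "outerp (x + x') y = outerp x y + outerp x' y"
  and outerp_add_right: "outerp x (y + y') = outerp x y + outerp x y'"
  and outerp_scaleR_left: "outerp (c *\<^sub>R x) y = c *\<^sub>R outerp x y"
  and outerp_scaleR_right: "outerp x (c *\<^sub>R y) = c *\<^sub>R outerp x y"
  by (simp_all add: vec_eq_iff outerp_def algebra_simps)

lemma centered_form_eq:
  "centered_form \<nu> \<alpha> u = (\<Sum>a\<in>UNIV. \<Sum>b\<in>UNIV. \<alpha> a b * (t_score (\<nu> a) (u $ a) * u $ b)) - (\<Sum>a\<in>UNIV. \<alpha> a a)"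
proof -
  have "centered_form \<nu> \<alpha> u = (\<Sum>a\<in>UNIV. \<Sum>b\<in>UNIV. \<alpha> a b * (t_score (\<nu> a) (u $ a) * u $ b) - (if b = a then \<alpha> a b else 0))"
    unfolding centered_form_def by (intro sum.cong refl) (auto simp: right_diff_distrib)
  then show ?thesis by (simp add: sum_subtractf)
qed

text \<open>
  The entries of the bracket multiplied by \<open>\<Omega>\<^sub>A\<close> and the entries of \<open>S\<close> are the centered forms with
  coefficients \<open>mean_coeff\<close> and \<open>dev_coeff\<close>.
\<close>
definition mean_coeff :: "('i::finite \<Rightarrow> 'k::finite) \<Rightarrow> 'k \<times> 'k \<Rightarrow> 'i \<Rightarrow> 'i \<Rightarrow> real" where
  "mean_coeff g p a b = of_bool (g a = fst p) * (of_bool (g b = snd p) * (1 / (sqrt (nb g (fst p)) * sqrt (nb g (snd p)))))"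

definition dev_coeff :: "('i::finite \<Rightarrow> 'k::finite) \<Rightarrow> real^'k^'k \<Rightarrow> 'k \<Rightarrow> 'i \<Rightarrow> 'i \<Rightarrow> real" where
  "dev_coeff g A k a b = of_bool (g a = k) * (of_bool (g b = k) *
     (- 1 / ((nb g k - 1) * lam g A k) * (of_bool (a = b) - 1 / nb g k)))"

lemma sum_of_bool_block:
  fixes f :: "'i::finite \<Rightarrow> real"
  shows "(\<Sum>a\<in>UNIV. of_bool (g a = k) * f a) = (\<Sum>a\<in>{a. g a = k}. f a)"
  by (rule sum.mono_neutral_cong_right) auto

lemma sum_of_bool_block2:
  fixes f :: "'i::finite \<Rightarrow> 'i \<Rightarrow> real"
  shows "(\<Sum>a\<in>UNIV. \<Sum>b\<in>UNIV. of_bool (g a = k) * (of_bool (g b = l) * f a b)) = (\<Sum>a\<in>{a. g a = k}. \<Sum>b\<in>{b. g b = l}. f a b)"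
  by (simp only: sum_distrib_left[symmetric] sum_of_bool_block)

context
  fixes g :: "'i::finite \<Rightarrow> 'k::finite" and \<nu> :: "'i \<Rightarrow> real" and A :: "real^'k^'k"
  assumes blocks: "\<forall>k. card {a. g a = k} \<ge> 2" and nu: "\<forall>a. \<nu> a > 2"
    and symA: "symm_mat A" and pdA: "posdef A" and lam_pos: "\<And>k. lam g A k > 0"
begin

private lemmas nbp = nb_pos[OF blocks]
private lemmas nb1 = nb_gt_1[OF blocks]
private lemmas sum_const = sum_block_const[OF blocks]
private abbreviation "exc a \<equiv> 3 * phi (\<nu> a) - 2 - psi (\<nu> a)"

private lemma sum_psi: "(\<Sum>a\<in>{a. g a = k}. psi (\<nu> a)) = nb g k * psibar g \<nu> k"
  using nbp[of k] by (simp add: psibar_def)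

private lemma sum_exc: "(\<Sum>a\<in>{a. g a = k}. exc a) = nb g k * (3 * phibar g \<nu> k - 2 - psibar g \<nu> k)"
proof -
  have "(\<Sum>a\<in>{a. g a = k}. exc a) = 3 * (\<Sum>a\<in>{a. g a = k}. phi (\<nu> a)) - nb g k * 2 - (\<Sum>a\<in>{a. g a = k}. psi (\<nu> a))"
    by (simp only: sum_subtractf sum_const sum_distrib_left)
  moreover have "(\<Sum>a\<in>{a. g a = k}. phi (\<nu> a)) = nb g k * phibar g \<nu> k"
    using nbp[of k] by (simp add: phibar_def)
  ultimately show ?thesis by (simp add: sum_psi algebra_simps)
qed

private lemma Upse_nth:
  "Upse g \<nu> $ (k, l) $ (k', l') = of_bool (k = k' \<and> l = l') * psibar g \<nu> k
     + of_bool (k = l \<and> k = k' \<and> k = l') * ((3 * phibar g \<nu> k - 2 - psibar g \<nu> k) / nb g k)"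
proof -
  have "Upse g \<nu> $ (k, l) $ (k', l') = (\<Sum>j\<in>UNIV. (if j = k then of_bool (k = k' \<and> l = l') * psibar g \<nu> k else 0)
     + (if j = k then of_bool (k = l \<and> k = k' \<and> k = l') * ((3 * phibar g \<nu> k - 2 - psibar g \<nu> k) / nb g k) else 0))"
    unfolding Upse_def sum_component
    by (intro sum.cong refl) (auto simp: Psie_def kron_def Je_def outerp_def ev_def axis_def mat_def)
  then show ?thesis by (simp add: sum.distrib)
qed

private lemma ThetaM_nth:
  "ThetaM g \<nu> A $ k $ (l, l') = of_bool (k = l \<and> k = l') * ((psibar g \<nu> k + 2 - 3 * phibar g \<nu> k) / (lam g A k * nb g k))"
proof -
  have "ThetaM g \<nu> A $ k $ (l, l') = (\<Sum>j\<in>UNIV. if j = k then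
      of_bool (k = l \<and> k = l') * ((psibar g \<nu> k + 2 - 3 * phibar g \<nu> k) / (lam g A k * nb g k)) else 0)"
    unfolding ThetaM_def sum_component
    by (intro sum.cong refl) (auto simp: Je_def outerp_def ev_def axis_def vecm_def)
  then show ?thesis by simp
qed

text \<open>The coefficients are constant on pairs of blocks. Reversed indices force (k', l') = (l,
  k), the commutation matrix; indices in equal order force (k', l') = (k, l); the diagonal needs all
  four blocks equal.\<close>

private lemma mean_form_covariance:
  "has_bochner_integral (lawU \<nu>) (\<lambda>u. centered_form \<nu> (mean_coeff g p) u * centered_form \<nu> (mean_coeff g q) u) ((commK + Upse g \<nu>) $ p $ q)"
proof -
  obtain k l k' l' where pq: "p = (k, l)" "q = (k', l')" by (metis surj_pair)
  let ?c = "mean_coeff g"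
  have sq: "\<bar>nb g j\<bar> = nb g j" for j using nbp[of j] by simp
  have block: "(\<Sum>a\<in>UNIV. \<Sum>b\<in>UNIV. of_bool (g a = k) * (of_bool (g b = l) * (f a / (nb g k * nb g l)))) = (\<Sum>a\<in>{a. g a = k}. f a) / nb g k" for f
    unfolding sum_of_bool_block2 sum_const using nbp[of l] nbp[of k] by (simp add: sum_divide_distrib)
  have "(\<Sum>a\<in>UNIV. \<Sum>b\<in>UNIV. ?c p a b * ?c q b a)
      = of_bool (k = l' \<and> l = k') * (\<Sum>a\<in>UNIV. \<Sum>b\<in>UNIV. of_bool (g a = k) * (of_bool (g b = l) * (1 / (nb g k * nb g l))))"
    unfolding sum_distrib_left by (intro sum.cong refl) (auto simp: mean_coeff_def pq sq mult_ac)
  also have "\<dots> = commK $ p $ q"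
    unfolding block sum_const using nbp[of k] by (auto simp: commK_def pq)
  finally have 1: "(\<Sum>a\<in>UNIV. \<Sum>b\<in>UNIV. ?c p a b * ?c q b a) = commK $ p $ q" .
  have "(\<Sum>a\<in>UNIV. \<Sum>b\<in>UNIV. ?c p a b * ?c q a b * psi (\<nu> a))
      = of_bool (k = k' \<and> l = l') * (\<Sum>a\<in>UNIV. \<Sum>b\<in>UNIV. of_bool (g a = k) * (of_bool (g b = l) * (psi (\<nu> a) / (nb g k * nb g l))))"
    unfolding sum_distrib_left by (intro sum.cong refl) (auto simp: mean_coeff_def pq sq mult_ac)
  also have "\<dots> = of_bool (k = k' \<and> l = l') * psibar g \<nu> k"
    unfolding block sum_psi using nbp[of k] by simp
  finally have 2: "(\<Sum>a\<in>UNIV. \<Sum>b\<in>UNIV. ?c p a b * ?c q a b * psi (\<nu> a)) = \<dots>" .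
  have "(\<Sum>a\<in>UNIV. ?c p a a * ?c q a a * exc a)
      = of_bool (k = l \<and> k = k' \<and> k = l') * (\<Sum>a\<in>UNIV. of_bool (g a = k) * (exc a * (1 / (nb g k * nb g k))))"
    unfolding sum_distrib_left using nbp[of k] by (intro sum.cong refl) (auto simp: mean_coeff_def pq sq)
  also have "\<dots> = of_bool (k = l \<and> k = k' \<and> k = l') * ((3 * phibar g \<nu> k - 2 - psibar g \<nu> k) / nb g k)"
    unfolding sum_of_bool_block sum_distrib_right[symmetric] sum_exc using nbp[of k] by simp
  finally have 3: "(\<Sum>a\<in>UNIV. ?c p a a * ?c q a a * exc a) = \<dots>" .
  have "commK $ p $ q + of_bool (k = k' \<and> l = l') * psibar g \<nu> k
      + of_bool (k = l \<and> k = k' \<and> k = l') * ((3 * phibar g \<nu> k - 2 - psibar g \<nu> k) / nb g k) = (commK + Upse g \<nu>) $ p $ q"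
    by (simp add: pq Upse_nth)
  then show ?thesis
    using centered_form_covariance[of \<nu> "?c p" "?c q", OF nu[rule_format]] unfolding 1 2 3 by (simp only:)
qed

private lemma sum_dev: "g a = k \<Longrightarrow> (\<Sum>b\<in>{b. g b = k}. of_bool (a = b) - 1 / nb g k) = 0"
  using nbp[of k] by (simp only: sum_subtractf sum_const) (simp add: of_bool_def)

text \<open>These are the entries of a row of the projection I - v v'; symmetry and idempotence make
  its squared length the diagonal entry 1 - 1/n.\<close>

private lemma sum_dev_sq: "g a = k \<Longrightarrow> (\<Sum>b\<in>{b. g b = k}. (of_bool (a = b) - 1 / nb g k)\<^sup>2) = (nb g k - 1) / nb g k"
proof -
  assume a: "g a = k"
  have "(\<Sum>b\<in>{b. g b = k}. (of_bool (a = b) - 1 / nb g k)\<^sup>2) = (\<Sum>b\<in>{b. g b = k}. (if b = a then 1 - 2 / nb g k else 0) + 1 / (nb g k)\<^sup>2)"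
    by (intro sum.cong refl) (auto simp: power2_eq_square algebra_simps)
  also have "\<dots> = 1 - 2 / nb g k + nb g k * (1 / (nb g k)\<^sup>2)"
    using a by (simp only: sum.distrib sum_const) simp
  also have "\<dots> = (nb g k - 1) / nb g k"
    using nbp[of k] by (simp add: field_simps power2_eq_square)
  finally show ?thesis .
qed

text \<open>The coefficients are symmetric, so the reversed sum and the psi sum both run over
  squared projection entries; distinct blocks do not meet, which makes \<open>XiM\<close>
  diagonal.\<close>

private lemma dev_form_covariance:
  "has_bochner_integral (lawU \<nu>) (\<lambda>u. centered_form \<nu> (dev_coeff g A k) u * centered_form \<nu> (dev_coeff g A l) u) (XiM g \<nu> A $ k $ l)"
proof -
  let ?c = "dev_coeff g A"
  define n where "n = nb g k"
  define B where "B = (n - 1) * lam g A k"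
  have n: "n > 0" "n - 1 > 0" using nbp[of k] nb1[of k] by (auto simp: n_def)
  have block: "(\<Sum>a\<in>UNIV. \<Sum>b\<in>UNIV. of_bool (g a = k) * (of_bool (g b = k) * (f a / B\<^sup>2 * (of_bool (a = b) - 1 / nb g k)\<^sup>2)))
      = (\<Sum>a\<in>{a. g a = k}. f a) * ((n - 1) / n / B\<^sup>2)" for f
  proof -
    have "(\<Sum>a\<in>UNIV. \<Sum>b\<in>UNIV. of_bool (g a = k) * (of_bool (g b = k) * (f a / B\<^sup>2 * (of_bool (a = b) - 1 / nb g k)\<^sup>2)))
      = (\<Sum>a\<in>{a. g a = k}. f a * ((n - 1) / n / B\<^sup>2))"
      unfolding sum_of_bool_block2 unfolding sum_distrib_left[symmetric] n_def
      by (intro sum.cong refl) (simp add: sum_dev_sq)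
    then show ?thesis by (simp only: sum_distrib_right)
  qed
  have "(\<Sum>a\<in>UNIV. \<Sum>b\<in>UNIV. ?c k a b * ?c l b a)
      = of_bool (k = l) * (\<Sum>a\<in>UNIV. \<Sum>b\<in>UNIV. of_bool (g a = k) * (of_bool (g b = k) * (1 / B\<^sup>2 * (of_bool (a = b) - 1 / nb g k)\<^sup>2)))"
    unfolding sum_distrib_left by (intro sum.cong refl) (auto simp: dev_coeff_def n_def B_def power2_eq_square)
  also have "\<dots> = of_bool (k = l) * ((n - 1) / B\<^sup>2)"
    unfolding block sum_const using n by (simp add: n_def)
  finally have 1: "(\<Sum>a\<in>UNIV. \<Sum>b\<in>UNIV. ?c k a b * ?c l b a) = \<dots>" .
  have "(\<Sum>a\<in>UNIV. \<Sum>b\<in>UNIV. ?c k a b * ?c l a b * psi (\<nu> a))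
      = of_bool (k = l) * (\<Sum>a\<in>UNIV. \<Sum>b\<in>UNIV. of_bool (g a = k) * (of_bool (g b = k) * (psi (\<nu> a) / B\<^sup>2 * (of_bool (a = b) - 1 / nb g k)\<^sup>2)))"
    unfolding sum_distrib_left by (intro sum.cong refl) (auto simp: dev_coeff_def n_def B_def power2_eq_square)
  also have "\<dots> = of_bool (k = l) * ((n - 1) * psibar g \<nu> k / B\<^sup>2)"
    unfolding block sum_psi using n by (simp add: n_def)
  finally have 2: "(\<Sum>a\<in>UNIV. \<Sum>b\<in>UNIV. ?c k a b * ?c l a b * psi (\<nu> a)) = \<dots>" .
  have "(\<Sum>a\<in>UNIV. ?c k a a * ?c l a a * exc a)
      = of_bool (k = l) * (\<Sum>a\<in>UNIV. of_bool (g a = k) * (exc a * ((1 - 1 / n)\<^sup>2 / B\<^sup>2)))"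
    unfolding sum_distrib_left by (intro sum.cong refl) (auto simp: dev_coeff_def n_def B_def power2_eq_square)
  also have "\<dots> = of_bool (k = l) * (n * (3 * phibar g \<nu> k - 2 - psibar g \<nu> k) * ((1 - 1 / n)\<^sup>2 / B\<^sup>2))"
    unfolding sum_of_bool_block sum_distrib_right[symmetric] sum_exc n_def ..
  finally have 3: "(\<Sum>a\<in>UNIV. ?c k a a * ?c l a a * exc a) = \<dots>" .
  have "(n - 1) / B\<^sup>2 + (n - 1) * psibar g \<nu> k / B\<^sup>2 + n * (3 * phibar g \<nu> k - 2 - psibar g \<nu> k) * ((1 - 1 / n)\<^sup>2 / B\<^sup>2)
      = (3 * phibar g \<nu> k - 1 + (psibar g \<nu> k + 1) / (n - 1)) / ((lam g A k)\<^sup>2 * n)" (is "?L = ?R")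
  proof -
    \<comment> \<open>In these variables the three sums are y/(m L) + x/(L n), and x + y = 3 phibar
      - 1 produces the numerator of \<open>XiM\<close>.\<close>
    define m x y L where "m = n - 1" and "x = 3 * phibar g \<nu> k - 2 - psibar g \<nu> k"
      and "y = psibar g \<nu> k + 1" and "L = (lam g A k)\<^sup>2"
    have m: "m > 0" "n = m + 1" "L > 0" using n lam_pos[of k] by (auto simp: m_def L_def)
    have B2: "B\<^sup>2 = m * m * L" by (simp add: B_def m_def L_def power_mult_distrib power2_eq_square)
    have "?L = m * y / B\<^sup>2 + n * x * ((1 - 1 / n)\<^sup>2 / B\<^sup>2)"
      unfolding x_def[symmetric] m_def[symmetric] by (simp add: y_def add_divide_distrib distrib_left)
    also have "m * y / B\<^sup>2 = y / (m * L)" using m by (simp add: B2)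
    also have "n * x * ((1 - 1 / n)\<^sup>2 / B\<^sup>2) = x / (L * n)"
    proof -
      have "1 - 1 / n = m / n" using n by (simp add: m_def field_simps)
      then show ?thesis unfolding B2 using m n by (simp add: power2_eq_square)
    qed
    also have "y / (m * L) + x / (L * n) = (x + y + y / m) / (L * n)"
    proof -
      have "y + y / m = y * n / m" using m by (simp add: field_simps)
      then have "(x + y + y / m) / (L * n) = x / (L * n) + y * n / m / (L * n)"
        by (simp only: add.assoc add_divide_distrib[symmetric])
      then show ?thesis using m n by simp
    qed
    also have "\<dots> = ?R" by (simp add: x_def y_def m_def L_def)
    finally show ?thesis .
  qed
  then have "of_bool (k = l) * ((n - 1) / B\<^sup>2) + of_bool (k = l) * ((n - 1) * psibar g \<nu> k / B\<^sup>2)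
      + of_bool (k = l) * (n * (3 * phibar g \<nu> k - 2 - psibar g \<nu> k) * ((1 - 1 / n)\<^sup>2 / B\<^sup>2)) = XiM g \<nu> A $ k $ l"
    by (auto simp: XiM_def n_def)
  then show ?thesis
    using centered_form_covariance[of \<nu> "?c k" "?c l", OF nu[rule_format]] unfolding 1 2 3 by (simp only:)
qed

text \<open>Mean coefficients are constant on a block while deviation coefficients sum to zero along
  rows, so two covariance terms vanish; only the diagonal fourth-moment term links the two parts of
  the score.\<close>

private lemma dev_mean_covariance:
  "has_bochner_integral (lawU \<nu>) (\<lambda>u. centered_form \<nu> (dev_coeff g A k) u * centered_form \<nu> (mean_coeff g p) u) (ThetaM g \<nu> A $ k $ p)"
proof -
  obtain l l' where p: "p = (l, l')" by (metis surj_pair)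
  let ?c = "dev_coeff g A k" and ?d = "mean_coeff g p"
  define n where "n = nb g k"
  define B where "B = (n - 1) * lam g A k"
  have n: "n > 0" "n - 1 > 0" using nbp[of k] nb1[of k] by (auto simp: n_def)
  have sq: "\<bar>nb g j\<bar> = nb g j" for j using nbp[of j] by simp
  have block: "(\<Sum>a\<in>UNIV. \<Sum>b\<in>UNIV. of_bool (g a = k) * (of_bool (g b = k) * (f a * (of_bool (a = b) - 1 / nb g k)))) = 0" for f
    unfolding sum_of_bool_block2 unfolding sum_distrib_left[symmetric] by (rule sum.neutral) (simp add: sum_dev)
  have "(\<Sum>a\<in>UNIV. \<Sum>b\<in>UNIV. ?c a b * ?d b a)
      = of_bool (k = l \<and> k = l') * (\<Sum>a\<in>UNIV. \<Sum>b\<in>UNIV. of_bool (g a = k) * (of_bool (g b = k) * (- 1 / B * (1 / n) * (of_bool (a = b) - 1 / nb g k))))"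
    unfolding sum_distrib_left by (intro sum.cong refl) (auto simp: dev_coeff_def mean_coeff_def p sq n_def B_def)
  then have 1: "(\<Sum>a\<in>UNIV. \<Sum>b\<in>UNIV. ?c a b * ?d b a) = 0" unfolding block by simp
  have "(\<Sum>a\<in>UNIV. \<Sum>b\<in>UNIV. ?c a b * ?d a b * psi (\<nu> a))
      = of_bool (k = l \<and> k = l') * (\<Sum>a\<in>UNIV. \<Sum>b\<in>UNIV. of_bool (g a = k) * (of_bool (g b = k) * (- 1 / B * (1 / n) * psi (\<nu> a) * (of_bool (a = b) - 1 / nb g k))))"
    unfolding sum_distrib_left by (intro sum.cong refl) (auto simp: dev_coeff_def mean_coeff_def p sq n_def B_def)
  then have 2: "(\<Sum>a\<in>UNIV. \<Sum>b\<in>UNIV. ?c a b * ?d a b * psi (\<nu> a)) = 0" unfolding block by simp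
  have "(\<Sum>a\<in>UNIV. ?c a a * ?d a a * exc a)
      = of_bool (k = l \<and> k = l') * (\<Sum>a\<in>UNIV. of_bool (g a = k) * (exc a * (- 1 / B * (1 - 1 / n) * (1 / n))))"
    unfolding sum_distrib_left by (intro sum.cong refl) (auto simp: dev_coeff_def mean_coeff_def p sq n_def B_def)
  also have "\<dots> = of_bool (k = l \<and> k = l') * (n * (3 * phibar g \<nu> k - 2 - psibar g \<nu> k) * (- 1 / B * (1 - 1 / n) * (1 / n)))"
    unfolding sum_of_bool_block sum_distrib_right[symmetric] sum_exc n_def ..
  also have "n * (3 * phibar g \<nu> k - 2 - psibar g \<nu> k) * (- 1 / B * (1 - 1 / n) * (1 / n))
      = (psibar g \<nu> k + 2 - 3 * phibar g \<nu> k) / (lam g A k * n)"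
  proof -
    have "1 - 1 / n = (n - 1) / n" using n by (simp add: field_simps)
    then have "- 1 / B * (1 - 1 / n) * (1 / n) = - (1 / (lam g A k * n * n))"
      using n lam_pos[of k] by (simp add: B_def)
    moreover have "n * x * (- (1 / (lam g A k * n * n))) = (- x) / (lam g A k * n)" for x using n by simp
    moreover have "- (3 * phibar g \<nu> k - 2 - psibar g \<nu> k) = psibar g \<nu> k + 2 - 3 * phibar g \<nu> k" by simp
    ultimately show ?thesis by (simp only:)
  qed
  finally have 3: "(\<Sum>a\<in>UNIV. ?c a a * ?d a a * exc a) = ThetaM g \<nu> A $ k $ p"
    by (simp add: p ThetaM_nth n_def)
  show ?thesis
    using centered_form_covariance[of \<nu> ?c ?d, OF nu[rule_format]] unfolding 1 2 3 by simp
qed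

section \<open>The score as a function of u, and its second moment\<close>

private lemma Uv_msqrt: "Uv g A (msqrt (blockC g A) *v u) = u"
  using posdef_invertible(2)[OF msqrt_blockC_props(2)[OF blocks symA pdA lam_pos]]
  by (simp add: Uv_def matrix_vector_mul_assoc)

text \<open>The scaled block means of C^(1/2) u are A^(1/2) times those of u, and the inverse root
  in \<open>X0\<close> cancels this factor.\<close>

private lemma X0_msqrt: "X0 g A (msqrt (blockC g A) *v u) = Y0 g u"
  using posdef_invertible(2)[OF msqrt_props(2)[OF symA pdA]]
  by (simp add: X0_def blockC_eq_block_lift[OF blocks] msqrt_block_lift[OF blocks symA pdA lam_pos]
      Y0_block_lift[OF blocks] matrix_vector_mul_assoc)

private lemma Wt_score: "Wt \<nu> u a * u $ a = t_score (\<nu> a) (u $ a)"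
  by (simp add: Wt_def t_score_def)

private lemma mean_vec_nth:
  "((\<Sum>a\<in>UNIV. (Wt \<nu> u a * u $ a / sqrt (nb g (g a))) *\<^sub>R vecm (outerp (ev (g a)) (Y0 g u))) - vecm (mat 1)) $ p
    = centered_form \<nu> (mean_coeff g p) u"
proof -
  obtain k l where p: "p = (k, l)" by (metis surj_pair)
  have "(\<Sum>a\<in>UNIV. (Wt \<nu> u a * u $ a / sqrt (nb g (g a))) *\<^sub>R vecm (outerp (ev (g a)) (Y0 g u))) $ p
      = (\<Sum>a\<in>UNIV. of_bool (g a = k) * (t_score (\<nu> a) (u $ a) / sqrt (nb g k) * Y0 g u $ l))"
    unfolding sum_component Wt_score
    by (intro sum.cong refl) (auto simp: p outerp_def ev_def axis_def)
  also have "\<dots> = (\<Sum>a\<in>UNIV. of_bool (g a = k) * (\<Sum>b\<in>UNIV. of_bool (g b = l) *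
      (t_score (\<nu> a) (u $ a) * u $ b / (sqrt (nb g k) * sqrt (nb g l)))))"
    unfolding sum_of_bool_block
    by (intro sum.cong refl) (simp add: Y0_def sum_distrib_left sum_divide_distrib)
  also have "\<dots> = (\<Sum>a\<in>UNIV. \<Sum>b\<in>UNIV. mean_coeff g p a b * (t_score (\<nu> a) (u $ a) * u $ b))"
    unfolding sum_distrib_left by (intro sum.cong refl) (simp add: mean_coeff_def p)
  finally have 1: "(\<Sum>a\<in>UNIV. (Wt \<nu> u a * u $ a / sqrt (nb g (g a))) *\<^sub>R vecm (outerp (ev (g a)) (Y0 g u))) $ p = \<dots>" .
  have "(\<Sum>a\<in>UNIV. mean_coeff g p a a) = (\<Sum>a\<in>UNIV. of_bool (g a = k) * (of_bool (k = l) * (1 / nb g k)))"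
    using nbp by (intro sum.cong refl) (auto simp: mean_coeff_def p less_imp_le)
  also have "\<dots> = vecm (mat 1) $ p"
    unfolding sum_of_bool_block sum_const using nbp[of k] by (simp add: p mat_def)
  finally have 2: "(\<Sum>a\<in>UNIV. mean_coeff g p a a) = vecm (mat 1) $ p" .
  show ?thesis unfolding vector_minus_component 1 centered_form_eq 2 ..
qed

text \<open>The coefficients have diagonal sum -1/lambda_k, so the leading 1/lambda_k of S is
  precisely the centering constant.\<close>

private lemma Svec_nth:
  "Svec g \<nu> A (msqrt (blockC g A) *v u) $ k = centered_form \<nu> (dev_coeff g A k) u"
proof -
  define c where "c = - 1 / ((nb g k - 1) * lam g A k)"
  have "(\<Sum>a\<in>UNIV. \<Sum>b\<in>UNIV. dev_coeff g A k a b * (t_score (\<nu> a) (u $ a) * u $ b))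
      = (\<Sum>a\<in>UNIV. \<Sum>b\<in>UNIV. of_bool (g a = k) * (of_bool (g b = k) * (c * t_score (\<nu> a) (u $ a) * ((of_bool (a = b) - 1 / nb g k) * u $ b))))"
    by (intro sum.cong refl) (simp add: dev_coeff_def c_def)
  also have "\<dots> = (\<Sum>a\<in>{a. g a = k}. c * t_score (\<nu> a) (u $ a) * FU g u a)"
    unfolding sum_of_bool_block2 unfolding sum_distrib_left[symmetric]
  proof (intro sum.cong refl)
    fix a assume "a \<in> {a. g a = k}"
    then have a: "g a = k" by simp
    have "(\<Sum>b\<in>{b. g b = k}. (of_bool (a = b) - 1 / nb g k) * u $ b) = (\<Sum>b\<in>{b. g b = k}. (if b = a then u $ b else 0) - u $ b / nb g k)"
      by (intro sum.cong refl) (auto simp: left_diff_distrib)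
    also have "\<dots> = FU g u a"
      using a by (simp add: sum_subtractf FU_def sum_divide_distrib)
    finally show "c * t_score (\<nu> a) (u $ a) * (\<Sum>b\<in>{b. g b = k}. (of_bool (a = b) - 1 / nb g k) * u $ b) = c * t_score (\<nu> a) (u $ a) * FU g u a"
      by (simp only:)
  qed
  finally have 1: "(\<Sum>a\<in>UNIV. \<Sum>b\<in>UNIV. dev_coeff g A k a b * (t_score (\<nu> a) (u $ a) * u $ b))
      = c * (\<Sum>a\<in>{a. g a = k}. t_score (\<nu> a) (u $ a) * FU g u a)"
    by (simp only: sum_distrib_left mult.assoc)
  have "(\<Sum>a\<in>UNIV. dev_coeff g A k a a) = (\<Sum>a\<in>UNIV. of_bool (g a = k) * (c * (1 - 1 / nb g k)))"
    by (intro sum.cong refl) (simp add: dev_coeff_def c_def)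
  also have "\<dots> = - (1 / lam g A k)"
  proof -
    have "nb g k * (c * (1 - 1 / nb g k)) = c * (nb g k - 1)"
      using nbp[of k] by (simp add: field_simps)
    also have "\<dots> = - (1 / lam g A k)" using nb1[of k] by (simp add: c_def)
    finally show ?thesis unfolding sum_of_bool_block sum_const .
  qed
  finally have 2: "(\<Sum>a\<in>UNIV. dev_coeff g A k a a) = - (1 / lam g A k)" .
  show ?thesis
    unfolding centered_form_eq 1 2 by (simp add: Svec_def Let_def Uv_msqrt Wt_score c_def)
qed

text \<open>The score is \<open>OmegaA\<close> applied to X plus half of E_d' T; its outer product
  splits into four products with constant outer factors, through which the expectation passes by
  linearity.\<close>

lemma information_matrix:
  "has_bochner_integral (lawU \<nu>)
     (\<lambda>u. outerp (gradA g \<nu> A (msqrt (blockC g A) *v u)) (gradA g \<nu> A (msqrt (blockC g A) *v u))) (InfoA g \<nu> A)"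
proof -
  let ?R = "msqrt (blockC g A)" and ?O = "OmegaA A" and ?E = "Ed :: real^('k \<times> 'k)^'k"
  define X where "X u = (\<Sum>a\<in>UNIV. (Wt \<nu> u a * u $ a / sqrt (nb g (g a))) *\<^sub>R vecm (outerp (ev (g a)) (Y0 g u))) - vecm (mat 1)" for u
  define T where "T u = Svec g \<nu> A (?R *v u)" for u
  have X: "X u $ p = centered_form \<nu> (mean_coeff g p) u" for u p
    unfolding X_def by (rule mean_vec_nth)
  have T: "T u $ k = centered_form \<nu> (dev_coeff g A k) u" for u k
    unfolding T_def by (rule Svec_nth)
  have XX: "has_bochner_integral (lawU \<nu>) (\<lambda>u. outerp (X u) (X u)) (commK + Upse g \<nu>)"
    by (rule has_bochner_integral_matrix) (simp add: outerp_def X mean_form_covariance del: vector_add_component)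
  have TT: "has_bochner_integral (lawU \<nu>) (\<lambda>u. outerp (T u) (T u)) (XiM g \<nu> A)"
    by (rule has_bochner_integral_matrix) (simp add: outerp_def T dev_form_covariance)
  have TX: "has_bochner_integral (lawU \<nu>) (\<lambda>u. outerp (T u) (X u)) (ThetaM g \<nu> A)"
    by (rule has_bochner_integral_matrix) (simp add: outerp_def T X dev_mean_covariance)
  have XT: "has_bochner_integral (lawU \<nu>) (\<lambda>u. outerp (X u) (T u)) (transpose (ThetaM g \<nu> A))"
  proof (rule has_bochner_integral_matrix)
    fix p k show "has_bochner_integral (lawU \<nu>) (\<lambda>u. outerp (X u) (T u) $ p $ k) (transpose (ThetaM g \<nu> A) $ p $ k)"
      using dev_mean_covariance[of k p] by (simp add: outerp_def T X transpose_def mult.commute)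
  qed
  have sandwich: "has_bochner_integral (lawU \<nu>) (\<lambda>u. M ** f u ** N) (M ** c ** N)"
    if "has_bochner_integral (lawU \<nu>) f c"
    for f :: "real^'i \<Rightarrow> real^'m::finite^'n::finite" and c and M :: "real^'n^('k \<times> 'k)" and N :: "real^('k \<times> 'k)^'m"
    by (rule has_bochner_integral_bounded_linear[OF _ that])
       (intro matmul.bounded_linear_left[THEN bounded_linear_compose] matmul.bounded_linear_right)
  have "has_bochner_integral (lawU \<nu>) (\<lambda>u. ?O ** outerp (X u) (X u) ** ?O
      + (1/4) *\<^sub>R (transpose ?E ** outerp (T u) (T u) ** ?E)
      + (1/2) *\<^sub>R (transpose ?E ** outerp (T u) (X u) ** ?O)
      + (1/2) *\<^sub>R (?O ** outerp (X u) (T u) ** ?E)) (InfoA g \<nu> A)"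
    unfolding InfoA_def
    by (intro has_bochner_integral_add has_bochner_integral_scaleR_right sandwich XX TT TX XT)
  moreover have "?O ** outerp (X u) (X u) ** ?O
      + (1/4) *\<^sub>R (transpose ?E ** outerp (T u) (T u) ** ?E)
      + (1/2) *\<^sub>R (transpose ?E ** outerp (T u) (X u) ** ?O)
      + (1/2) *\<^sub>R (?O ** outerp (X u) (T u) ** ?E)
      = outerp (gradA g \<nu> A (?R *v u)) (gradA g \<nu> A (?R *v u))" for u
  proof -
    have "gradA g \<nu> A (?R *v u) = ?O *v X u + (1/2) *\<^sub>R (transpose ?E *v T u)"
      by (simp add: gradA_def Let_def Uv_msqrt X0_msqrt X_def T_def del: transpose_matrix_vector)
    then show ?thesis
      by (simp add: outerp_add_left outerp_add_right outerp_scaleR_left outerp_scaleR_right outerp_mult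
          transpose_OmegaA[OF symA pdA] scaleR_add_right del: transpose_matrix_vector)
  qed
  ultimately show ?thesis by simp
qed

text \<open>Certifies \<open>loglik\<close> as the log-density of Z: the factor (det C)^(-1/2) is
  the Jacobian 1/|det R| of z = R u, because det C = (det R)^2.\<close>

lemma distr_lawU:
  "distr (lawU \<nu>) lborel (\<lambda>u. msqrt (blockC g A) *v u) = density lborel (\<lambda>z. ennreal (exp (loglik g \<nu> A z)))"
proof (rule measure_eqI)
  let ?R = "msqrt (blockC g A)"
  have [measurable]: "(\<lambda>x. M *v x) \<in> borel_measurable borel" for M :: "real^'i^'i"
    by (intro borel_measurable_continuous_onI continuous_intros)
  have [measurable]: "(\<lambda>x. (M *v x) $ a) \<in> borel_measurable borel" for M :: "real^'i^'i" and a
    by (intro borel_measurable_continuous_onI continuous_intros)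
  have [measurable]: "loglik g \<nu> A \<in> borel_measurable borel"
    unfolding loglik_def[abs_def] by measurable
  note det = det_msqrt_blockC[OF blocks symA pdA lam_pos]
  have lik: "\<bar>det ?R\<bar> * exp (loglik g \<nu> A (?R *v u)) = (\<Prod>a\<in>UNIV. t_std_dens (\<nu> a) (u $ a))" for u
  proof -
    have "matrix_inv ?R *v (?R *v u) = u" using Uv_msqrt[of u] by (simp add: Uv_def)
    moreover have "- (1/2) * ln (det (blockC g A)) = - ln \<bar>det ?R\<bar>"
      using det(1) ln_realpow[of "\<bar>det ?R\<bar>" 2] by (simp add: det(2))
    ultimately have "loglik g \<nu> A (?R *v u) = - ln \<bar>det ?R\<bar> + (\<Sum>a\<in>UNIV. ln (t_std_dens (\<nu> a) (u $ a)))"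
      by (simp only: loglik_def)
    then have "exp (loglik g \<nu> A (?R *v u)) = exp (- ln \<bar>det ?R\<bar>) * (\<Prod>a\<in>UNIV. exp (ln (t_std_dens (\<nu> a) (u $ a))))"
      by (simp only: exp_add exp_sum finite)
    moreover have "exp (ln (t_std_dens (\<nu> a) (u $ a))) = t_std_dens (\<nu> a) (u $ a)" for a
      using t_std_dens_pos[of "\<nu> a"] nu by simp
    moreover have "\<bar>det ?R\<bar> * exp (- ln \<bar>det ?R\<bar>) = 1"
      using det(1) by (simp add: exp_minus)
    ultimately show ?thesis by (simp only: mult.assoc[symmetric] mult_1_left)
  qed
  show "sets (distr (lawU \<nu>) lborel (\<lambda>u. ?R *v u)) = sets (density lborel (\<lambda>z. ennreal (exp (loglik g \<nu> A z))))"
    by simp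
  fix B assume "B \<in> sets (distr (lawU \<nu>) lborel (\<lambda>u. ?R *v u))"
  then have [measurable]: "B \<in> sets borel" by simp
  have [measurable_cong]: "sets (lawU \<nu>) = sets borel" by (simp add: lawU_def)
  have sp: "space (lawU \<nu>) = UNIV" by (simp add: lawU_def)
  have vim: "(\<lambda>u. ?R *v u) -` B \<in> sets borel"
    using measurable_sets[of "\<lambda>u. ?R *v u" borel borel B] by simp
  have "emeasure (distr (lawU \<nu>) lborel (\<lambda>u. ?R *v u)) B = emeasure (lawU \<nu>) ((\<lambda>u. ?R *v u) -` B)"
    by (subst emeasure_distr) (simp_all add: sp)
  also have "\<dots> = (\<integral>\<^sup>+ u. ennreal (\<Prod>a\<in>UNIV. t_std_dens (\<nu> a) (u $ a)) * indicator ((\<lambda>u. ?R *v u) -` B) u \<partial>lborel)"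
    unfolding lawU_def by (rule emeasure_density) (use vim in \<open>simp_all\<close>)
  also have "\<dots> = (\<integral>\<^sup>+ u. ennreal \<bar>det ?R\<bar> * (ennreal (exp (loglik g \<nu> A (?R *v u))) * indicator B (?R *v u)) \<partial>lborel)"
    by (intro nn_integral_cong) (simp add: lik[symmetric] ennreal_mult mult.assoc indicator_def)
  also have "\<dots> = ennreal \<bar>det ?R\<bar> * (\<integral>\<^sup>+ u. ennreal (exp (loglik g \<nu> A (?R *v u))) * indicator B (?R *v u) \<partial>lborel)"
    by (rule nn_integral_cmult) measurable
  also have "\<dots> = (\<integral>\<^sup>+ z. ennreal (exp (loglik g \<nu> A z)) * indicator B z \<partial>lborel)"
    by (rule nn_integral_lborel_linear[symmetric]) (use det in \<open>auto\<close>)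
  also have "\<dots> = emeasure (density lborel (\<lambda>z. ennreal (exp (loglik g \<nu> A z)))) B"
    by (rule emeasure_density[symmetric]) auto
  finally show "emeasure (distr (lawU \<nu>) lborel (\<lambda>u. ?R *v u)) B = \<dots>" .
qed

end

text \<open>Expectations over Z are taken over u at z = C^(1/2) u. Integrability is a separate claim
  because the Bochner integral of a nonintegrable function defaults to 0.\<close>

theorem theorem5:
  fixes g :: "'i::finite \<Rightarrow> 'k::finite"
    and \<nu> :: "'i \<Rightarrow> real"
    and A :: "real^'k^'k"
  assumes blocks: "\<forall>k. card {a. g a = k} \<ge> 2"
    and nu: "\<forall>a. \<nu> a > 2"
    and symA: "symm_mat A"
    and pdA: "posdef A"
    and lam_pos: "\<forall>k. lam g A k > 0"
  shows "(distr (lawU \<nu>) lborel (\<lambda>u. msqrt (blockC g A) *v u)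
           = density lborel (\<lambda>z. ennreal (exp (loglik g \<nu> A z))))
         \<and> (\<forall>z. ((\<lambda>B. loglik g \<nu> B z) has_derivative (\<lambda>H. gradA g \<nu> A z \<bullet> vecm H))
              (at A within {B. symm_mat B}))
         \<and> integrable (lawU \<nu>)
           (\<lambda>u. outerp (gradA g \<nu> A (msqrt (blockC g A) *v u)) (gradA g \<nu> A (msqrt (blockC g A) *v u)))
         \<and> integral\<^sup>L (lawU \<nu>)
           (\<lambda>u. outerp (gradA g \<nu> A (msqrt (blockC g A) *v u)) (gradA g \<nu> A (msqrt (blockC g A) *v u)))
         = InfoA g \<nu> A"
  using distr_lawU[OF blocks nu symA pdA] loglik_has_derivative[OF blocks symA pdA _ nu]
    information_matrix[OF blocks nu symA pdA] lam_pos
  by (auto simp: has_bochner_integral_iff)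

end
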